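(* Let $q$ be a prime power and let $V_2$ be a non-degenerate Hermitian surface in $\mathbb{P}^3$ over $\mathbb{F}_{q^2}$. There exist three planes $\Pi_1,\Pi_2,\Pi_3$ tangent to $V_2$ such that (a) for $i\neq j$, the line $\ell_{ij}=\Pi_i\cap\Pi_j$ is a secant line; (b) $|\Pi_1\cap\Pi_2\cap\Pi_3\cap V_2|=1$. In particular, there exists a homogeneous polynomial $F\in\mathbb{F}_{q^2}[x_0,x_1,x_2,x_3]$ of degree $3$ such that $|\mathsf{V}(F)\cap V_2| = 3(q^3+q^2-q)+1$. Consequently, if $q\ge 4$, the second highest value of $|\mathsf{V}(F)\cap V_2|$, as $F$ ranges over all nonzero homogeneous polynomials of degree $3$ in $\mathbb{F}_{q^2}[x_0,x_1,x_2,x_3]$, is $3(q^3+q^2-q)+1$.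
   Context: A non-degenerate Hermitian surface $V_2$ is the zero set in $\mathbb{P}^3$ of $x^T A x^{(q)}$, where $x=(x_0,x_1,x_2,x_3)^T$, $x^{(q)}=(x_0^q,x_1^q,x_2^q,x_3^q)^T$, and $A=(a_{ij})$ is an invertible $4\times 4$ matrix over $\mathbb{F}_{q^2}$ with $A^T=A^{(q)}:=(a_{ij}^q)$. $\mathsf{V}(F)$ is the set of $\mathbb{F}_{q^2}$-rational points of $\mathbb{P}^3$ at which $F$ vanishes. In cardinalities, $V_2$ and planes are understood as their sets of $\mathbb{F}_{q^2}$-rational points. Planes and lines are defined over $\mathbb{F}_{q^2}$. A plane is tangent to $V_2$ if it is the tangent plane of $V_2$ at some $\mathbb{F}_{q^2}$-rational point of $V_2$. A line is a secant line if it meets $V_2$ in exactly $q+1$ $\mathbb{F}_{q^2}$-rational points. *)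

theory Defs
  imports
    "HOL-Analysis.Analysis"
    "HOL-Library.Poly_Mapping"
    "HOL-Number_Theory.Prime_Powers"
begin

text \<open>Polynomials in the coordinates of \<^typ>\<open>'a ^ 4\<close>.  The inner poly mapping is the exponent vector of
  a monomial, the outer one assigns coefficients to monomials.  The four coordinates are indexed by
  the type \<^typ>\<open>4\<close>.\<close>

type_synonym 'a poly4 = "(4 \<Rightarrow>\<^sub>0 nat) \<Rightarrow>\<^sub>0 'a"

definition peval :: "'a::comm_ring_1 poly4 \<Rightarrow> 'a ^ 4 \<Rightarrow> 'a" where
  "peval F x = (\<Sum>m\<in>Poly_Mapping.keys F.
     Poly_Mapping.lookup F m * (\<Prod>i\<in>UNIV. (x $ i) ^ Poly_Mapping.lookup m i))"

definition homogeneous :: "nat \<Rightarrow> 'a::comm_ring_1 poly4 \<Rightarrow> bool" where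
  "homogeneous d F \<longleftrightarrow>
     (\<forall>m\<in>Poly_Mapping.keys F. (\<Sum>i\<in>UNIV. Poly_Mapping.lookup m i) = d)"

text \<open>The zero polynomial counts as homogeneous of every degree.\<close>

definition partial_deriv :: "4 \<Rightarrow> 'a::comm_ring_1 poly4 \<Rightarrow> 'a poly4" where
  "partial_deriv k F = (\<Sum>m\<in>Poly_Mapping.keys F.
     Poly_Mapping.single (m - Poly_Mapping.single k 1)
       (of_nat (Poly_Mapping.lookup m k) * Poly_Mapping.lookup F m))"

text \<open>Points, lines and planes of projective 3-space over the field \<^typ>\<open>'a\<close> are the vector subspaces of
  \<^typ>\<open>'a ^ 4\<close> of dimension 1, 2 and 3.  Incidence is inclusion, and the intersection of two
  projective subspaces is the intersection of the vector subspaces.\<close>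

definition proj_points :: "('a::field ^ 4) set set" where
  "proj_points = {P. vec.subspace P \<and> vec.dim P = 1}"

definition proj_line :: "('a::field ^ 4) set \<Rightarrow> bool" where
  "proj_line L \<longleftrightarrow> vec.subspace L \<and> vec.dim L = 2"

definition proj_plane :: "('a::field ^ 4) set \<Rightarrow> bool" where
  "proj_plane T \<longleftrightarrow> vec.subspace T \<and> vec.dim T = 3"

definition points_of :: "('a::field ^ 4) set \<Rightarrow> ('a ^ 4) set set" where
  "points_of S = {P \<in> proj_points. P \<subseteq> S}"

text \<open>The set of rational points at which \<open>F\<close> vanishes; meaningful for homogeneous \<open>F\<close>.\<close>

definition VV :: "'a::field poly4 \<Rightarrow> ('a ^ 4) set set" where
  "VV F = {P \<in> proj_points. \<forall>x\<in>P - {0}. peval F x = 0}"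

text \<open>The plane with equation \<open>\<Sum>\<^sub>i (\<partial>F/\<partial>x\<^sub>i)(p) x\<^sub>i = 0\<close>, where \<open>p\<close> is
  any coordinate vector of the point \<open>P\<close>.\<close>

definition tangent_space :: "'a::field poly4 \<Rightarrow> ('a ^ 4) set \<Rightarrow> ('a ^ 4) set" where
  "tangent_space F P =
     {x. \<forall>p\<in>P - {0}. (\<Sum>i\<in>UNIV. peval (partial_deriv i F) p * x $ i) = 0}"

definition tangent_plane :: "'a::field poly4 \<Rightarrow> ('a ^ 4) set \<Rightarrow> bool" where
  "tangent_plane F T \<longleftrightarrow> proj_plane T \<and> (\<exists>P\<in>VV F. T = tangent_space F P)"

definition nondeg_hermitian :: "nat \<Rightarrow> 'a::field ^ 4 ^ 4 \<Rightarrow> bool" where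
  "nondeg_hermitian q A \<longleftrightarrow> invertible A \<and> transpose A = (\<chi> i j. (A $ i $ j) ^ q)"

text \<open>The polynomial \<open>x\<^sup>T A x\<^sup>(\<^sup>q\<^sup>) = \<Sum>\<^sub>i\<^sub>j a\<^sub>i\<^sub>j x\<^sub>i x\<^sub>j\<^sup>q\<close>.\<close>

definition herm_poly :: "nat \<Rightarrow> 'a::comm_ring_1 ^ 4 ^ 4 \<Rightarrow> 'a poly4" where
  "herm_poly q A = (\<Sum>i\<in>UNIV. \<Sum>j\<in>UNIV.
     Poly_Mapping.single (Poly_Mapping.single i 1 + Poly_Mapping.single j q) (A $ i $ j))"

definition secant_line :: "nat \<Rightarrow> 'a::field ^ 4 ^ 4 \<Rightarrow> ('a ^ 4) set \<Rightarrow> bool" where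
  "secant_line q A L \<longleftrightarrow> proj_line L \<and> card (points_of L \<inter> VV (herm_poly q A)) = q + 1"

definition second_highest :: "nat set \<Rightarrow> nat \<Rightarrow> bool" where
  "second_highest S v \<longleftrightarrow> v \<in> S \<and> (\<exists>!w. w \<in> S \<and> v < w)"


text \<open>The expected descriptions of the Hermitian surface and of its tangent planes.\<close>

lemma peval_superset:
  assumes "finite M" "Poly_Mapping.keys F \<subseteq> M"
  shows "peval F x = (\<Sum>m\<in>M.
     Poly_Mapping.lookup F m * (\<Prod>i\<in>UNIV. (x $ i) ^ Poly_Mapping.lookup m i))"
  unfolding peval_def using assms
  by (intro sum.mono_neutral_left) (auto simp: in_keys_iff)

lemma peval_0 [simp]: "peval 0 x = 0"
  by (simp add: peval_def)

lemma peval_add: "peval (F + G) x = peval F x + peval G x"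
  using keys_add [of F G]
  by (simp add: peval_superset [of "Poly_Mapping.keys F \<union> Poly_Mapping.keys G"]
      lookup_add distrib_right sum.distrib)

lemma peval_sum: "peval (\<Sum>i\<in>I. F i) x = (\<Sum>i\<in>I. peval (F i) x)"
  by (induction I rule: infinite_finite_induct) (auto simp: peval_add)

lemma peval_single:
  "peval (Poly_Mapping.single m c) x = c * (\<Prod>i\<in>UNIV. (x $ i) ^ Poly_Mapping.lookup m i)"
  by (simp add: peval_superset [of "{m}"])

lemma prod_power_single:
  "(\<Prod>k\<in>UNIV. (x $ k) ^ Poly_Mapping.lookup (Poly_Mapping.single i n) k) = (x $ i :: 'a::comm_ring_1) ^ n"
  for i :: 4
proof -
  have "(\<Prod>k\<in>UNIV. (x $ k) ^ Poly_Mapping.lookup (Poly_Mapping.single i n) k)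
      = (\<Prod>k\<in>UNIV. if k = i then (x $ i) ^ n else 1)"
    by (intro prod.cong) (auto simp: lookup_single when_def)
  then show ?thesis by simp
qed

lemma peval_herm_poly:
  "peval (herm_poly q A) x = (\<Sum>i\<in>UNIV. \<Sum>j\<in>UNIV. A $ i $ j * x $ i * (x $ j) ^ q)"
  by (simp add: herm_poly_def peval_sum peval_single lookup_add power_add prod.distrib
      prod_power_single mult.assoc del: One_nat_def)

lemma partial_deriv_superset:
  assumes "finite M" "Poly_Mapping.keys F \<subseteq> M"
  shows "partial_deriv k F = (\<Sum>m\<in>M. Poly_Mapping.single (m - Poly_Mapping.single k 1)
       (of_nat (Poly_Mapping.lookup m k) * Poly_Mapping.lookup F m))"
  unfolding partial_deriv_def using assms
  by (intro sum.mono_neutral_left) (auto simp: in_keys_iff)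

lemma partial_deriv_add: "partial_deriv k (F + G) = partial_deriv k F + partial_deriv k G"
  using keys_add [of F G]
  by (simp add: partial_deriv_superset [of "Poly_Mapping.keys F \<union> Poly_Mapping.keys G"]
      lookup_add distrib_left single_add sum.distrib)

lemma partial_deriv_sum: "partial_deriv k (\<Sum>i\<in>I. F i) = (\<Sum>i\<in>I. partial_deriv k (F i))"
  by (induction I rule: infinite_finite_induct)
    (auto simp: partial_deriv_add, auto simp: partial_deriv_def)

lemma partial_deriv_single:
  "partial_deriv k (Poly_Mapping.single m c)
     = Poly_Mapping.single (m - Poly_Mapping.single k 1) (of_nat (Poly_Mapping.lookup m k) * c)"
  by (simp add: partial_deriv_superset [of "{m}"])

lemma of_nat_q_eq_0:
  assumes "CARD('a::{field,finite}) = q ^ 2"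
  shows "of_nat q = (0::'a)"
proof -
  have "(\<Sum>x\<in>UNIV. x + 1) = (\<Sum>x\<in>UNIV. x :: 'a)"
    by (rule sum.reindex_bij_witness [of _ "\<lambda>x. x - 1" "\<lambda>x. x + 1"]) auto
  then have "of_nat (CARD('a)) = (0::'a)"
    by (simp add: sum.distrib)
  then show ?thesis using assms by simp
qed

lemma peval_partial_deriv_herm_poly:
  fixes A :: "'a::{field,finite} ^ 4 ^ 4"
  assumes q: "CARD('a) = q ^ 2"
  shows "peval (partial_deriv k (herm_poly q A)) p = (\<Sum>j\<in>UNIV. A $ k $ j * (p $ j) ^ q)"
proof -
  have *: "peval (partial_deriv k (Poly_Mapping.single
        (Poly_Mapping.single i 1 + Poly_Mapping.single j q) (A $ i $ j))) p
      = (if i = k then A $ i $ j * (p $ j) ^ q else 0)" for i j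
  proof (cases "i = k")
    case True
    have "of_nat (Poly_Mapping.lookup (Poly_Mapping.single i 1 + Poly_Mapping.single j q) k) = (1::'a)"
      using True of_nat_q_eq_0 [OF q] by (auto simp: lookup_add lookup_single when_def)
    then show ?thesis
      using True
      by (simp only: partial_deriv_single peval_single) (simp add: prod_power_single)
  next
    case False
    have "of_nat (Poly_Mapping.lookup (Poly_Mapping.single i 1 + Poly_Mapping.single j q) k) = (0::'a)"
      using False of_nat_q_eq_0 [OF q] by (auto simp: lookup_add lookup_single when_def)
    then show ?thesis
      using False by (simp only: partial_deriv_single peval_single) simp
  qed
  have "peval (partial_deriv k (herm_poly q A)) p
      = (\<Sum>i\<in>UNIV. \<Sum>j\<in>UNIV. if i = k then A $ i $ j * (p $ j) ^ q else 0)"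
    unfolding herm_poly_def partial_deriv_sum peval_sum * ..
  also have "\<dots> = (\<Sum>i\<in>UNIV. if i = k then \<Sum>j\<in>UNIV. A $ k $ j * (p $ j) ^ q else 0)"
    by (intro sum.cong) auto
  finally show ?thesis by simp
qed

end

theory Submission
  imports Defs
begin

text \<open>
  A point \<open>p\<close> lies on the surface \<open>V\<^sub>2\<close> iff it is isotropic for the Hermitian form
  \<open>h x y = x\<^sup>T A y\<^sup>(\<^sup>q\<^sup>)\<close>, and the tangent plane at \<open>p\<close> is \<open>perp p = {x. h x p = 0}\<close>.  Call a line
  contained in \<open>V\<^sub>2\<close> a generator.

  \<^bold>\<open>Existence.\<close>  If \<open>p\<close> and \<open>r\<close> are isotropic and \<open>h p r \<noteq> 0\<close>, then \<open>h\<close> is nondegenerate on the line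
  \<open>perp p \<inter> perp r\<close>, which is therefore a secant line (\<open>polar_line_secant\<close>).  The tangent planes at
  three points of one secant line all contain the polar of that line, again a secant line.  Moving one
  of the three points off the line by adding to it an isotropic vector \<open>r\<close> of the polar leaves the
  pairwise intersections secant, but makes the three planes meet in the point \<open>r\<close> alone
  (\<open>three_isotropic_points\<close>).  Inclusion-exclusion for the product of the three equations gives
  \<open>3(q\<^sup>3 + q\<^sup>2 - q) + q + 1\<close> points in the first configuration and \<open>3(q\<^sup>3 + q\<^sup>2 - q) + 1\<close> in the second.

  \<^bold>\<open>Upper bound.\<close>  A cubic form that vanishes on a tangent plane is divisible by the equation of that
  plane (\<open>tangent_plane_factor\<close>).  So a cubic surface is either the union of three tangent planes, which
  inclusion-exclusion settles (\<open>tangent_planes_dichotomy\<close>), or the union of at most two tangent planes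
  and a surface \<open>X\<close> of degree \<open>d \<le> 3\<close> that contains no tangent plane.  It remains to see that such
  an \<open>X\<close> meets \<open>V\<^sub>2\<close> in few points.

  Every plane through a generator \<open>L\<close> is the tangent plane at exactly one point \<open>P\<close> of \<open>L\<close>, and it meets
  \<open>V\<^sub>2\<close> in \<open>L\<close> and \<open>q\<close> further generators through \<open>P\<close>.  If \<open>X\<close> contains no generator, each of these
  \<open>q(q\<^sup>2 + 1)\<close> generators carries at most \<open>d\<close> points of \<open>X\<close>, or \<open>d - 1\<close> points besides \<open>P\<close> if \<open>P \<in> X\<close>
  (\<open>card_points_no_line\<close>).  Suppose now that \<open>L \<subseteq> X\<close>, and that \<open>X\<close> contains \<open>k\<^sub>P\<close> of the further
  generators through \<open>P\<close>.  Then the plane section of \<open>X\<close> has multiplicity at least \<open>k\<^sub>P + 1\<close> at \<open>P\<close>,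
  which leaves at most \<open>d - 1 - k\<^sub>P\<close> other points on each remaining generator, hence at most
  \<open>(d - 1) q + k\<^sub>P (q\<^sup>2 - q)\<close> points off \<open>L\<close> in this plane (\<open>planar_zero_count\<close>).

  The sum of the \<open>k\<^sub>P\<close> is at most \<open>q + d - 1\<close>, unless \<open>X\<close> is singular along \<open>L\<close>
  (\<open>sum_lines_through\<close>).  Indeed, the direction in which the tangent plane at \<open>P\<close> leaves \<open>L\<close> depends on
  the \<open>q\<close>-th powers of the coordinates of \<open>P\<close>; so the derivative of the equation of \<open>X\<close> in this direction
  is a form of degree \<open>q + d - 1\<close> on \<open>L\<close>, and it vanishes to order \<open>k\<^sub>P\<close> at \<open>P\<close>.  If \<open>X\<close> is singular
  along every generator that it contains, then two of these never meet: a line joining a point of one to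
  a point of the other would meet \<open>X\<close> with multiplicity 4, so \<open>X\<close> would contain the plane that the two
  generators span, which is a tangent plane.  In this case all \<open>k\<^sub>P\<close> are 0 (\<open>no_further_lines\<close>).
\<close>


section \<open>Forms as functions\<close>

text \<open>All degrees below stay under the size of the field, so a homogeneous polynomial is determined by its
  values and only the polynomial function matters.  Peeling off one coordinate at a time lets
  statements about forms be proved by induction on the degree; the zero function is a form of every
  degree.\<close>

primrec is_form :: "nat \<Rightarrow> ('a::field ^ 4 \<Rightarrow> 'a) \<Rightarrow> bool" where
  "is_form 0 f \<longleftrightarrow> (\<exists>c. f = (\<lambda>_. c))"
| "is_form (Suc d) f \<longleftrightarrow> (\<exists>g. (\<forall>i. is_form d (g i)) \<and> f = (\<lambda>x. \<Sum>i\<in>UNIV. x $ i * g i x))"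

lemma is_form_zero: "is_form d (\<lambda>_. 0)"
proof (induction d)
  case (Suc d)
  then show ?case by (auto intro!: exI [of _ "\<lambda>_ _. 0"])
qed auto

lemma is_form_add: "is_form d f \<Longrightarrow> is_form d g \<Longrightarrow> is_form d (\<lambda>x. f x + g x)"
proof (induction d arbitrary: f g)
  case (Suc d)
  from Suc.prems obtain f' g' where
    f': "\<And>i. is_form d (f' i)" "f = (\<lambda>x. \<Sum>i\<in>UNIV. x $ i * f' i x)" and
    g': "\<And>i. is_form d (g' i)" "g = (\<lambda>x. \<Sum>i\<in>UNIV. x $ i * g' i x)"
    by auto
  show ?case
    using Suc.IH [OF f'(1) g'(1)]
    by (auto simp: f'(2) g'(2) distrib_left sum.distrib intro!: exI [of _ "\<lambda>i x. f' i x + g' i x"])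
qed auto

lemma is_form_cmult: "is_form d f \<Longrightarrow> is_form d (\<lambda>x. c * f x)"
proof (induction d arbitrary: f)
  case (Suc d)
  from Suc.prems obtain f' where
    f': "\<And>i. is_form d (f' i)" "f = (\<lambda>x. \<Sum>i\<in>UNIV. x $ i * f' i x)"
    by auto
  show ?case
    using Suc.IH [OF f'(1)]
    by (auto simp: f'(2) sum_distrib_left mult_ac intro!: exI [of _ "\<lambda>i x. c * f' i x"])
qed auto

lemma is_form_sum: "(\<And>i. i \<in> I \<Longrightarrow> is_form d (f i)) \<Longrightarrow> is_form d (\<lambda>x. \<Sum>i\<in>I. f i x)"
  by (induction I rule: infinite_finite_induct) (auto simp: is_form_zero is_form_add)

lemma is_form_coord_mult:
  assumes "is_form d f"
  shows "is_form (Suc d) (\<lambda>x. x $ k * f x)"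
proof -
  have "x $ k * f x = (\<Sum>i\<in>UNIV. x $ i * (if i = k then f x else 0))" for x
    by (simp add: if_distrib [of "(*) _"] cong: if_cong)
  moreover have "is_form d (\<lambda>x. if i = k then f x else 0)" for i
    using assms is_form_zero by (cases "i = k") auto
  ultimately show ?thesis
    by (auto intro!: exI [of _ "\<lambda>i x. if i = k then f x else 0"])
qed

lemma is_form_homogeneous: "is_form d f \<Longrightarrow> f (c *s x) = c ^ d * f x"
proof (induction d arbitrary: f)
  case (Suc d)
  from Suc.prems obtain f' where
    f': "\<And>i. is_form d (f' i)" "f = (\<lambda>x. \<Sum>i\<in>UNIV. x $ i * f' i x)"
    by auto
  show ?case
    by (simp add: f'(2) Suc.IH [OF f'(1)] sum_distrib_left mult_ac)
qed auto

text \<open>Induction on the degree: remove one coordinate that occurs in the monomial.\<close>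

lemma is_form_monomial:
  "is_form (\<Sum>i\<in>UNIV. Poly_Mapping.lookup m i)
     (\<lambda>x::'a::field ^ 4. \<Prod>i\<in>UNIV. (x $ i) ^ Poly_Mapping.lookup m i)"
proof (induction "\<Sum>i\<in>UNIV. Poly_Mapping.lookup m i" arbitrary: m)
  case 0
  then have "Poly_Mapping.lookup m i = 0" for i
    by simp
  then show ?case by auto
next
  case (Suc d)
  then obtain k where k: "Poly_Mapping.lookup m k > 0"
    by (metis gr0I sum.neutral nat.distinct(1))
  define n where "n = m - Poly_Mapping.single k 1"
  have m: "m = Poly_Mapping.single k 1 + n"
    using k by (intro poly_mapping_eqI) (auto simp: n_def lookup_add lookup_minus lookup_single when_def)
  have "(\<Sum>i\<in>UNIV. Poly_Mapping.lookup m i) = Suc (\<Sum>i\<in>UNIV. Poly_Mapping.lookup n i)"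
    by (simp add: m lookup_add sum.distrib lookup_single when_def del: One_nat_def)
  with Suc have "is_form (\<Sum>i\<in>UNIV. Poly_Mapping.lookup n i)
      (\<lambda>x::'a ^ 4. \<Prod>i\<in>UNIV. (x $ i) ^ Poly_Mapping.lookup n i)"
    by auto
  from is_form_coord_mult [OF this, of k] show ?case
    by (simp only: \<open>_ = Suc _\<close>)
      (simp add: m lookup_add power_add prod.distrib prod_power_single del: One_nat_def)
qed

lemma is_form_peval:
  assumes "homogeneous d F"
  shows "is_form d (peval F)"
proof -
  have "is_form d (\<lambda>x. \<Sum>m\<in>Poly_Mapping.keys F.
     Poly_Mapping.lookup F m * (\<Prod>i\<in>UNIV. (x $ i) ^ Poly_Mapping.lookup m i))"
  proof (intro is_form_sum is_form_cmult)
    fix m assume "m \<in> Poly_Mapping.keys F"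
    then show "is_form d (\<lambda>x::'a ^ 4. \<Prod>i\<in>UNIV. (x $ i) ^ Poly_Mapping.lookup m i)"
      using is_form_monomial [of m, where 'a = 'a] assms by (simp only: homogeneous_def)
  qed
  then show ?thesis by (simp add: peval_def [abs_def])
qed

lemma is_form_linear_mult:
  "is_form d f \<Longrightarrow> is_form (Suc d) (\<lambda>x. (\<Sum>i\<in>UNIV. c i * x $ i) * f x)"
  using is_form_sum [of UNIV "Suc d" "\<lambda>i x. c i * (x $ i * f x)"]
  by (simp add: sum_distrib_right mult.assoc is_form_cmult is_form_coord_mult del: is_form.simps)

text \<open>Let \<open>\<pi>\<close> be the projection onto the hyperplane \<open>l = 0\<close> along \<open>y\<close>.  Since \<open>x - \<pi> x\<close> is a multiple
  \<open>l x\<close> of \<open>y\<close>, the difference \<open>f x - f (\<pi> x)\<close> is divisible by \<open>l x\<close> for every form \<open>f\<close>, by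
  induction on the degree; and \<open>f \<circ> \<pi>\<close> is zero here.\<close>

lemma form_vanishing_on_hyperplane:
  fixes c y
  defines "l \<equiv> \<lambda>x. \<Sum>i\<in>UNIV. c i * x $ i"
  assumes "is_form (Suc d) f" "l y = 1" "\<And>x. l x = 0 \<Longrightarrow> f x = 0"
  obtains g where "is_form d g" "\<And>x. f x = l x * g x"
proof -
  define \<pi> where "\<pi> x = x - l x *s y" for x
  have step: "\<exists>g. is_form d g \<and> (\<forall>x. f x - f (\<pi> x) = l x * g x)" if "is_form (Suc d) f" for f d
    using that
  proof (induction d arbitrary: f)
    case 0
    then obtain f' where f': "\<forall>i. \<exists>c. f' i = (\<lambda>_. c)" "f = (\<lambda>x. \<Sum>i\<in>UNIV. x $ i * f' i x)"
      by auto
    from choice [OF f'(1)] obtain a where "\<And>i. f' i = (\<lambda>_. a i)"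
      by blast
    with f'(2) have f: "f = (\<lambda>x. \<Sum>i\<in>UNIV. x $ i * a i)"
      by simp
    have "f x - f (\<pi> x) = l x * (\<Sum>i\<in>UNIV. y $ i * a i)" for x
      by (simp add: f \<pi>_def sum_distrib_left flip: sum_subtractf) (simp add: algebra_simps)
    then show ?case by (auto intro!: exI [of _ "\<lambda>_. \<Sum>i\<in>UNIV. y $ i * a i"])
  next
    case (Suc d)
    then obtain f' where f': "\<And>i. is_form (Suc d) (f' i)" "f = (\<lambda>x. \<Sum>i\<in>UNIV. x $ i * f' i x)"
      by (auto simp del: is_form.simps simp: is_form.simps(2) [of "Suc d"])
    from Suc.IH [OF f'(1)] obtain g where g: "\<And>i. is_form d (g i)"
        "\<And>i x. f' i x - f' i (\<pi> x) = l x * g i x"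
      by metis
    have "f x - f (\<pi> x) = l x * (\<Sum>i\<in>UNIV. y $ i * f' i x + \<pi> x $ i * g i x)" for x
    proof -
      have "x $ i * f' i x - \<pi> x $ i * f' i (\<pi> x) = l x * (y $ i * f' i x + \<pi> x $ i * g i x)" for i
      proof -
        have "f' i (\<pi> x) = f' i x - l x * g i x"
          using g(2) [of i x] by (simp add: algebra_simps)
        moreover have "x $ i - \<pi> x $ i = l x * y $ i"
          by (simp add: \<pi>_def)
        ultimately show ?thesis by algebra
      qed
      then show ?thesis
        by (simp add: f'(2) sum_distrib_left flip: sum_subtractf)
    qed
    moreover have "is_form (Suc d) (\<lambda>x. \<Sum>i\<in>UNIV. y $ i * f' i x + \<pi> x $ i * g i x)"
    proof (intro is_form_sum is_form_add is_form_cmult f'(1))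
      fix i
      have "\<pi> x $ i = (\<Sum>j\<in>UNIV. ((if i = j then 1 else 0) - c j * y $ i) * x $ j)" for x
      proof -
        have "(\<Sum>j\<in>UNIV. ((if i = j then 1 else 0) - c j * y $ i) * x $ j) =
            (\<Sum>j\<in>UNIV. (if i = j then x $ j else 0) - c j * x $ j * y $ i)"
          by (intro sum.cong) (auto simp: algebra_simps)
        then show ?thesis
          by (simp add: \<pi>_def l_def sum_subtractf sum_distrib_right)
      qed
      then show "is_form (Suc d) (\<lambda>x. \<pi> x $ i * g i x)"
        using is_form_linear_mult [OF g(1), of "\<lambda>j. (if i = j then 1 else 0) - c j * y $ i" i]
        by simp
    qed
    ultimately show ?case by blast
  qed
  from step [OF assms(2)] obtain g where g: "is_form d g" "\<And>x. f x - f (\<pi> x) = l x * g x"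
    by auto
  have "l (\<pi> x) = 0" for x
  proof -
    have "l (\<pi> x) = l x - l x * l y"
      by (simp add: l_def \<pi>_def right_diff_distrib sum_subtractf sum_distrib_left mult_ac)
    then show ?thesis using assms(3) by simp
  qed
  with g assms(4) show ?thesis
    by (intro that [of g]) (auto simp: algebra_simps)
qed

text \<open>The Taylor expansion of \<open>f\<close>: \<open>C j x y\<close> collects the terms of degree \<open>j\<close> in \<open>y\<close>.  So \<open>C 1 x y\<close> is
  the derivative of \<open>f\<close> at \<open>x\<close> in direction \<open>y\<close>, in a form that makes sense in every characteristic.  The
  vanishing beyond \<open>d\<close> is a normalisation that keeps the truncated subtraction \<open>d - j\<close> harmless.\<close>

definition bihomogeneous_expansion ::
    "nat \<Rightarrow> ('a::field ^ 4 \<Rightarrow> 'a) \<Rightarrow> (nat \<Rightarrow> 'a ^ 4 \<Rightarrow> 'a ^ 4 \<Rightarrow> 'a) \<Rightarrow> bool" where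
  "bihomogeneous_expansion d f C \<longleftrightarrow>
    (\<forall>a b x y. f (a *s x + b *s y) = (\<Sum>j\<le>d. a ^ (d - j) * b ^ j * C j x y)) \<and>
    (\<forall>j x. is_form j (C j x)) \<and> (\<forall>j y. is_form (d - j) (\<lambda>x. C j x y)) \<and> (\<forall>j>d. C j = (\<lambda>_ _. 0))"

text \<open>Multiplying a form by the coordinate \<open>(a *s x + b *s y) $ i\<close> raises either the degree in \<open>x\<close> or that in \<open>y\<close>.\<close>

lemma form_bihomogeneous_expansion:
  assumes "is_form d f"
  shows "\<exists>C. bihomogeneous_expansion d f C"
  using assms
proof (induction d arbitrary: f)
  case 0
  then obtain c where "f = (\<lambda>_. c)" by auto
  then show ?case
    by (intro exI [of _ "\<lambda>j _ _. if j = 0 then c else 0"])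
      (auto simp: bihomogeneous_expansion_def is_form_zero)
next
  case (Suc d)
  then obtain f' where f': "\<And>i. is_form d (f' i)" "f = (\<lambda>x. \<Sum>i\<in>UNIV. x $ i * f' i x)"
    by auto
  from Suc.IH [OF f'(1)] have "\<forall>i. \<exists>C. bihomogeneous_expansion d (f' i) C"
    by blast
  from choice [OF this] obtain C where "\<And>i. bihomogeneous_expansion d (f' i) (C i)"
    by blast
  then have C: "\<And>i a b x y. f' i (a *s x + b *s y) = (\<Sum>j\<le>d. a ^ (d - j) * b ^ j * C i j x y)"
      "\<And>i j x. is_form j (C i j x)" "\<And>i j y. is_form (d - j) (\<lambda>x. C i j x y)"
      "\<And>i j. j > d \<Longrightarrow> C i j = (\<lambda>_ _. 0)"
    by (simp_all add: bihomogeneous_expansion_def)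
  define D where "D j x y = (\<Sum>i\<in>UNIV. x $ i * C i j x y) +
    (case j of 0 \<Rightarrow> 0 | Suc j' \<Rightarrow> \<Sum>i\<in>UNIV. y $ i * C i j' x y)" for j x y
  have "f (a *s x + b *s y) = (\<Sum>j\<le>Suc d. a ^ (Suc d - j) * b ^ j * D j x y)" for a b x y
  proof -
    have "f (a *s x + b *s y) =
        (\<Sum>i\<in>UNIV. (a * x $ i) * (\<Sum>j\<le>d. a ^ (d - j) * b ^ j * C i j x y)) +
        (\<Sum>i\<in>UNIV. (b * y $ i) * (\<Sum>j\<le>d. a ^ (d - j) * b ^ j * C i j x y))"
      by (simp add: f'(2) C(1) distrib_right sum.distrib)
    also have "(\<Sum>i\<in>UNIV. (a * x $ i) * (\<Sum>j\<le>d. a ^ (d - j) * b ^ j * C i j x y)) =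
        (\<Sum>j\<le>d. a ^ (Suc d - j) * b ^ j * (\<Sum>i\<in>UNIV. x $ i * C i j x y))"
      unfolding sum_distrib_left
      by (subst sum.swap, intro sum.cong refl) (simp add: Suc_diff_le mult_ac)
    also have "\<dots> = (\<Sum>j\<le>Suc d. a ^ (Suc d - j) * b ^ j * (\<Sum>i\<in>UNIV. x $ i * C i j x y))"
      by (simp add: C(4))
    also have "(\<Sum>i\<in>UNIV. (b * y $ i) * (\<Sum>j\<le>d. a ^ (d - j) * b ^ j * C i j x y)) =
        (\<Sum>j\<le>d. a ^ (d - j) * b ^ Suc j * (\<Sum>i\<in>UNIV. y $ i * C i j x y))"
      unfolding sum_distrib_left
      by (subst sum.swap, intro sum.cong refl) (simp add: mult_ac)
    also have "\<dots> = (\<Sum>j\<le>Suc d. a ^ (Suc d - j) * b ^ j *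
        (case j of 0 \<Rightarrow> 0 | Suc j' \<Rightarrow> \<Sum>i\<in>UNIV. y $ i * C i j' x y))"
      by (subst sum.atMost_Suc_shift) simp
    finally show ?thesis
      by (simp only: D_def distrib_left sum.distrib)
  qed
  moreover have "is_form j (D j x)" for j x
    unfolding D_def
    by (intro is_form_add is_form_sum is_form_cmult C(2), cases j)
      (auto simp: is_form_zero intro!: is_form_sum is_form_coord_mult C(2) simp del: is_form.simps)
  moreover have "is_form (Suc d - j) (\<lambda>x. D j x y)" for j y
  proof -
    have "is_form (Suc d - j) (\<lambda>x. x $ i * C i j x y)" for i
      using is_form_coord_mult [OF C(3) [of j i y], of i] C(4) [of j i]
      by (cases "j \<le> d") (auto simp: Suc_diff_le is_form_zero simp del: is_form.simps)
    moreover have "is_form (Suc d - j)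
        (\<lambda>x. case j of 0 \<Rightarrow> 0 | Suc j' \<Rightarrow> \<Sum>i\<in>UNIV. y $ i * C i j' x y)"
      using C(3) by (cases j) (auto intro!: is_form_zero is_form_sum is_form_cmult simp del: is_form.simps)
    ultimately show ?thesis
      unfolding D_def by (intro is_form_add is_form_sum)
  qed
  moreover have "D j = (\<lambda>_ _. 0)" if "j > Suc d" for j
    using that by (auto simp: D_def fun_eq_iff C(4) split: nat.split)
  ultimately show ?case
    unfolding bihomogeneous_expansion_def by blast
qed

section \<open>Univariate polynomials over a finite field\<close>

lemma poly_sum_monom:
  fixes c :: "nat \<Rightarrow> 'a::field"
  shows "poly (\<Sum>j\<le>n. monom (c j) j) x = (\<Sum>j\<le>n. c j * x ^ j)"
  by (simp add: poly_sum poly_monom)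

lemma coeff_sum_monom: "coeff (\<Sum>j\<le>n. monom (c j) j) i = (if i \<le> n then c i else 0)"
  by (simp add: coeff_sum)

lemma degree_sum_monom: "degree (\<Sum>j\<le>n. monom (c j) j) \<le> n"
  by (intro degree_le) (auto simp: coeff_sum_monom)

lemma card_roots_sum_powers:
  fixes c :: "nat \<Rightarrow> 'a::field"
  assumes "j \<le> n" "c j \<noteq> 0"
  shows "finite {x. (\<Sum>j\<le>n. c j * x ^ j) = 0}" "card {x. (\<Sum>j\<le>n. c j * x ^ j) = 0} \<le> n"
proof -
  let ?p = "\<Sum>j\<le>n. monom (c j) j"
  have "coeff ?p j \<noteq> 0"
    using assms by (simp add: coeff_sum_monom)
  then have "?p \<noteq> 0" by auto
  then show "finite {x. (\<Sum>j\<le>n. c j * x ^ j) = 0}" "card {x. (\<Sum>j\<le>n. c j * x ^ j) = 0} \<le> n"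
    using poly_roots_finite [of ?p] card_poly_roots_bound [of ?p] degree_sum_monom [of c n]
    by (simp_all add: poly_sum_monom)
qed

lemma sum_powers_zero:
  fixes c :: "nat \<Rightarrow> 'a::{field,finite}"
  assumes "\<And>x. x \<in> T \<Longrightarrow> (\<Sum>j\<le>n. c j * x ^ j) = 0" "n < card T" "j \<le> n"
  shows "c j = 0"
proof (rule ccontr)
  assume "c j \<noteq> 0"
  then have "card T \<le> n"
    using card_roots_sum_powers [OF assms(3), of c] assms(1) card_mono [of "{x. (\<Sum>j\<le>n. c j * x ^ j) = 0}" T]
    by force
  with assms(2) show False by simp
qed

text \<open>Separate the monomials one coordinate at a time: a polynomial in one coordinate that vanishes on the
  whole field and has degree below its size is zero, so the part of \<open>F\<close> with a prescribed exponent of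
  that coordinate also vanishes everywhere.  After all four coordinates a single monomial is left, and
  its value at \<open>(1, 1, 1, 1)\<close> is its coefficient.\<close>

lemma peval_not_zero:
  fixes F :: "'a::{field,finite} poly4"
  assumes "F \<noteq> 0" "homogeneous d F" "d < CARD('a)"
  shows "\<exists>x. peval F x \<noteq> 0"
proof (rule ccontr)
  assume "\<not> ?thesis"
  then have zero: "peval F x = 0" for x by blast
  let ?l = "Poly_Mapping.lookup"
  define S where "S K x = (\<Sum>m\<in>K. ?l F m * (\<Prod>i\<in>UNIV. (x $ i) ^ ?l m i))"
    for K and x :: "'a ^ 4"
  have restrict: "S {m \<in> K. ?l m k = e} x = 0"
    if K: "K \<subseteq> Poly_Mapping.keys F" and S: "\<And>x. S K x = 0" for K k e x
  proof -
    have fin: "finite K" by (rule finite_subset [OF K]) simp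
    have deg: "?l m k \<le> d" if "m \<in> K" for m
    proof -
      have "?l m k \<le> (\<Sum>i\<in>UNIV. ?l m i)"
        by (intro member_le_sum) auto
      then show ?thesis using that assms(2) K by (auto simp: homogeneous_def)
    qed
    define c where "c j = (\<Sum>m\<in>{m \<in> K. ?l m k = j}. ?l F m * (\<Prod>i\<in>UNIV-{k}. (x $ i) ^ ?l m i))" for j
    have split: "?l F m * (\<Prod>i\<in>UNIV. (y $ i) ^ ?l m i) =
        ?l F m * (\<Prod>i\<in>UNIV-{k}. (x $ i) ^ ?l m i) * (y $ k) ^ ?l m k"
      if "\<And>i. i \<noteq> k \<Longrightarrow> y $ i = x $ i" for m and y :: "'a ^ 4"
      using that by (subst prod.remove [of _ k]) (auto simp: mult_ac intro!: prod.cong)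
    have "(\<Sum>j\<le>d. c j * t ^ j) = 0" for t
    proof -
      let ?y = "\<chi> i. if i = k then t else x $ i"
      have "(\<Sum>j\<le>d. c j * t ^ j) = (\<Sum>j\<le>d. \<Sum>m\<in>{m \<in> K. ?l m k = j}.
          ?l F m * (\<Prod>i\<in>UNIV-{k}. (x $ i) ^ ?l m i) * t ^ ?l m k)"
        by (simp add: c_def sum_distrib_right)
      also have "\<dots> = (\<Sum>m\<in>K. ?l F m * (\<Prod>i\<in>UNIV-{k}. (x $ i) ^ ?l m i) * t ^ ?l m k)"
        using fin deg by (intro sum.group) auto
      also have "\<dots> = S K ?y"
        unfolding S_def by (intro sum.cong refl) (subst split, auto)
      finally show ?thesis using S by simp
    qed
    then have "c e = 0" if "e \<le> d"
      using sum_powers_zero [of UNIV c d e] assms(3) that by auto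
    moreover have "c e = 0" if "\<not> e \<le> d"
    proof -
      have "{m \<in> K. ?l m k = e} = {}" using deg that by auto
      then show ?thesis by (simp only: c_def sum.empty)
    qed
    moreover have "S {m \<in> K. ?l m k = e} x = c e * (x $ k) ^ e"
      unfolding S_def c_def sum_distrib_right by (intro sum.cong refl) (subst split, auto)
    ultimately show ?thesis by fastforce
  qed
  from assms(1) obtain m where m: "m \<in> Poly_Mapping.keys F"
    using keys_eq_empty [of F] by blast
  have "S {n \<in> Poly_Mapping.keys F. \<forall>i\<in>I. ?l n i = ?l m i} x = 0" if "finite I" for I x
    using that
  proof (induction I arbitrary: x)
    case empty
    then show ?case using zero by (simp add: S_def peval_def)
  next
    case (insert k I)
    have "{n \<in> Poly_Mapping.keys F. \<forall>i\<in>insert k I. ?l n i = ?l m i} =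
        {n \<in> {n \<in> Poly_Mapping.keys F. \<forall>i\<in>I. ?l n i = ?l m i}. ?l n k = ?l m k}"
      by auto
    then show ?case
      using restrict [of "{n \<in> Poly_Mapping.keys F. \<forall>i\<in>I. ?l n i = ?l m i}" k "?l m k" x] insert.IH
      by auto
  qed
  from this [of UNIV "\<chi> i. 1"] have "S {n \<in> Poly_Mapping.keys F. \<forall>i. ?l n i = ?l m i} (\<chi> i. 1) = 0"
    by simp
  moreover have "{n \<in> Poly_Mapping.keys F. \<forall>i. ?l n i = ?l m i} = {m}"
    using m by (auto intro: poly_mapping_eqI)
  ultimately show False
    using m by (simp add: S_def in_keys_iff)
qed

definition triple_product :: "(4 \<Rightarrow> 'a) \<Rightarrow> (4 \<Rightarrow> 'a) \<Rightarrow> (4 \<Rightarrow> 'a::field) \<Rightarrow> 'a poly4" where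
  "triple_product a b c = (\<Sum>i\<in>UNIV. \<Sum>j\<in>UNIV. \<Sum>k\<in>UNIV. Poly_Mapping.single
     (Poly_Mapping.single i 1 + (Poly_Mapping.single j 1 + Poly_Mapping.single k 1)) (a i * b j * c k))"

lemma peval_triple_product:
  "peval (triple_product a b c) x =
    (\<Sum>i\<in>UNIV. a i * x $ i) * (\<Sum>i\<in>UNIV. b i * x $ i) * (\<Sum>i\<in>UNIV. c i * x $ i)"
proof -
  have "peval (triple_product a b c) x =
      (\<Sum>i\<in>UNIV. \<Sum>j\<in>UNIV. \<Sum>k\<in>UNIV. (a i * x $ i) * (b j * x $ j) * (c k * x $ k))"
    unfolding triple_product_def
    by (simp add: peval_sum peval_single lookup_add power_add prod.distrib prod_power_single mult_ac
        del: One_nat_def)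
  also have "\<dots> = (\<Sum>i\<in>UNIV. (a i * x $ i) * ((\<Sum>j\<in>UNIV. b j * x $ j) * (\<Sum>k\<in>UNIV. c k * x $ k)))"
    by (simp only: sum_product) (simp only: sum_distrib_left mult.assoc)
  also have "\<dots> = (\<Sum>i\<in>UNIV. a i * x $ i) * (\<Sum>i\<in>UNIV. b i * x $ i) * (\<Sum>i\<in>UNIV. c i * x $ i)"
    by (simp only: sum_distrib_right mult.assoc)
  finally show ?thesis .
qed

lemma homogeneous_triple_product: "homogeneous 3 (triple_product a b c)"
proof -
  have "(\<Sum>l\<in>UNIV. Poly_Mapping.lookup m l) = 3"
    if "m = Poly_Mapping.single i 1 + (Poly_Mapping.single j 1 + Poly_Mapping.single k 1)"
    for m :: "4 \<Rightarrow>\<^sub>0 nat" and i j k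
    using that by (simp add: lookup_add sum.distrib lookup_single when_def del: One_nat_def)
  moreover have "Poly_Mapping.keys (triple_product a b c) \<subseteq>
      (\<Union>i. \<Union>j. \<Union>k. {Poly_Mapping.single i 1 + (Poly_Mapping.single j 1 + Poly_Mapping.single k 1)})"
    unfolding triple_product_def
    by (intro order_trans [OF keys_sum] UN_mono order_refl) auto
  ultimately show ?thesis unfolding homogeneous_def by blast
qed

section \<open>Zeros of forms on lines and planes\<close>

context
  fixes d :: nat and f :: "'a::{field,finite} ^ 4 \<Rightarrow> 'a" and C
  assumes expansion: "bihomogeneous_expansion d f C" and d_less: "d < CARD('a)"
begin

lemma expansion_eval: "f (a *s x + b *s y) = (\<Sum>j\<le>d. a ^ (d - j) * b ^ j * C j x y)"
  using expansion by (simp add: bihomogeneous_expansion_def)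

lemma expansion_translate: "f (x + b *s y) = (\<Sum>j\<le>d. C j x y * b ^ j)"
  using expansion_eval [of 1 x b y] by (simp add: mult.commute)

lemma expansion_at_second: "f (a *s x + y) = (\<Sum>i\<le>d. C (d - i) x y * a ^ i)"
proof -
  have "f (a *s x + y) = (\<Sum>j\<le>d. a ^ (d - j) * C j x y)"
    using expansion_eval [of a x 1 y] by simp
  also have "\<dots> = (\<Sum>i\<le>d. C (d - i) x y * a ^ i)"
    by (rule sum.reindex_bij_witness [of _ "\<lambda>i. d - i" "\<lambda>i. d - i"]) (auto simp: mult.commute)
  finally show ?thesis .
qed

lemma coefficient_form: "is_form j (C j x)" "is_form (d - j) (\<lambda>x. C j x y)"
  using expansion by (simp_all add: bihomogeneous_expansion_def)

lemma coefficient_zero_on_line: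
  assumes "\<And>b. f (x + b *s y) = 0"
  shows "C j x y = 0"
proof (cases "j \<le> d")
  case True
  have "(\<Sum>j\<le>d. C j x y * b ^ j) = 0" for b
    using assms [of b] by (simp add: expansion_translate)
  then show ?thesis using sum_powers_zero [of UNIV "\<lambda>j. C j x y" d j] d_less True by simp
next
  case False
  then show ?thesis using expansion by (simp add: bihomogeneous_expansion_def)
qed

text \<open>Exchanging the two arguments reverses the expansion, because the coefficients of a polynomial of
  degree below the size of the field are determined by its values.\<close>

lemma coefficient_swap:
  assumes "j \<le> d"
  shows "C (d - j) x y = C j y x"
proof -
  have "(\<Sum>i\<le>d. (C (d - i) x y - C i y x) * a ^ i) = 0" for a
  proof -
    have "f (a *s x + y) = f (y + a *s x)" by (simp add: add.commute)
    then show ?thesis by (simp add: expansion_translate expansion_at_second left_diff_distrib sum_subtractf)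
  qed
  from sum_powers_zero [of UNIV "\<lambda>i. C (d - i) x y - C i y x" d j, OF this] show ?thesis
    using d_less assms by simp
qed

lemma coefficient_top: "C d x y = f y"
  using expansion_at_second [of 0 x y] by (simp add: power_0_left if_distrib [of "(*) _"] sum.delta cong: if_cong)

text \<open>On the line spanned by \<open>u\<close> and \<open>v\<close>, the form has \<open>d + 1\<close> zeros: \<open>u\<close>, which kills the leading
  coefficient of the polynomial \<open>f (v + t *s u)\<close>, and \<open>d\<close> values of \<open>t\<close>.\<close>

lemma form_vanishes_on_line:
  assumes "f u = 0" "\<And>t. t \<in> T \<Longrightarrow> f (v + t *s u) = 0" "d \<le> card T"
  shows "f (a *s u + b *s v) = 0"
proof (cases d)
  case 0
  then have "is_form 0 f"
    using coefficient_form(1) [of 0 0] coefficient_top 0 by (auto simp: fun_eq_iff)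
  then show ?thesis using assms(1) by auto
next
  case (Suc n)
  have top: "C d v u = 0" using coefficient_top assms(1) by simp
  have "(\<Sum>j\<le>n. C j v u * t ^ j) = 0" if "t \<in> T" for t
    using assms(2) [OF that] top by (simp add: expansion_translate Suc)
  then have "C j v u = 0" if "j \<le> n" for j
    using sum_powers_zero [of T "\<lambda>j. C j v u" n j] that assms(3) Suc by auto
  then have "C j v u = 0" if "j \<le> d" for j
    using that top Suc by (cases "j = d") auto
  then show ?thesis
    using expansion_eval [of b v a u] by (simp add: add.commute)
qed

lemma card_zeros_on_line:
  assumes "f (a *s u + b *s v) \<noteq> 0"
  shows "card {t. f (v + t *s u) = 0} \<le> d"
    "f u = 0 \<Longrightarrow> card {t. f (v + t *s u) = 0} < d"
proof -
  have *: "card {t. f (v + t *s u) = 0} < d" if "f u = 0"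
    using form_vanishes_on_line [of u "{t. f (v + t *s u) = 0}" v a b] that assms by fastforce
  then show "f u = 0 \<Longrightarrow> card {t. f (v + t *s u) = 0} < d" .
  show "card {t. f (v + t *s u) = 0} \<le> d"
  proof (cases "f u = 0")
    case False
    then have "C d v u \<noteq> 0" by (simp add: coefficient_top)
    then show ?thesis using card_roots_sum_powers(2) [of d d "\<lambda>j. C j v u"] by (simp add: expansion_translate)
  qed (use * in simp)
qed

end

text \<open>If a plane curve contains \<open>k + 1\<close> lines through a point \<open>p\<close>, here the one towards \<open>u\<close> and those towards
  \<open>v + t *s u\<close> for \<open>t \<in> K\<close>, then it has multiplicity at least \<open>k + 1\<close> at \<open>p\<close>: the homogeneous component
  of degree \<open>j \<le> k\<close> of its expansion at \<open>p\<close> is a binary form with more than \<open>j\<close> zeros.\<close>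

lemma planar_lines_through_point:
  fixes f :: "'a::{field,finite} ^ 4 \<Rightarrow> 'a"
  assumes expansion: "bihomogeneous_expansion d f C" and d_less: "d < CARD('a)"
    and line: "\<And>a b. f (a *s p + b *s u) = 0"
    and lines: "\<And>t a b. t \<in> K \<Longrightarrow> f (a *s p + b *s (v + t *s u)) = 0"
    and "j \<le> card K"
  shows "C j p (a *s u + b *s v) = 0"
proof -
  note expansion_facts = expansion d_less
  have "is_form j (C j p)" by (rule coefficient_form(1) [OF expansion_facts])
  then obtain D where D: "bihomogeneous_expansion j (C j p) D"
    using form_bihomogeneous_expansion by blast
  show ?thesis
  proof (cases "j \<le> d")
    case True
    show ?thesis
    proof (rule form_vanishes_on_line [OF D _ _ _ \<open>j \<le> card K\<close>])
      show "j < CARD('a)" using True d_less by simp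
      show "C j p u = 0"
        using line [of 1] by (intro coefficient_zero_on_line [OF expansion_facts]) simp
      show "C j p (v + t *s u) = 0" if "t \<in> K" for t
        using lines [OF that, of 1] by (intro coefficient_zero_on_line [OF expansion_facts]) simp
    qed
  next
    case False
    then show ?thesis using expansion by (simp add: bihomogeneous_expansion_def)
  qed
qed

text \<open>By the preceding lemma the curve has multiplicity at least \<open>card K + 1\<close> at \<open>p\<close>.  Hence a line through
  \<open>p\<close> that is not contained in it meets it in at most \<open>d - 1 - card K\<close> other points.  The bound for the
  sum is stated in a form that is linear in \<open>card K\<close>, so that it can be added up over many points \<open>p\<close>.\<close>

lemma planar_zero_count:
  fixes f :: "'a::{field,finite} ^ 4 \<Rightarrow> 'a"
  assumes expansion: "bihomogeneous_expansion d f C" and d_less: "d < CARD('a)"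
    and line: "\<And>a b. f (a *s p + b *s u) = 0"
    and K: "K = {t \<in> S. \<forall>a b. f (a *s p + b *s (v + t *s u)) = 0}"
    and nonzero: "f (a *s p + (b *s u + c *s v)) \<noteq> 0"
    and S: "card S = q" "CARD('a) = q ^ 2"
  shows "card K < d"
    "(\<Sum>t\<in>S. card {a. f (v + t *s u + a *s p) = 0}) \<le> (d - 1) * q + card K * (q ^ 2 - q)"
proof -
  note expansion_facts = expansion d_less
  define k where "k = card K"
  have zero: "C j p (b *s u + c *s v) = 0" if "j \<le> k" for j b c
    using planar_lines_through_point [OF expansion_facts line _, of K v j b c] that by (auto simp: K k_def)
  have k_less: "k < d"
  proof (rule ccontr)
    assume "\<not> k < d"
    then have "f (a *s p + 1 *s (b *s u + c *s v)) = 0"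
      unfolding expansion_eval [OF expansion_facts] using zero by (intro sum.neutral) auto
    with nonzero show False by simp
  qed
  then show "card K < d" by (simp add: k_def)
  have "finite S" by simp
  have "K \<subseteq> S" using K by auto
  then have "k \<le> q" using S card_mono [of S K] by (simp add: k_def)
  have outside: "card {a. f (v + t *s u + a *s p) = 0} \<le> d - 1 - k" if t: "t \<in> S - K" for t
  proof -
    let ?y = "v + t *s u"
    have Cz: "C j p ?y = 0" if "j \<le> k" for j
      using zero [OF that, of t 1] by (simp add: add.commute)
    obtain a0 b0 where "f (a0 *s p + b0 *s ?y) \<noteq> 0" using t K by auto
    then obtain j where j: "j \<le> d" "C j p ?y \<noteq> 0"
      unfolding expansion_eval [OF expansion_facts] by (metis (no_types, lifting) atMost_iff mult_zero_right sum.neutral)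
    then have "k < j" using Cz by (meson not_le)
    \<comment> \<open>The coefficients of \<open>a ^ i\<close> with \<open>i \<ge> d - k\<close> are components of degree at most \<open>k\<close> at \<open>p\<close>.\<close>
    have "f (?y + a *s p) = (\<Sum>i\<le>d - 1 - k. C (d - i) p ?y * a ^ i)" for a
    proof -
      have "f (?y + a *s p) = (\<Sum>i\<le>d. C (d - i) p ?y * a ^ i)"
        using expansion_at_second [OF expansion_facts, of a p ?y] by (simp add: add.commute)
      also have "\<dots> = (\<Sum>i\<le>d - 1 - k. C (d - i) p ?y * a ^ i)"
      proof (rule sum.mono_neutral_right)
        have "C (d - i) p ?y = 0" if "i \<in> {..d} - {..d - 1 - k}" for i
          using that by (intro Cz) auto
        then show "\<forall>i\<in>{..d} - {..d - 1 - k}. C (d - i) p ?y * a ^ i = 0" by simp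
      qed auto
      finally show ?thesis .
    qed
    then show ?thesis
      using card_roots_sum_powers(2) [of "d - j" "d - 1 - k" "\<lambda>i. C (d - i) p ?y"] j \<open>k < j\<close> by simp
  qed
  have "(\<Sum>t\<in>S. card {a. f (v + t *s u + a *s p) = 0}) =
      (\<Sum>t\<in>K. card {a. f (v + t *s u + a *s p) = 0}) +
      (\<Sum>t\<in>S - K. card {a. f (v + t *s u + a *s p) = 0})"
    using \<open>K \<subseteq> S\<close> by (subst sum.subset_diff [of K S]) (auto simp: add.commute)
  also have "\<dots> \<le> (\<Sum>t\<in>K. q ^ 2) + (\<Sum>t\<in>S - K. d - 1 - k)"
    using outside S(2) by (intro add_mono sum_mono) (auto intro: order_trans [OF card_mono [of UNIV]])
  also have "\<dots> = k * q ^ 2 + (q - k) * (d - 1 - k)"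
    using \<open>K \<subseteq> S\<close> S(1) by (simp add: k_def card_Diff_subset)
  also have "\<dots> \<le> (d - 1) * q + k * (q ^ 2 - q)"
  proof -
    obtain r where r: "q = k + r" using \<open>k \<le> q\<close> by (metis le_iff_add)
    obtain s where s: "d - 1 = k + s" using k_less by (metis Suc_pred' le_iff_add less_Suc_eq_le not_less_zero zero_less_iff_neq_zero)
    have "k * q ^ 2 = k * (q ^ 2 - q) + k * q"
      by (simp add: power2_eq_square flip: distrib_left)
    moreover have "(q - k) * (d - 1 - k) + k * q \<le> (d - 1) * q"
      unfolding s by (simp add: r algebra_simps)
    ultimately show ?thesis by simp
  qed
  finally show "(\<Sum>t\<in>S. card {a. f (v + t *s u + a *s p) = 0}) \<le> (d - 1) * q + card K * (q ^ 2 - q)"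
    by (simp add: k_def)
qed

lemma is_form_1_linear:
  assumes "is_form 1 g"
  shows "g (a *s x + b *s y) = a * g x + b * g y"
proof -
  from assms obtain c where c: "\<forall>i. \<exists>k. c i = (\<lambda>_. k)" "g = (\<lambda>x. \<Sum>i\<in>UNIV. x $ i * c i x)"
    by auto
  from choice [OF c(1)] obtain k where "\<And>i. c i = (\<lambda>_. k i)" by blast
  with c(2) have "g = (\<lambda>x. \<Sum>i\<in>UNIV. x $ i * k i)" by simp
  then show ?thesis
    by (simp add: sum_distrib_left sum.distrib distrib_right mult.assoc)
qed

lemma form_polynomial_on_line:
  fixes g :: "'a::{field,finite} ^ 4 \<Rightarrow> 'a"
  assumes "is_form n g" "n < CARD('a)"
  obtains P where "degree P \<le> n" "\<And>t. poly P t = g (x + t *s y)"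
proof -
  obtain G where G: "bihomogeneous_expansion n g G"
    using form_bihomogeneous_expansion [OF assms(1)] by blast
  show ?thesis
    by (rule that [of "\<Sum>j\<le>n. monom (G j x y) j"])
      (simp_all add: degree_sum_monom poly_sum_monom expansion_translate [OF G assms(2)])
qed

section \<open>Points as spans of vectors\<close>

lemma proj_points_eq: "proj_points = (\<lambda>x. vec.span {x}) ` (- {0 :: 'a::field ^ 4})"
proof (intro subset_antisym subsetI)
  fix P :: "('a ^ 4) set" assume "P \<in> proj_points"
  then have P: "vec.subspace P" "vec.dim P = 1" by (auto simp: proj_points_def)
  then obtain x where x: "x \<in> P" "x \<noteq> 0"
    using vec.dim_eq_0 [of P] by auto
  then have "vec.span {x} = P"
    using P vec.subspace_dim_equal [of "vec.span {x}" P]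
    by (simp add: vec.span_minimal)
  then show "P \<in> (\<lambda>x. vec.span {x}) ` (- {0})" using x by auto
qed (auto simp: proj_points_def vec.subspace_span)

lemma span_singleton_subset_iff:
  "vec.subspace S \<Longrightarrow> vec.span {x} \<subseteq> S \<longleftrightarrow> x \<in> S"
  using vec.span_minimal [of "{x}" S] vec.span_base [of x "{x}"] by auto

lemma span_singleton_eqD:
  fixes x y :: "'a::field ^ 4"
  assumes "vec.span {x} = vec.span {y}" "y \<noteq> 0"
  obtains c where "c \<noteq> 0" "y = c *s x"
proof -
  have "y \<in> vec.span {x}" using assms(1) vec.span_base by auto
  then obtain c where "y = c *s x" by (auto simp: vec.span_singleton)
  with assms(2) that show ?thesis by auto
qed

lemma span_singleton_scale:
  fixes x :: "'a::field ^ 4"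
  shows "c \<noteq> 0 \<Longrightarrow> vec.span {c *s x} = vec.span {x}"
  using vec.span_image_scale [of "{x}" "\<lambda>_. c"] by simp

lemma points_of_eq:
  assumes "vec.subspace S"
  shows "points_of S = (\<lambda>x. vec.span {x}) ` (S - {0})"
  unfolding points_of_def proj_points_eq using span_singleton_subset_iff [OF assms] by auto

lemma VV_eq:
  assumes "is_form d (peval F)"
  shows "VV F = (\<lambda>x. vec.span {x}) ` {x. x \<noteq> 0 \<and> peval F x = 0}"
proof -
  have "(\<forall>y\<in>vec.span {x} - {0}. peval F y = 0) \<longleftrightarrow> peval F x = 0" if "x \<noteq> 0" for x
    using that vec.span_base [of x "{x}"] is_form_homogeneous [OF assms]
    by (auto simp: vec.span_singleton)
  then show ?thesis
    by (auto simp: VV_def proj_points_eq)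
qed

lemma span_pair: "vec.span {u, v :: 'a::field ^ 4} = {a *s u + b *s v | a b. True}"
  by (auto simp: vec.span_insert vec.span_singleton algebra_simps eq_diff_eq)

lemma independent_pair:
  fixes u v :: "'a::field ^ 4"
  assumes "\<And>a b. a *s u + b *s v = 0 \<Longrightarrow> a = 0 \<and> b = 0"
  shows "vec.dim {u, v} = 2"
proof -
  have "v \<noteq> 0" using assms [of 0 1] by auto
  moreover have "u \<notin> vec.span {v}"
    using assms [of 1 "- c" for c] by (auto simp: vec.span_singleton)
  ultimately show ?thesis by (simp add: vec.dim_insert)
qed

lemma plane_eq_span:
  fixes u v :: "'a::field ^ 4"
  assumes "vec.subspace S" "vec.dim S = 2" "u \<in> S" "v \<in> S"
    "\<And>a b. a *s u + b *s v = 0 \<Longrightarrow> a = 0 \<and> b = 0"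
  shows "S = {a *s u + b *s v | a b. True}"
proof -
  have "vec.span {u, v} = S"
    using assms independent_pair [OF assms(5)]
    by (intro vec.subspace_dim_equal vec.span_minimal) auto
  then show ?thesis by (simp add: span_pair)
qed

text \<open>Adding one vector outside the kernel to the kernel spans the subspace again.\<close>

lemma dim_kernel:
  fixes S :: "('a::field ^ 4) set" and f :: "'a ^ 4 \<Rightarrow> 'a"
  assumes S: "vec.subspace S" and "y \<in> S" "f y \<noteq> 0"
    and add: "\<And>x y. f (x + y) = f x + f y" and scale: "\<And>c x. f (c *s x) = c * f x"
  shows "vec.subspace {x \<in> S. f x = 0}" "vec.dim S = Suc (vec.dim {x \<in> S. f x = 0})"
proof -
  let ?K = "{x \<in> S. f x = 0}"
  have [simp]: "f 0 = 0" using scale [of 0 0] by simp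
  show K: "vec.subspace ?K"
    using S by (auto simp: vec.subspace_def add scale)
  have "S = vec.span (insert y ?K)"
  proof
    show "S \<subseteq> vec.span (insert y ?K)"
    proof
      fix x assume x: "x \<in> S"
      define c where "c = f x / f y"
      have "x + (- c) *s y \<in> S"
        using x S \<open>y \<in> S\<close> by (intro vec.subspace_add vec.subspace_scale)
      moreover have "f (x + (- c) *s y) = 0"
        using assms(3) by (simp only: add scale) (simp add: c_def)
      ultimately have "x - c *s y \<in> ?K" by simp
      then have "x - c *s y \<in> vec.span ?K" by (rule vec.span_base)
      then show "x \<in> vec.span (insert y ?K)" unfolding vec.span_insert by blast
    qed
    show "vec.span (insert y ?K) \<subseteq> S"
      using S \<open>y \<in> S\<close> by (intro vec.span_minimal) auto
  qed
  then have "vec.dim S = vec.dim (vec.span (insert y ?K))"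
    by (rule arg_cong)
  also have "\<dots> = vec.dim (insert y ?K)"
    by (rule vec.dim_span)
  also have "\<dots> = Suc (vec.dim ?K)"
  proof -
    have "vec.span ?K = ?K" using K by simp
    then have "y \<notin> vec.span ?K" using assms(3) by (simp only: mem_Collect_eq) simp
    then show ?thesis by (simp add: vec.dim_insert)
  qed
  finally show "vec.dim S = Suc (vec.dim ?K)" .
qed

section \<open>The conjugation of a field of square order\<close>

text \<open>Multiplication by \<open>x \<noteq> 0\<close> permutes the nonzero elements; compare their products.\<close>

lemma finite_field_power_card:
  fixes x :: "'a::{field,finite}"
  shows "x ^ CARD('a) = x"
proof (cases "x = 0")
  case False
  have "(\<Prod>y\<in>UNIV-{0}. x * y) = (\<Prod>y\<in>UNIV-{0}. y)"
    by (rule prod.reindex_bij_witness [of _ "\<lambda>y. y / x" "\<lambda>y. x * y"]) (use False in auto)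
  then have "x ^ card (UNIV - {0 :: 'a}) * (\<Prod>y\<in>UNIV-{0}. y) = (\<Prod>y\<in>UNIV-{0}. y :: 'a)"
    by (simp add: prod.distrib)
  moreover have "(\<Prod>y\<in>UNIV-{0}. y :: 'a) \<noteq> 0"
    by (simp add: prod_zero_iff)
  ultimately have "x ^ card (UNIV - {0 :: 'a}) = 1" by simp
  moreover have "CARD('a) = Suc (card (UNIV - {0 :: 'a}))"
    using card.remove [of "UNIV :: 'a set" 0] by simp
  ultimately show ?thesis by (simp only: power_Suc mult_1_right)
qed (simp add: power_0_left)

locale hermitian =
  fixes q :: nat and A :: "'a::{field,finite} ^ 4 ^ 4"
  assumes primepow_q: "primepow q" and card_field: "CARD('a) = q ^ 2"
    and nondeg_A: "nondeg_hermitian q A"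
begin

lemma q_ge_2: "2 \<le> q"
  using primepow_gt_Suc_0 [OF primepow_q] by simp

lemma q_pos [simp]: "0 < q" "q \<noteq> 0"
  using q_ge_2 by simp_all

lemma frob_add: "(x + y :: 'a) ^ q = x ^ q + y ^ q"
proof -
  obtain p k where p: "prime p" "q = p ^ k"
    using primepow_q by (auto simp: primepow_def)
  have char: "CHAR('a) dvd p ^ k"
    using of_nat_q_eq_0 [OF card_field] p by (simp only: of_nat_eq_0_iff_char_dvd)
  then obtain i where i: "CHAR('a) = p ^ i" "i \<le> k"
    using p(1) by (auto simp: divides_primepow_nat)
  have "prime CHAR('a)"
    using prime_CHAR_semidom [where 'a = 'a] finite_imp_CHAR_pos [where 'a = 'a] by simp
  then have "CHAR('a) = p"
    using i p(1) by (metis prime_dvd_power primes_dvd_imp_eq dvd_refl)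
  then show ?thesis
    using freshmans_dream' [of q k x y] \<open>prime CHAR('a)\<close> p(2) by simp
qed

lemma frob_frob [simp]: "((x :: 'a) ^ q) ^ q = x"
  using finite_field_power_card [of x] by (simp add: card_field power_mult [symmetric] power2_eq_square)

lemma frob_zero [simp]: "(0 :: 'a) ^ q = 0"
  by (simp add: power_0_left)

lemma frob_minus: "(- x :: 'a) ^ q = - (x ^ q)"
  using frob_add [of x "- x"] by (simp add: eq_neg_iff_add_eq_0 add.commute)

lemma frob_diff: "(x - y :: 'a) ^ q = x ^ q - y ^ q"
  using frob_add [of x "- y"] by (simp add: frob_minus)

lemma frob_sum: "(\<Sum>i\<in>I. f i :: 'a) ^ q = (\<Sum>i\<in>I. f i ^ q)"
  by (induction I rule: infinite_finite_induct) (auto simp: frob_add)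

lemma frob_eq_iff: "(x :: 'a) ^ q = y ^ q \<longleftrightarrow> x = y"
  by (metis frob_frob)

lemma card_fixed_le: "card {x :: 'a. x ^ q = x} \<le> q"
proof -
  have "(\<Sum>j\<le>q. (if j = q then 1 else if j = 1 then -1 else 0) * x ^ j) = x ^ q - x" for x :: 'a
  proof -
    have "(\<Sum>j\<le>q. (if j = q then 1 else if j = 1 then -1 else 0) * x ^ j) =
        (\<Sum>j\<in>{q, 1}. (if j = q then 1 else -1) * x ^ j)"
      using q_ge_2 by (intro sum.mono_neutral_cong_right) auto
    then show ?thesis using q_ge_2 by simp
  qed
  then show ?thesis
    using card_roots_sum_powers(2) [of q q "\<lambda>j. if j = q then 1 else if j = 1 then -1 else 0 :: 'a"]
    by simp
qed

lemma card_trace_kernel_le: "card {x :: 'a. x + x ^ q = 0} \<le> q"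
proof -
  have "(\<Sum>j\<le>q. (if j = q then 1 else if j = 1 then 1 else 0) * x ^ j) = x + x ^ q" for x :: 'a
  proof -
    have "(\<Sum>j\<le>q. (if j = q then 1 else if j = 1 then 1 else 0) * x ^ j) =
        (\<Sum>j\<in>{q, 1}. x ^ j)"
      using q_ge_2 by (intro sum.mono_neutral_cong_right) auto
    then show ?thesis using q_ge_2 by simp
  qed
  then show ?thesis
    using card_roots_sum_powers(2) [of q q "\<lambda>j. if j = q then 1 else if j = 1 then 1 else 0 :: 'a"]
    by simp
qed

text \<open>A fibre of \<open>x \<mapsto> x + x\<^sup>q\<close> is empty or a coset of the kernel, which has at most \<open>q\<close> elements, and the
  image lies among the at most \<open>q\<close> fixed elements of the conjugation.  As the field has \<open>q\<^sup>2\<close> elements,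
  equality must hold everywhere.\<close>

lemma card_trace_fibre:
  assumes "z ^ q = (z :: 'a)"
  shows "card {x. x + x ^ q = z} = q"
proof -
  let ?F = "{z :: 'a. z ^ q = z}" and ?T = "\<lambda>z. {x :: 'a. x + x ^ q = z}"
  have le: "card (?T z) \<le> q" for z
  proof (cases "?T z = {}")
    case False
    then obtain y where y: "y + y ^ q = z" by auto
    have "card (?T z) \<le> card (?T 0)"
      using y by (intro card_inj_on_le [where f = "\<lambda>x. x - y"])
        (auto simp: inj_on_def frob_diff algebra_simps)
    then show ?thesis using card_trace_kernel_le by simp
  qed auto
  have "(\<Sum>z\<in>?F. card (?T z)) = card (\<Union>z\<in>?F. ?T z)"
    by (intro card_UN_disjoint [symmetric]) auto
  also have "(\<Union>z\<in>?F. ?T z) = UNIV"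
    by (auto simp: frob_add add.commute)
  finally have total: "(\<Sum>z\<in>?F. card (?T z)) = q * q"
    by (simp add: card_field power2_eq_square)
  show ?thesis
  proof (rule ccontr)
    assume "card (?T z) \<noteq> q"
    then have "(\<Sum>z\<in>?F. card (?T z)) < (\<Sum>z\<in>?F. q)"
      using assms le by (intro sum_strict_mono_ex1) (auto intro!: exI [of _ z] simp: le_less)
    also have "\<dots> \<le> q * q"
      using card_fixed_le by simp
    finally show False using total by simp
  qed
qed

lemma card_trace_equation:
  assumes "z ^ q = (z :: 'a)" "b \<noteq> 0"
  shows "card {x. z + x * b + (x * b) ^ q = 0} = q"
proof -
  have "{x. x + x ^ q = - z} = (\<lambda>x. x * b) ` {x. z + x * b + (x * b) ^ q = 0}"
  proof (intro subset_antisym subsetI)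
    fix x assume "x \<in> {x. x + x ^ q = - z}"
    then have "x / b \<in> {x. z + x * b + (x * b) ^ q = 0}"
      using assms(2) by (simp add: add.assoc)
    moreover have "x = x / b * b" using assms(2) by simp
    ultimately show "x \<in> (\<lambda>x. x * b) ` {x. z + x * b + (x * b) ^ q = 0}"
      by blast
  qed (auto simp: eq_neg_iff_add_eq_0 add_ac)
  moreover have "inj_on (\<lambda>x. x * b) {x. z + x * b + (x * b) ^ q = 0}"
    using assms(2) by (auto simp: inj_on_def)
  ultimately show ?thesis
    using card_trace_fibre [of "- z"] assms(1) by (simp add: card_image frob_minus)
qed

text \<open>The fibres of \<open>x \<mapsto> x\<^sup>q\<^sup>+\<^sup>1\<close> have at most \<open>q + 1\<close> elements, so the \<open>q\<^sup>2 - 1\<close> nonzero elements need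
  all of the at most \<open>q - 1\<close> nonzero values that are fixed by the conjugation.\<close>

lemma norm_surjective:
  assumes "z ^ q = (z :: 'a)"
  shows "\<exists>x. x ^ Suc q = z"
proof (rule ccontr)
  assume *: "\<not> ?thesis"
  then have "z \<noteq> 0" by (metis power_0_Suc)
  let ?F = "{z :: 'a. z ^ q = z} - {0}" and ?T = "\<lambda>z. {x :: 'a. x ^ Suc q = z}"
  have le: "card (?T y) \<le> Suc q" for y
  proof -
    have "(\<Sum>j\<le>Suc q. (if j = Suc q then 1 else if j = 0 then -y else 0) * x ^ j) = x ^ Suc q - y" for x
    proof -
      have "(\<Sum>j\<le>Suc q. (if j = Suc q then 1 else if j = 0 then -y else 0) * x ^ j) =
          (\<Sum>j\<in>{Suc q, 0}. (if j = Suc q then 1 else -y) * x ^ j)"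
        by (intro sum.mono_neutral_cong_right) auto
      then show ?thesis by simp
    qed
    then show ?thesis
      using card_roots_sum_powers(2) [of "Suc q" "Suc q" "\<lambda>j. if j = Suc q then 1 else if j = 0 then -y else 0"]
      by simp
  qed
  have "(x ^ Suc q) ^ q = x ^ Suc q" for x :: 'a
    by (simp only: power_Suc power_mult_distrib frob_frob mult.commute)
  then have "UNIV - {0} \<subseteq> (\<Union>y\<in>?F - {z}. ?T y)"
    using * by (auto simp del: power_Suc)
  then have "card (UNIV - {0 :: 'a}) \<le> card (\<Union>y\<in>?F - {z}. ?T y)"
    by (intro card_mono) auto
  also have "\<dots> \<le> (\<Sum>y\<in>?F - {z}. card (?T y))"
    by (rule card_UN_le) simp
  also have "\<dots> \<le> (\<Sum>y\<in>?F - {z}. Suc q)"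
    by (intro sum_mono le)
  also have "\<dots> = card (?F - {z}) * Suc q"
    by simp
  also have "card (?F - {z}) = card {z :: 'a. z ^ q = z} - 2"
    using assms \<open>z \<noteq> 0\<close> by (simp add: card_Diff_singleton_if)
  also have "(card {z :: 'a. z ^ q = z} - 2) * Suc q \<le> (q - 2) * Suc q"
    using card_fixed_le by (intro mult_right_mono) auto
  finally have "q ^ 2 - 1 \<le> (q - 2) * Suc q"
    by (simp add: card_field)
  moreover obtain r where "q = r + 2" using q_ge_2 by (metis le_add_diff_inverse2)
  ultimately show False
    by (simp add: power2_eq_square)
qed

section \<open>The Hermitian form\<close>

definition h :: "'a ^ 4 \<Rightarrow> 'a ^ 4 \<Rightarrow> 'a" where
  "h x y = (\<Sum>i\<in>UNIV. \<Sum>j\<in>UNIV. A $ i $ j * x $ i * (y $ j) ^ q)"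

lemma h_add_left: "h (x + y) z = h x z + h y z"
  by (simp add: h_def algebra_simps sum.distrib)

lemma h_add_right: "h x (y + z) = h x y + h x z"
  by (simp add: h_def algebra_simps sum.distrib frob_add)

lemma h_scale_left: "h (c *s x) y = c * h x y"
  by (simp add: h_def sum_distrib_left mult_ac)

lemma h_scale_right: "h x (c *s y) = c ^ q * h x y"
  by (simp add: h_def sum_distrib_left mult_ac power_mult_distrib)

lemma h_zero [simp]: "h 0 x = 0" "h x 0 = 0"
  by (simp_all add: h_def)

lemma h_sym: "h y x = h x y ^ q"
proof -
  have A: "A $ j $ i = (A $ i $ j) ^ q" for i j
  proof -
    have "transpose A = (\<chi> i j. (A $ i $ j) ^ q)"
      using nondeg_A unfolding nondeg_hermitian_def by blast
    then have "transpose A $ i $ j = (\<chi> i j. (A $ i $ j) ^ q) $ i $ j"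
      by (rule arg_cong)
    then show ?thesis unfolding transpose_def vec_lambda_beta .
  qed
  have "h x y ^ q = (\<Sum>i\<in>UNIV. \<Sum>j\<in>UNIV. A $ j $ i * (x $ i) ^ q * y $ j)"
    by (simp add: h_def frob_sum power_mult_distrib A [symmetric])
  also have "\<dots> = h y x"
    unfolding h_def by (subst sum.swap) (simp add: mult_ac)
  finally show ?thesis ..
qed

lemma h_sym_zero: "h x y = 0 \<Longrightarrow> h y x = 0"
  by (subst h_sym) simp

lemma h_self_fixed: "h x x ^ q = h x x"
  by (rule h_sym [symmetric])

lemma nondegenerate:
  assumes "y \<noteq> 0"
  obtains x where "h x y \<noteq> 0"
proof -
  have "y = 0" if "\<And>x. h x y = 0"
  proof -
    let ?y = "\<chi> j. (y $ j) ^ q"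
    have "(A *v ?y) $ i = h (axis i 1) y" for i
    proof -
      have "h (axis i 1) y = (\<Sum>k\<in>UNIV. if k = i then \<Sum>j\<in>UNIV. A $ i $ j * (y $ j) ^ q else 0)"
        unfolding h_def by (intro sum.cong) (auto simp: axis_def)
      then show ?thesis by (simp add: matrix_vector_mult_def)
    qed
    then have "A *v ?y = 0" using that by (simp add: vec_eq_iff)
    moreover have "invertible A" using nondeg_A by (simp add: nondeg_hermitian_def)
    then obtain B where "B ** A = mat 1" by (auto simp: invertible_def)
    ultimately have "?y = 0"
      by (metis matrix_vector_mul_assoc matrix_vector_mul_lid matrix_vector_mult_0_right)
    then show "y = 0" by (simp add: vec_eq_iff)
  qed
  then show ?thesis using assms that by blast
qed

lemma herm_poly_eq_h: "peval (herm_poly q A) x = h x x"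
  by (simp add: peval_herm_poly h_def)

lemma h_diff_left: "h (x - y) z = h x z - h y z"
  using h_add_left [of "x - y" y z] by simp

lemma h_diff_right: "h x (y - z) = h x y - h x z"
  using h_add_right [of x "y - z" z] by simp

lemmas h_linear = h_add_left h_add_right h_diff_left h_diff_right h_scale_left h_scale_right

text \<open>The points of \<open>V\<^sub>2\<close> that lie in a cone \<open>S\<close> of vectors.\<close>

definition iso_points :: "('a ^ 4) set \<Rightarrow> ('a ^ 4) set set" where
  "iso_points S = (\<lambda>x. vec.span {x}) ` {x \<in> S. x \<noteq> 0 \<and> h x x = 0}"

definition perp :: "'a ^ 4 \<Rightarrow> ('a ^ 4) set" where
  "perp p = {x. h x p = 0}"

text \<open>Two cones have a point in common only through a common vector, because one of them is closed under
  scaling.\<close>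

lemma span_image_Int:
  fixes S T :: "('a ^ 4) set"
  assumes "\<And>c x. c \<noteq> 0 \<Longrightarrow> x \<in> T \<Longrightarrow> c *s x \<in> T"
  shows "(\<lambda>x. vec.span {x}) ` (S - {0}) \<inter> (\<lambda>x. vec.span {x}) ` (T - {0}) =
    (\<lambda>x. vec.span {x}) ` (S \<inter> T - {0})"
proof (intro subset_antisym subsetI)
  fix P assume "P \<in> (\<lambda>x. vec.span {x}) ` (S - {0}) \<inter> (\<lambda>x. vec.span {x}) ` (T - {0})"
  then obtain x y where xy: "x \<in> S" "x \<noteq> 0" "y \<in> T" "P = vec.span {x}" "vec.span {y} = vec.span {x}"
    by blast
  obtain c where "c \<noteq> 0" "x = c *s y" using span_singleton_eqD [OF xy(5,2)] .
  then show "P \<in> (\<lambda>x. vec.span {x}) ` (S \<inter> T - {0})" using xy assms by blast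
qed blast

lemma is_form_herm: "is_form (Suc q) (peval (herm_poly q A))"
proof (rule is_form_peval)
  show "homogeneous (Suc q) (herm_poly q A)"
  proof -
    have "(\<Sum>k\<in>UNIV. Poly_Mapping.lookup m k) = Suc q"
      if "m = Poly_Mapping.single i 1 + Poly_Mapping.single j q" for m :: "4 \<Rightarrow>\<^sub>0 nat" and i j
      using that by (simp add: lookup_add sum.distrib lookup_single when_def del: One_nat_def)
    moreover have "Poly_Mapping.keys (herm_poly q A) \<subseteq>
        (\<Union>i. \<Union>j. {Poly_Mapping.single i 1 + Poly_Mapping.single j q})"
      unfolding herm_poly_def
      by (intro order_trans [OF keys_sum] UN_mono order_refl) auto
    ultimately show ?thesis unfolding homogeneous_def by blast
  qed
qed

lemma VV_herm: "VV (herm_poly q A) = iso_points UNIV"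
  by (simp add: VV_eq [OF is_form_herm] iso_points_def herm_poly_eq_h)

lemma iso_points_alt: "iso_points S = (\<lambda>x. vec.span {x}) ` (S \<inter> {x. h x x = 0} - {0})"
  unfolding iso_points_def by (rule arg_cong [where f = "image _"]) auto

lemma points_of_Int_VV_herm:
  assumes "vec.subspace S"
  shows "points_of S \<inter> VV (herm_poly q A) = iso_points S"
  unfolding VV_herm iso_points_alt points_of_eq [OF assms]
  by (subst span_image_Int) (auto simp: h_linear)

lemma VV_Int_VV_herm:
  assumes "is_form d (peval F)"
  shows "VV F \<inter> VV (herm_poly q A) = iso_points {x. peval F x = 0}"
proof -
  have "VV F = (\<lambda>x. vec.span {x}) ` ({x. peval F x = 0} - {0})"
    unfolding VV_eq [OF assms] by (rule arg_cong [where f = "image _"]) auto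
  then show ?thesis
    unfolding VV_herm iso_points_alt by (simp only:) (subst span_image_Int, auto simp: h_linear)
qed

lemma finite_iso_points [simp]: "finite (iso_points S)"
  by (simp add: iso_points_def)

lemma iso_points_Un: "iso_points (S \<union> T) = iso_points S \<union> iso_points T"
  by (auto simp: iso_points_def)

lemma iso_points_Int:
  assumes "vec.subspace T"
  shows "iso_points (S \<inter> T) = iso_points S \<inter> iso_points T"
  unfolding iso_points_alt
  using assms by (subst span_image_Int) (auto simp: h_linear vec.subspace_scale intro!: arg_cong [where f = "image _"])

lemma subspace_perp: "vec.subspace (perp p)"
  by (auto simp: perp_def vec.subspace_def h_linear)

text \<open>The partial derivatives of \<open>x\<^sup>T A x\<^sup>(\<^sup>q\<^sup>)\<close> see only the factor \<open>x\<close>, since \<open>q = 0\<close> in the field.\<close>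

lemma tangent_space_eq_perp:
  assumes "p \<noteq> 0"
  shows "tangent_space (herm_poly q A) (vec.span {p}) = perp p"
proof -
  have "(\<Sum>i\<in>UNIV. peval (partial_deriv i (herm_poly q A)) y * x $ i) = h x y" for x y
    by (simp add: peval_partial_deriv_herm_poly [OF card_field] h_def sum_distrib_left mult_ac)
  then have "tangent_space (herm_poly q A) (vec.span {p}) = {x. \<forall>y\<in>vec.span {p} - {0}. h x y = 0}"
    by (simp add: tangent_space_def)
  also have "\<dots> = perp p"
    using assms vec.span_base [of p "{p}"] by (auto simp: perp_def vec.span_singleton h_linear)
  finally show ?thesis .
qed

lemma dim_perp:
  assumes "p \<noteq> 0"
  shows "vec.dim (perp p) = 3"
proof -
  obtain y where "h y p \<noteq> 0" using nondegenerate [OF assms] .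
  then have "vec.dim (UNIV :: ('a ^ 4) set) = Suc (vec.dim {x \<in> UNIV. h x p = 0})"
    by (intro dim_kernel(2) [of UNIV y]) (auto simp: h_linear)
  moreover have "vec.dim (UNIV :: ('a ^ 4) set) = 4"
    using vec_dim_card [where 'a = 'a and 'n = 4] by simp
  ultimately show ?thesis
    by (simp add: perp_def)
qed

lemma tangent_plane_iff:
  "tangent_plane (herm_poly q A) T \<longleftrightarrow> (\<exists>p. p \<noteq> 0 \<and> h p p = 0 \<and> T = perp p)"
proof -
  have "(\<exists>P\<in>VV (herm_poly q A). T = tangent_space (herm_poly q A) P) \<longleftrightarrow>
      (\<exists>p. p \<noteq> 0 \<and> h p p = 0 \<and> T = perp p)"
    unfolding VV_herm iso_points_def using tangent_space_eq_perp by auto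
  moreover have "proj_plane (perp p)" if "p \<noteq> 0" for p
    using that by (simp add: proj_plane_def dim_perp subspace_perp)
  ultimately show ?thesis unfolding tangent_plane_def by blast
qed

section \<open>Isotropic vectors and secant lines\<close>

lemma h_lincomb_self: "h (a *s u + b *s v) (a *s u + b *s v) =
    a * a ^ q * h u u + (a ^ q * b * h v u + (a ^ q * b * h v u) ^ q) + b * b ^ q * h v v"
proof -
  have "(a ^ q * b * h v u) ^ q = a * b ^ q * h u v"
    by (simp only: power_mult_distrib frob_frob h_sym [of u v])
  then show ?thesis by (simp only:) (simp add: h_linear algebra_simps)
qed

text \<open>If \<open>u\<close> is not isotropic, replace \<open>v\<close> by a vector \<open>w\<close> orthogonal to \<open>u\<close>.  Then \<open>a *s u + w\<close> is isotropic
  iff \<open>a\<^sup>q\<^sup>+\<^sup>1\<close> has a prescribed value, which is fixed by the conjugation and hence a norm.\<close>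

lemma isotropic_in_pair:
  obtains a b where "(a, b) \<noteq> (0, 0)" "h (a *s u + b *s v) (a *s u + b *s v) = 0"
proof (cases "h u u = 0")
  case True
  then show ?thesis using that [of 1 0] by simp
next
  case False
  define c where "c = h v u / h u u"
  define w where "w = v - c *s u"
  have w: "h w u = 0"
    using False h_add_left [of w "c *s u" u] by (simp add: w_def c_def h_scale_left)
  have "(- h w w / h u u) ^ q = - h w w / h u u"
    by (simp add: power_divide frob_minus h_self_fixed)
  then obtain a where a: "a ^ Suc q = - h w w / h u u"
    using norm_surjective by blast
  have "h (a *s u + 1 *s w) (a *s u + 1 *s w) = 0"
    unfolding h_lincomb_self using a w False by (simp add: field_simps)
  moreover have "a *s u + 1 *s w = (a - c) *s u + 1 *s v"
    by (simp add: w_def vec_eq_iff algebra_simps)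
  ultimately have "h ((a - c) *s u + 1 *s v) ((a - c) *s u + 1 *s v) = 0"
    by (simp only:)
  then show ?thesis by (rule that [rotated]) simp
qed

lemma independent_vector_in:
  fixes S :: "('a ^ 4) set"
  assumes "vec.subspace S" "2 \<le> vec.dim S" "u \<in> S" "u \<noteq> 0"
  obtains v where "v \<in> S" "\<forall>a b. a *s u + b *s v = 0 \<longrightarrow> a = 0 \<and> b = 0"
proof -
  have "\<not> S \<subseteq> vec.span {u}"
  proof
    assume "S \<subseteq> vec.span {u}"
    then have "vec.dim S \<le> vec.dim {u}" by (rule vec.dim_mono)
    then show False using assms(2) by (simp split: if_splits)
  qed
  then obtain v where v: "v \<in> S" "v \<notin> vec.span {u}" by auto
  have "a = 0 \<and> b = 0" if "a *s u + b *s v = 0" for a b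
  proof -
    have "b = 0"
    proof (rule ccontr)
      assume "b \<noteq> 0"
      then have "v = (- a / b) *s u"
        using that by (simp add: vec_eq_iff field_simps eq_neg_iff_add_eq_0 add_ac)
      moreover have "(- a / b) *s u \<in> vec.span {u}"
        by (intro vec.span_scale vec.span_base) simp
      ultimately show False using v(2) by simp
    qed
    with that assms(4) show ?thesis by simp
  qed
  then show ?thesis using that v(1) by blast
qed

lemma isotropic_in_subspace:
  assumes "vec.subspace S" "2 \<le> vec.dim S"
  obtains x where "x \<in> S" "x \<noteq> 0" "h x x = 0"
proof -
  have "vec.dim S \<noteq> 0" using assms(2) by linarith
  then obtain u where u: "u \<in> S" "u \<noteq> 0" unfolding vec.dim_eq_0 by blast
  from independent_vector_in [OF assms u] obtain v where
    v: "v \<in> S" "\<forall>a b. a *s u + b *s v = 0 \<longrightarrow> a = 0 \<and> b = 0" .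
  obtain a b where "(a, b) \<noteq> (0, 0)" "h (a *s u + b *s v) (a *s u + b *s v) = 0"
    by (rule isotropic_in_pair)
  moreover from this v(2) have "a *s u + b *s v \<noteq> 0" by auto
  moreover have "a *s u + b *s v \<in> S"
    using u v assms(1) by (intro vec.subspace_add vec.subspace_scale)
  ultimately show ?thesis using that by blast
qed

text \<open>Along \<open>w + c *s u\<close> with \<open>u\<close> isotropic, isotropy is an equation for the trace of \<open>c * h u w\<close>.\<close>

lemma card_isotropic_translates:
  assumes "h u u = 0" "h u w \<noteq> 0"
  shows "card {c. h (w + c *s u) (w + c *s u) = 0} = q"
proof -
  have "h (w + c *s u) (w + c *s u) = h w w + c * h u w + (c * h u w) ^ q" for c
    using h_lincomb_self [of 1 w c u] assms(1) by simp
  then show ?thesis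
    using card_trace_equation [OF h_self_fixed assms(2)] by simp
qed

text \<open>The line contains an isotropic point \<open>u\<close>.  Its other points are \<open>v + c *s u\<close>, and \<open>q\<close> of them are
  isotropic.\<close>

lemma card_iso_points_nondegenerate_line:
  assumes S: "vec.subspace S" "vec.dim S = 2"
    and nd: "\<And>x. x \<in> S \<Longrightarrow> x \<noteq> 0 \<Longrightarrow> \<exists>y\<in>S. h y x \<noteq> 0"
  shows "card (iso_points S) = q + 1"
proof -
  obtain u where u: "u \<in> S" "u \<noteq> 0" "h u u = 0"
    using isotropic_in_subspace [OF S(1)] S(2) by auto
  obtain v where v: "v \<in> S" "h v u \<noteq> 0" using nd u by blast
  have ind: "a = 0 \<and> b = 0" if "a *s u + b *s v = 0" for a b
  proof -
    have "h (a *s u + b *s v) u = b * h v u" using u(3) by (simp add: h_linear)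
    then have "b = 0" using that v(2) by simp
    then show ?thesis using that u(2) by simp
  qed
  have S_eq: "S = {a *s u + b *s v | a b. True}"
    by (rule plane_eq_span [OF S u(1) v(1) ind])
  let ?C = "{c. h (v + c *s u) (v + c *s u) = 0}"
  have nz: "v + c *s u \<noteq> 0" for c
    using ind [of c 1] by (auto simp: add.commute)
  have inS: "v + c *s u \<in> S" for c
    using u v S(1) by (simp add: vec.subspace_add vec.subspace_scale)
  have "iso_points S = insert (vec.span {u}) ((\<lambda>c. vec.span {v + c *s u}) ` ?C)"
  proof (intro subset_antisym subsetI)
    fix P assume "P \<in> iso_points S"
    then obtain a b where x: "a *s u + b *s v \<noteq> 0"
        "h (a *s u + b *s v) (a *s u + b *s v) = 0" "P = vec.span {a *s u + b *s v}"
      by (auto simp: iso_points_def S_eq)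
    show "P \<in> insert (vec.span {u}) ((\<lambda>c. vec.span {v + c *s u}) ` ?C)"
    proof (cases "b = 0")
      case True
      then show ?thesis using x by (auto simp: span_singleton_scale)
    next
      case False
      have eq: "a *s u + b *s v = b *s (v + (a / b) *s u)"
        using False by (simp add: vec_eq_iff field_simps)
      have "P = vec.span {v + (a / b) *s u}"
        unfolding x(3) eq by (rule span_singleton_scale [OF False])
      moreover have "a / b \<in> ?C"
        using x(2) False unfolding eq h_scale_left h_scale_right by simp
      ultimately show ?thesis by blast
    qed
  next
    fix P assume "P \<in> insert (vec.span {u}) ((\<lambda>c. vec.span {v + c *s u}) ` ?C)"
    then show "P \<in> iso_points S"
      using u nz inS by (auto simp: iso_points_def)
  qed
  moreover have "vec.span {u} \<notin> (\<lambda>c. vec.span {v + c *s u}) ` ?C"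
  proof
    assume "vec.span {u} \<in> (\<lambda>c. vec.span {v + c *s u}) ` ?C"
    then obtain c where "vec.span {u} = vec.span {v + c *s u}" by auto
    from span_singleton_eqD [OF this nz] obtain k where "v + c *s u = k *s u" by auto
    then show False using ind [of "c - k" 1] by (auto simp: vec_eq_iff algebra_simps)
  qed
  moreover have "inj_on (\<lambda>c. vec.span {v + c *s u}) ?C"
  proof (rule inj_onI)
    fix c d assume "vec.span {v + c *s u} = vec.span {v + d *s u}"
    from span_singleton_eqD [OF this nz] obtain k where "v + d *s u = k *s (v + c *s u)" by auto
    then have "(k * c - d) *s u + (k - 1) *s v = 0"
      by (simp add: vec_eq_iff algebra_simps)
    from ind [OF this] show "c = d" by auto
  qed
  moreover have "card ?C = q"
    using card_isotropic_translates u(3) v(2) h_sym_zero by blast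
  ultimately show ?thesis by (simp add: card_image)
qed

text \<open>The vectors \<open>p\<close> and \<open>r\<close> span a complement of \<open>perp p \<inter> perp r\<close> to which \<open>x\<close> is orthogonal, so some
  vector of the intersection must pair with \<open>x\<close>.\<close>

lemma perp_perp_nondegenerate:
  assumes "h p p = 0" "h r r = 0" "h p r \<noteq> 0" "x \<in> perp p \<inter> perp r" "x \<noteq> 0"
  shows "\<exists>y\<in>perp p \<inter> perp r. h y x \<noteq> 0"
proof -
  have rp: "h r p \<noteq> 0" using assms(3) h_sym_zero by blast
  have x: "h p x = 0" "h r x = 0" using assms(4) h_sym_zero by (auto simp: perp_def)
  obtain y where y: "h y x \<noteq> 0" using nondegenerate [OF assms(5)] .
  define z where "z = y + (- h y r / h p r) *s p + (- h y p / h r p) *s r"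
  have "z \<in> perp p \<inter> perp r"
    using assms(1-3) rp by (simp add: z_def perp_def h_linear)
  moreover have "h z x \<noteq> 0"
    using x y by (simp add: z_def h_linear)
  ultimately show ?thesis by blast
qed

lemma dim_perp_Int:
  assumes "p \<noteq> 0" "y \<in> perp p" "h y r \<noteq> 0"
  shows "vec.dim (perp p \<inter> perp r) = 2"
proof -
  have "vec.dim (perp p) = Suc (vec.dim {x \<in> perp p. h x r = 0})"
    using assms by (intro dim_kernel(2) [OF subspace_perp assms(2)]) (auto simp: h_linear)
  moreover have "{x \<in> perp p. h x r = 0} = perp p \<inter> perp r" by (auto simp: perp_def)
  ultimately show ?thesis using dim_perp [OF assms(1)] by simp
qed

lemma polar_line_secant:
  assumes "h p p = 0" "h r r = 0" "h p r \<noteq> 0"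
  shows "vec.dim (perp p \<inter> perp r) = 2" "card (iso_points (perp p \<inter> perp r)) = q + 1"
proof -
  show dim: "vec.dim (perp p \<inter> perp r) = 2"
    using assms by (intro dim_perp_Int [of p p r]) (auto simp: perp_def)
  show "card (iso_points (perp p \<inter> perp r)) = q + 1"
    using assms by (intro card_iso_points_nondegenerate_line dim perp_perp_nondegenerate
        vec.subspace_inter subspace_perp)
qed

section \<open>Frames adapted to a line of the surface\<close>

text \<open>The vectors \<open>e0\<close> and \<open>e1\<close> span a line of \<open>V\<^sub>2\<close>, and \<open>e2\<close> and \<open>e3\<close> are dual to them.  The point \<open>e0 + t *s e1\<close> has the tangent plane spanned by the line and
  \<open>t ^ q *s e2 - e3\<close>; the point \<open>e1\<close>, where \<open>t\<close> is infinite, has the one spanned by the line and \<open>e2\<close>.\<close>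

definition frame :: "'a ^ 4 \<Rightarrow> 'a ^ 4 \<Rightarrow> 'a ^ 4 \<Rightarrow> 'a ^ 4 \<Rightarrow> bool" where
  "frame e0 e1 e2 e3 \<longleftrightarrow>
    h e0 e0 = 0 \<and> h e1 e1 = 0 \<and> h e0 e1 = 0 \<and> h e1 e0 = 0 \<and>
    h e2 e0 = 1 \<and> h e2 e1 = 0 \<and> h e3 e0 = 0 \<and> h e3 e1 = 1 \<and>
    (\<forall>x. \<exists>a b. x = a *s e0 + b *s e1 + h x e0 *s e2 + h x e1 *s e3)"

text \<open>The functionals \<open>h _ e0\<close> and \<open>h _ e1\<close> are independent, so they have dual vectors \<open>e2\<close> and \<open>e3\<close>.  The
  orthogonal space of the line has dimension 2 and contains the line, hence equals it; this gives the
  coordinates of an arbitrary vector.\<close>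

lemma frame_exists:
  assumes "h e0 e0 = 0" "h e1 e1 = 0" "h e0 e1 = 0"
    and ind: "\<And>a b. a *s e0 + b *s e1 = 0 \<Longrightarrow> a = 0 \<and> b = 0"
  shows "\<exists>e2 e3. frame e0 e1 e2 e3"
proof -
  have "e0 \<noteq> 0" using ind [of 1 0] by auto
  have h10: "h e1 e0 = 0" using assms(3) h_sym_zero by blast
  obtain y' where y': "h y' e0 \<noteq> 0" using nondegenerate [OF \<open>e0 \<noteq> 0\<close>] .
  define y where "y = (1 / h y' e0) *s y'"
  have y: "h y e0 = 1" using y' by (simp add: y_def h_scale_left)
  \<comment> \<open>Otherwise \<open>h _ e1\<close> is a multiple of \<open>h _ e0\<close>, and \<open>e1\<close> a multiple of \<open>e0\<close>.\<close>
  have "\<exists>z. h z e0 = 0 \<and> h z e1 \<noteq> 0"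
  proof (rule ccontr)
    assume *: "\<not> ?thesis"
    have "h z (e1 + (- (h y e1 ^ q)) *s e0) = 0" for z
    proof -
      have "h (z + (- h z e0) *s y) e0 = 0" using y by (simp add: h_linear)
      with * have "h (z + (- h z e0) *s y) e1 = 0" by blast
      then show ?thesis by (simp add: h_linear frob_minus mult.commute)
    qed
    then have "e1 + (- (h y e1 ^ q)) *s e0 = 0" using nondegenerate by blast
    then show False using ind [of "- (h y e1 ^ q)" 1] by (simp add: add.commute)
  qed
  then obtain z where z: "h z e0 = 0" "h z e1 \<noteq> 0" by blast
  define e3 where "e3 = (1 / h z e1) *s z"
  define e2 where "e2 = y + (- h y e1) *s e3"
  have e3: "h e3 e0 = 0" "h e3 e1 = 1" using z by (simp_all add: e3_def h_linear)
  have e2: "h e2 e0 = 1" "h e2 e1 = 0" using y e3 by (simp_all add: e2_def h_linear)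
  have dim: "vec.dim (perp e0 \<inter> perp e1) = 2"
    using dim_perp_Int [OF \<open>e0 \<noteq> 0\<close>, of z e1] z by (simp add: perp_def)
  have S: "perp e0 \<inter> perp e1 = {a *s e0 + b *s e1 | a b. True}"
    using assms h10 by (intro plane_eq_span dim ind vec.subspace_inter subspace_perp) (auto simp: perp_def)
  have "\<exists>a b. x = a *s e0 + b *s e1 + h x e0 *s e2 + h x e1 *s e3" for x
  proof -
    have "x + (- h x e0) *s e2 + (- h x e1) *s e3 \<in> perp e0 \<inter> perp e1"
      using e2 e3 by (simp add: perp_def h_linear)
    then obtain a b where "x + (- h x e0) *s e2 + (- h x e1) *s e3 = a *s e0 + b *s e1"
      unfolding S by blast
    then have "x = a *s e0 + b *s e1 + h x e0 *s e2 + h x e1 *s e3"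
      by (simp add: vec_eq_iff algebra_simps)
    then show ?thesis by blast
  qed
  then show ?thesis
    using assms(1-3) h10 e2 e3 unfolding frame_def by blast
qed

lemma frame_h:
  assumes "frame e0 e1 e2 e3"
  shows "h e0 e0 = 0" "h e1 e1 = 0" "h e0 e1 = 0" "h e1 e0 = 0"
    "h e2 e0 = 1" "h e2 e1 = 0" "h e3 e0 = 0" "h e3 e1 = 1"
    "h e0 e2 = 1" "h e1 e2 = 0" "h e0 e3 = 0" "h e1 e3 = 1"
  using assms unfolding frame_def by (auto simp: h_sym [of e0 e2] h_sym [of e0 e3] h_sym [of e1 e2] h_sym [of e1 e3])

lemma frame_coordinates:
  assumes "frame e0 e1 e2 e3"
  obtains a b c d where "x = a *s e0 + b *s e1 + c *s e2 + d *s e3"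
  using assms unfolding frame_def by metis

lemma frame_unique:
  assumes F: "frame e0 e1 e2 e3"
    and eq: "a *s e0 + b *s e1 + c *s e2 + d *s e3 = a' *s e0 + b' *s e1 + c' *s e2 + d' *s e3"
  shows "a = a'" "b = b'" "c = c'" "d = d'"
proof -
  note H = frame_h [OF F]
  have "h (a *s e0 + b *s e1 + c *s e2 + d *s e3) e0 = h (a' *s e0 + b' *s e1 + c' *s e2 + d' *s e3) e0"
    using eq by simp
  then show c: "c = c'" by (simp add: h_linear H)
  have "h (a *s e0 + b *s e1 + c *s e2 + d *s e3) e1 = h (a' *s e0 + b' *s e1 + c' *s e2 + d' *s e3) e1"
    using eq by simp
  then show d: "d = d'" by (simp add: h_linear H)
  from eq c d have eq': "a *s e0 + b *s e1 = a' *s e0 + b' *s e1" by simp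
  then have "h (a *s e0 + b *s e1) e2 = h (a' *s e0 + b' *s e1) e2" by simp
  then show "a = a'" by (simp add: h_linear H)
  from eq' have "h (a *s e0 + b *s e1) e3 = h (a' *s e0 + b' *s e1) e3" by simp
  then show "b = b'" by (simp add: h_linear H)
qed

text \<open>A generator through \<open>e0\<close> arises from an isotropic vector of \<open>perp e0\<close> other than \<open>e0\<close>; intersecting
  with \<open>perp r\<close> for some \<open>r\<close> not orthogonal to \<open>e0\<close> keeps it away from \<open>e0\<close>.\<close>

lemma frame_at_point:
  assumes e0: "e0 \<noteq> 0" "h e0 e0 = 0"
  shows "\<exists>e1 e2 e3. frame e0 e1 e2 e3"
proof -
  obtain r where "h r e0 \<noteq> 0" using nondegenerate [OF e0(1)] .
  then have r: "h e0 r \<noteq> 0" using h_sym_zero by blast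
  have "vec.dim (perp e0 \<inter> perp r) = 2"
    using e0 r by (intro dim_perp_Int [of e0 e0]) (auto simp: perp_def)
  then obtain e1 where e1: "e1 \<in> perp e0 \<inter> perp r" "e1 \<noteq> 0" "h e1 e1 = 0"
    using isotropic_in_subspace [OF vec.subspace_inter [OF subspace_perp subspace_perp], of e0 r] by auto
  have "a = 0 \<and> b = 0" if "a *s e0 + b *s e1 = 0" for a b
  proof -
    have "h (a *s e0 + b *s e1) r = a * h e0 r" using e1(1) by (simp add: h_linear perp_def)
    then have "a = 0" using that r by simp
    then show ?thesis using that e1(2) by simp
  qed
  moreover have "h e0 e1 = 0" using e1(1) h_sym_zero by (simp add: perp_def)
  ultimately show ?thesis using frame_exists [OF e0(2) e1(3)] by blast
qed

lemma isotropic_exists: "\<exists>p. p \<noteq> 0 \<and> h p p = 0"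
proof -
  have "vec.dim (UNIV :: ('a ^ 4) set) = 4"
    using vec_dim_card [where 'a = 'a and 'n = 4] by simp
  then have "2 \<le> vec.dim (UNIV :: ('a ^ 4) set)" by simp
  from isotropic_in_subspace [OF vec.subspace_UNIV this] show ?thesis by blast
qed

lemma perp_frame_infinity:
  assumes "frame e0 e1 e2 e3" "h x e1 = 0"
  shows "\<exists>a b c. x = a *s e1 + (b *s e0 + c *s e2)"
proof -
  obtain a b where "x = a *s e0 + b *s e1 + h x e0 *s e2 + h x e1 *s e3"
    using assms(1) unfolding frame_def by blast
  then have "x = b *s e1 + (a *s e0 + h x e0 *s e2)" using assms(2) by (simp add: add_ac)
  then show ?thesis by blast
qed

lemma perp_frame_finite:
  assumes "frame e0 e1 e2 e3" "h x (e0 + t *s e1) = 0"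
  shows "\<exists>a b c. x = a *s (e0 + t *s e1) + (b *s e1 + c *s (t ^ q *s e2 - e3))"
proof -
  obtain a b where x: "x = a *s e0 + b *s e1 + h x e0 *s e2 + h x e1 *s e3"
    using assms(1) unfolding frame_def by blast
  have "h x e0 = - (t ^ q * h x e1)"
    using assms(2) by (simp add: h_linear eq_neg_iff_add_eq_0)
  with x have "x = a *s (e0 + t *s e1) + ((b - a * t) *s e1 + (- h x e1) *s (t ^ q *s e2 - e3))"
    by (simp add: vec_eq_iff algebra_simps)
  then show ?thesis by blast
qed

section \<open>Counting along the planes through a line of the surface\<close>

lemma h_translate:
  assumes "h p p = 0" "h x p = 0"
  shows "h (x + a *s p) (x + a *s p) = h x x"
  using assms h_sym_zero [OF assms(2)] by (simp add: h_linear)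

text \<open>If \<open>p\<close> and \<open>u\<close> span a generator and \<open>w\<close> completes them to the tangent plane at \<open>p\<close>, then this number
  counts \<open>p\<close> and the points off that generator, as far as they are zeros of \<open>f\<close> on \<open>V\<^sub>2\<close> in the
  tangent plane at \<open>p\<close>.  The other generators through \<open>p\<close> are the lines joining \<open>p\<close> to the isotropic
  points \<open>w + t *s u\<close>.\<close>

definition zeros_through :: "('a ^ 4 \<Rightarrow> 'a) \<Rightarrow> 'a ^ 4 \<Rightarrow> 'a ^ 4 \<Rightarrow> 'a ^ 4 \<Rightarrow> nat" where
  "zeros_through f p u w = (if f p = 0 then 1 else 0) +
     (\<Sum>t\<in>{t. h (w + t *s u) (w + t *s u) = 0}. card {a. f (w + t *s u + a *s p) = 0})"

text \<open>The tangent planes at the points of the line \<open>e0, e1\<close> are all the planes through that line, so they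
  partition the points off the line.  Concretely, every point has a unique coordinate vector of one of
  the shapes \<open>I1\<close> and \<open>I2\<close> (on the line), \<open>I3\<close> (off the line in the tangent plane at \<open>e1\<close>) and \<open>I4\<close> (off
  the line in the tangent plane at \<open>e0 + t *s e1\<close>).\<close>

lemma card_iso_points_frame:
  assumes F: "frame e0 e1 e2 e3" and f: "is_form d f"
  shows "card (iso_points {x. f x = 0}) =
    (\<Sum>t\<in>UNIV. zeros_through f (e0 + t *s e1) e1 (t ^ q *s e2 - e3)) + zeros_through f e1 e0 e2"
proof -
  note H = frame_h [OF F]
  define V where "V = (\<lambda>(a, b, c, d). a *s e0 + b *s e1 + c *s e2 + d *s e3)"
  have V_inj: "i = j" if "V i = V j" for i j
    using that frame_unique [OF F] unfolding V_def by (cases i; cases j) simp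
  have V_scale: "k *s V (a, b, c, d) = V (k * a, k * b, k * c, k * d)" for k a b c d
    by (simp add: V_def vec_eq_iff algebra_simps)
  have V_zero: "V (0, 0, 0, 0) = 0" by (simp add: V_def)
  define R where "R i \<longleftrightarrow> h (V i) (V i) = 0 \<and> f (V i) = 0" for i
  define I1 :: "('a \<times> 'a \<times> 'a \<times> 'a) set" where "I1 = range (\<lambda>t. (1, t, 0, 0))"
  define I2 :: "('a \<times> 'a \<times> 'a \<times> 'a) set" where "I2 = {(0, 1, 0, 0)}"
  define I3 :: "('a \<times> 'a \<times> 'a \<times> 'a) set" where "I3 = range (\<lambda>(t, a). (t, a, 1, 0))"
  define I4 :: "('a \<times> 'a \<times> 'a \<times> 'a) set" where "I4 = range (\<lambda>(t, s, a). (a, s + a * t, t ^ q, - 1))"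
  let ?I = "I1 \<union> I2 \<union> I3 \<union> I4"
  let ?pt = "\<lambda>i. vec.span {V i}"
  have nonzero: "V i \<noteq> 0" if "i \<in> ?I" for i
  proof
    assume "V i = 0"
    then have "i = (0, 0, 0, 0)" using V_inj V_zero by metis
    then show False using that by (auto simp: I1_def I2_def I3_def I4_def)
  qed
  have inj: "inj_on ?pt {i \<in> ?I. R i}"
  proof (rule inj_onI)
    fix i j assume ij: "i \<in> {i \<in> ?I. R i}" "j \<in> {i \<in> ?I. R i}" "?pt i = ?pt j"
    then have "V j \<noteq> 0" using nonzero by blast
    from span_singleton_eqD [OF ij(3) this] obtain k where k: "k \<noteq> 0" "V j = k *s V i" .
    obtain a b c e where i: "i = (a, b, c, e)" by (cases i) auto
    from k(2) have j: "j = (k * a, k * b, k * c, k * e)"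
      unfolding i V_scale by (rule V_inj)
    have "k = 1"
      using ij(1,2) k(1) unfolding i j by (auto simp: I1_def I2_def I3_def I4_def)
    then show "i = j" by (simp add: i j)
  qed
  have image: "iso_points {x. f x = 0} = ?pt ` {i \<in> ?I. R i}"
  proof (intro subset_antisym subsetI)
    fix P assume "P \<in> iso_points {x. f x = 0}"
    then obtain x where x: "f x = 0" "x \<noteq> 0" "h x x = 0" "P = vec.span {x}"
      by (auto simp: iso_points_def)
    obtain a b c e where "x = a *s e0 + b *s e1 + c *s e2 + e *s e3"
      using frame_coordinates [OF F] .
    then have V: "x = V (a, b, c, e)" by (simp add: V_def)
    have "\<exists>k. k \<noteq> 0 \<and> (k * a, k * b, k * c, k * e) \<in> ?I"
    proof (cases "e = 0")
      case False
      \<comment> \<open>The parameter \<open>t\<close> is found by conjugating the third coordinate.\<close>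
      have "(- 1 / e * a, - 1 / e * b, - 1 / e * c, - 1 / e * e) =
          (\<lambda>(t, s, a). (a, s + a * t, t ^ q, - 1))
            ((- 1 / e * c) ^ q, - 1 / e * b - (- 1 / e * a) * (- 1 / e * c) ^ q, - 1 / e * a)"
        using False by simp
      then have "(- 1 / e * a, - 1 / e * b, - 1 / e * c, - 1 / e * e) \<in> I4"
        unfolding I4_def by (rule range_eqI)
      then show ?thesis using False by (intro exI [of _ "- 1 / e"]) simp
    next
      case e: True
      show ?thesis
      proof (cases "c = 0")
        case False
        have "(1 / c * a, 1 / c * b, 1 / c * c, 1 / c * e) = (\<lambda>(t, a). (t, a, 1, 0)) (1 / c * a, 1 / c * b)"
          using False e by simp
        then have "(1 / c * a, 1 / c * b, 1 / c * c, 1 / c * e) \<in> I3"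
          unfolding I3_def by (rule range_eqI)
        then show ?thesis using False by (intro exI [of _ "1 / c"]) simp
      next
        case c: True
        show ?thesis
        proof (cases "a = 0")
          case False
          then have "(1 / a * a, 1 / a * b, 1 / a * c, 1 / a * e) \<in> I1"
            using c e by (simp add: I1_def)
          then show ?thesis using False by (intro exI [of _ "1 / a"]) simp
        next
          case a: True
          then have "b \<noteq> 0" using x(2) c e unfolding V by (auto simp: V_def)
          then have "(1 / b * a, 1 / b * b, 1 / b * c, 1 / b * e) \<in> I2"
            using a c e by (simp add: I2_def)
          then show ?thesis using \<open>b \<noteq> 0\<close> by (intro exI [of _ "1 / b"]) simp
        qed
      qed
    qed
    then obtain k where k: "k \<noteq> 0" "(k * a, k * b, k * c, k * e) \<in> ?I" by blast
    have kx: "V (k * a, k * b, k * c, k * e) = k *s x" by (simp only: V V_scale)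
    have "R (k * a, k * b, k * c, k * e)"
      unfolding R_def kx using x by (simp add: h_linear is_form_homogeneous [OF f])
    moreover have "P = ?pt (k * a, k * b, k * c, k * e)"
      unfolding kx x(4) by (rule span_singleton_scale [OF k(1), symmetric])
    ultimately show "P \<in> ?pt ` {i \<in> ?I. R i}" using k(2) by blast
  qed (use nonzero in \<open>auto simp: iso_points_def R_def\<close>)
  have "card (iso_points {x. f x = 0}) = card {i \<in> ?I. R i}"
    unfolding image by (rule card_image [OF inj])
  also have "\<dots> = card {i \<in> I1. R i} + card {i \<in> I2. R i} + card {i \<in> I3. R i} + card {i \<in> I4. R i}"
  proof -
    have split: "card {i \<in> I \<union> J. R i} = card {i \<in> I. R i} + card {i \<in> J. R i}"
      if "I \<inter> J = {}" for I J
    proof -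
      have "{i \<in> I \<union> J. R i} = {i \<in> I. R i} \<union> {i \<in> J. R i}" by blast
      then show ?thesis
        using that by (simp only:) (rule card_Un_disjoint, auto intro: finite_subset [of _ UNIV])
    qed
    have "I1 \<inter> I2 = {}" "(I1 \<union> I2) \<inter> I3 = {}" "(I1 \<union> I2 \<union> I3) \<inter> I4 = {}"
      by (auto simp: I1_def I2_def I3_def I4_def)
    then show ?thesis by (simp only: split)
  qed
  also have "card {i \<in> I1. R i} = (\<Sum>t\<in>UNIV. if f (e0 + t *s e1) = 0 then 1 else 0)"
  proof -
    have "{i \<in> I1. R i} = (\<lambda>t. (1, t, 0, 0)) ` {t. f (e0 + t *s e1) = 0}"
      by (auto simp: I1_def R_def V_def h_linear H)
    moreover have "inj_on (\<lambda>t::'a. (1::'a, t, 0::'a, 0::'a)) T" for T by (auto simp: inj_on_def)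
    ultimately show ?thesis by (simp add: card_image sum.If_cases)
  qed
  also have "card {i \<in> I2. R i} = (if f e1 = 0 then 1 else 0)"
  proof -
    have "{i \<in> I2. R i} = (if f e1 = 0 then {(0, 1, 0, 0)} else {})"
      by (auto simp: I2_def R_def V_def H)
    then show ?thesis by simp
  qed
  also have "card {i \<in> I3. R i} =
      (\<Sum>t\<in>{t. h (e2 + t *s e0) (e2 + t *s e0) = 0}. card {a. f (e2 + t *s e0 + a *s e1) = 0})"
  proof -
    have V3: "V (t, a, 1, 0) = e2 + t *s e0 + a *s e1" for t a
      by (simp add: V_def add_ac)
    have "h (e2 + t *s e0 + a *s e1) (e2 + t *s e0 + a *s e1) = h (e2 + t *s e0) (e2 + t *s e0)" for t a
      by (rule h_translate) (simp_all add: h_linear H)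
    then have "{i \<in> I3. R i} = (\<lambda>(t, a). (t, a, 1, 0)) `
        (SIGMA t:{t. h (e2 + t *s e0) (e2 + t *s e0) = 0}. {a. f (e2 + t *s e0 + a *s e1) = 0})"
      by (auto simp: I3_def R_def V3 image_iff)
    moreover have "inj_on (\<lambda>(t::'a, a::'a). (t, a, 1::'a, 0::'a)) T" for T by (auto simp: inj_on_def)
    ultimately show ?thesis by (simp add: card_image)
  qed
  also have "card {i \<in> I4. R i} =
      (\<Sum>t\<in>UNIV. \<Sum>s\<in>{s. h (t ^ q *s e2 - e3 + s *s e1) (t ^ q *s e2 - e3 + s *s e1) = 0}.
        card {a. f (t ^ q *s e2 - e3 + s *s e1 + a *s (e0 + t *s e1)) = 0})"
  proof -
    let ?w = "\<lambda>t s. t ^ q *s e2 - e3 + s *s e1"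
    have V4: "V (a, s + a * t, t ^ q, - 1) = ?w t s + a *s (e0 + t *s e1)" for a s t
      by (simp add: V_def vec_eq_iff algebra_simps)
    have "h (?w t s + a *s (e0 + t *s e1)) (?w t s + a *s (e0 + t *s e1)) = h (?w t s) (?w t s)" for a s t
      by (rule h_translate) (simp_all add: h_linear H)
    then have "{k. R ((\<lambda>(t, s, a). (a, s + a * t, t ^ q, - 1)) k)} =
        (SIGMA t:UNIV. SIGMA s:{s. h (?w t s) (?w t s) = 0}. {a. f (?w t s + a *s (e0 + t *s e1)) = 0})"
      by (auto simp: R_def V4 simp del: vector_add_ldistrib)
    moreover have "{i \<in> I4. R i} = (\<lambda>(t, s, a). (a, s + a * t, t ^ q, - 1)) `
        {k. R ((\<lambda>(t, s, a). (a, s + a * t, t ^ q, - 1)) k)}"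
      unfolding I4_def by blast
    ultimately have "{i \<in> I4. R i} = (\<lambda>(t, s, a). (a, s + a * t, t ^ q, - 1)) `
        (SIGMA t:UNIV. SIGMA s:{s. h (?w t s) (?w t s) = 0}. {a. f (?w t s + a *s (e0 + t *s e1)) = 0})"
      by (simp only:)
    moreover have "inj_on (\<lambda>(t::'a, s, a). (a, s + a * t, t ^ q, - 1 :: 'a)) T" for T
      by (auto simp: inj_on_def frob_eq_iff)
    ultimately show ?thesis by (simp add: card_image)
  qed
  finally show ?thesis
    by (simp add: zeros_through_def sum.distrib add_ac)
qed

end

section \<open>Surfaces that contain no tangent plane\<close>

text \<open>The surface \<open>f = 0\<close> is fixed together with one expansion \<open>C\<close> of its equation, so that the derivatives
  \<open>C 1\<close> can be referred to throughout.  The degree is at most 3 because of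
  \<open>singular_lines_span\<close>, and \<open>q \<ge> 4\<close> keeps it below \<open>q\<close>.\<close>

locale hermitian_section = hermitian q A for q and A :: "'a::{field,finite} ^ 4 ^ 4" +
  fixes d :: nat and f :: "'a ^ 4 \<Rightarrow> 'a" and C
  assumes expansion: "bihomogeneous_expansion d f C"
    and q_ge_4: "4 \<le> q" and d_pos: "1 \<le> d" and d_le_3: "d \<le> 3"
    and no_tangent_plane: "\<And>p. p \<noteq> 0 \<Longrightarrow> h p p = 0 \<Longrightarrow> \<exists>x\<in>perp p. f x \<noteq> 0"
begin

lemma d_less_q: "d < q"
  using d_le_3 q_ge_4 by simp

lemma q_less_card: "q < CARD('a)"
  using q_ge_4 by (simp add: card_field power2_eq_square)

lemma d_less_card: "d < CARD('a)"
  using d_less_q q_less_card by simp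

lemmas expansion_facts = expansion d_less_card

definition line_in :: "'a ^ 4 \<Rightarrow> 'a ^ 4 \<Rightarrow> bool" where
  "line_in x y \<longleftrightarrow> (\<forall>a b. f (a *s x + b *s y) = 0)"

text \<open>The number of generators in the surface \<open>f = 0\<close> through \<open>p\<close>, apart from the line \<open>p, u\<close>.\<close>

definition lines_through :: "'a ^ 4 \<Rightarrow> 'a ^ 4 \<Rightarrow> 'a ^ 4 \<Rightarrow> nat" where
  "lines_through p u w = card {t. h (w + t *s u) (w + t *s u) = 0 \<and> line_in p (w + t *s u)}"

lemma line_inD: "line_in x y \<Longrightarrow> f (a *s x + b *s y) = 0" "line_in x y \<Longrightarrow> f x = 0" "line_in x y \<Longrightarrow> f y = 0"
proof -
  assume l: "line_in x y"
  then show *: "f (a *s x + b *s y) = 0" for a b by (simp add: line_in_def)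
  show "f x = 0" "f y = 0" using *[of 1 0] *[of 0 1] by simp_all
qed

lemma line_in_lincomb:
  assumes "line_in x y"
  shows "line_in (a *s x + b *s y) (a' *s x + b' *s y)"
proof -
  have "k *s (a *s x + b *s y) + l *s (a' *s x + b' *s y) = (k * a + l * a') *s x + (k * b + l * b') *s y"
    for k l by (simp add: vec_eq_iff algebra_simps)
  then show ?thesis
    unfolding line_in_def by (simp only: line_inD(1) [OF assms]) simp
qed

text \<open>This is \<open>planar_zero_count\<close> in the tangent plane at \<open>p\<close>, which meets \<open>V\<^sub>2\<close> in the line \<open>p, u\<close> and
  \<open>q\<close> further lines.\<close>

lemma lines_through_bound:
  assumes p: "p \<noteq> 0" "h p p = 0" and u: "h u u = 0" "h u w \<noteq> 0" "line_in p u"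
    and plane: "\<And>x. h x p = 0 \<Longrightarrow> \<exists>a b c. x = a *s p + (b *s u + c *s w)"
  shows "lines_through p u w < d"
    "zeros_through f p u w \<le> 1 + (d - 1) * q + lines_through p u w * (q ^ 2 - q)"
proof -
  obtain x where x: "h x p = 0" "f x \<noteq> 0" using no_tangent_plane [OF p] by (auto simp: perp_def)
  then obtain a b c where abc: "f (a *s p + (b *s u + c *s w)) \<noteq> 0" using plane by metis
  have S: "card {t. h (w + t *s u) (w + t *s u) = 0} = q"
    using card_isotropic_translates u(1,2) by blast
  have K: "{t. h (w + t *s u) (w + t *s u) = 0 \<and> line_in p (w + t *s u)} =
      {t \<in> {t. h (w + t *s u) (w + t *s u) = 0}. \<forall>a b. f (a *s p + b *s (w + t *s u)) = 0}"
    by (auto simp: line_in_def)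
  note * = planar_zero_count [OF expansion_facts line_inD(1) [OF u(3)] K abc S card_field]
  show "lines_through p u w < d" using *(1) by (simp add: lines_through_def)
  show "zeros_through f p u w \<le> 1 + (d - 1) * q + lines_through p u w * (q ^ 2 - q)"
    using *(2) by (simp add: lines_through_def zeros_through_def)
qed

lemma
  assumes F: "frame e0 e1 e2 e3" and l: "line_in e0 e1"
  shows lines_through_finite_less: "lines_through (e0 + t *s e1) e1 (t ^ q *s e2 - e3) < d"
    and zeros_through_finite: "zeros_through f (e0 + t *s e1) e1 (t ^ q *s e2 - e3) \<le>
      1 + (d - 1) * q + lines_through (e0 + t *s e1) e1 (t ^ q *s e2 - e3) * (q ^ 2 - q)"
    and zeros_through_infinity: "zeros_through f e1 e0 e2 \<le>
      1 + (d - 1) * q + lines_through e1 e0 e2 * (q ^ 2 - q)"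
proof -
  note H = frame_h [OF F]
  have p: "e0 + t *s e1 \<noteq> 0" "h (e0 + t *s e1) (e0 + t *s e1) = 0"
  proof -
    have "h e2 (e0 + t *s e1) = 1" by (simp add: h_linear H)
    then show "e0 + t *s e1 \<noteq> 0" using h_zero(2) [of e2] zero_neq_one by metis
  qed (simp add: h_linear H)
  have l': "line_in (e0 + t *s e1) e1"
    using line_in_lincomb [OF l, of 1 t 0 1] by simp
  have hw: "h e1 (t ^ q *s e2 - e3) \<noteq> 0" by (simp add: h_linear H)
  show "lines_through (e0 + t *s e1) e1 (t ^ q *s e2 - e3) < d"
    by (rule lines_through_bound(1) [OF p H(2) hw l' perp_frame_finite [OF F]])
  show "zeros_through f (e0 + t *s e1) e1 (t ^ q *s e2 - e3) \<le>
      1 + (d - 1) * q + lines_through (e0 + t *s e1) e1 (t ^ q *s e2 - e3) * (q ^ 2 - q)"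
    by (rule lines_through_bound(2) [OF p H(2) hw l' perp_frame_finite [OF F]])
  have "e1 \<noteq> 0" using H by auto
  moreover have "line_in e1 e0" using line_in_lincomb [OF l, of 0 1 1 0] by simp
  moreover have "h e0 e2 \<noteq> 0" by (simp add: H)
  ultimately show "zeros_through f e1 e0 e2 \<le> 1 + (d - 1) * q + lines_through e1 e0 e2 * (q ^ 2 - q)"
    using lines_through_bound(2) [of e1 e0 e2] H perp_frame_infinity [OF F] by blast
qed

lemma derivative_linear: "C 1 x (a *s y + b *s z) = a * C 1 x y + b * C 1 x z"
  by (rule is_form_1_linear) (rule coefficient_form(1) [OF expansion_facts])

text \<open>Let \<open>p = x + t0 *s u\<close> and \<open>k = card K\<close>.  By \<open>planar_lines_through_point\<close>, the expansion of
  \<open>f (p + s *s u + b *s w)\<close> in \<open>s\<close> and \<open>b\<close> starts in degree \<open>k + 1\<close>.  The derivative in direction \<open>w\<close> is the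
  coefficient of \<open>b\<close>, so it starts in degree \<open>k\<close> in \<open>s = t - t0\<close>.\<close>

lemma derivative_vanishing_order:
  assumes F: "degree P \<le> d - 1" "\<And>t. poly P t = C 1 (x + t *s u) w"
    and line: "line_in (x + t0 *s u) u"
    and lines: "\<And>t. t \<in> K \<Longrightarrow> line_in (x + t0 *s u) (w + t *s u)"
  shows "[:- t0, 1:] ^ card K dvd P"
proof -
  let ?p = "x + t0 *s u"
  define k where "k = card K"
  have Cz: "C j ?p (a *s u + b *s w) = 0" if "j \<le> k" for j a b
    by (rule planar_lines_through_point [OF expansion_facts, where K = K])
      (use line lines that in \<open>auto simp: line_in_def k_def\<close>)
  have "\<forall>j. \<exists>D. bihomogeneous_expansion j (C j ?p) D"
    using coefficient_form(1) [OF expansion_facts] form_bihomogeneous_expansion by blast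
  from choice [OF this] obtain D where D: "\<And>j. bihomogeneous_expansion j (C j ?p) (D j)"
    by blast
  have D_zero: "D j i = (\<lambda>_ _. 0)" if "j < i" for i j
    using D [of j] that by (simp add: bihomogeneous_expansion_def)
  have D1_zero: "D j 1 u w = 0" if "j \<le> k" "j \<le> d" for j
  proof -
    have "j < CARD('a)" using that(2) d_less_card by simp
    then show ?thesis
      using coefficient_zero_on_line [OF D, of j u w 1] Cz [OF that(1), of 1] by simp
  qed
  \<comment> \<open>Compare the coefficients of \<open>b\<close> in the expansions at \<open>p + s *s u\<close> and at \<open>p\<close>.\<close>
  have deriv: "C 1 (?p + s *s u) w = (\<Sum>j\<le>d. s ^ (j - 1) * D j 1 u w)" for s
  proof -
    have "(\<Sum>i\<le>d. (C i (?p + s *s u) w - (\<Sum>j\<le>d. s ^ (j - i) * D j i u w)) * b ^ i) = 0" for b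
    proof -
      have "(\<Sum>i\<le>d. C i (?p + s *s u) w * b ^ i) = f (?p + s *s u + b *s w)"
        by (simp add: expansion_translate [OF expansion_facts])
      also have "\<dots> = f (1 *s ?p + 1 *s (s *s u + b *s w))" by (simp add: add.assoc)
      also have "\<dots> = (\<Sum>j\<le>d. C j ?p (s *s u + b *s w))" by (simp only: expansion_eval [OF expansion_facts]) simp
      also have "\<dots> = (\<Sum>j\<le>d. \<Sum>i\<le>d. s ^ (j - i) * b ^ i * D j i u w)"
      proof (intro sum.cong refl)
        fix j assume "j \<in> {..d}"
        then have j: "j \<le> d" "j < CARD('a)" using d_less_card by auto
        show "C j ?p (s *s u + b *s w) = (\<Sum>i\<le>d. s ^ (j - i) * b ^ i * D j i u w)"
          unfolding expansion_eval [OF D j(2)]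
          using j(1) by (intro sum.mono_neutral_left) (auto simp: D_zero)
      qed
      also have "\<dots> = (\<Sum>i\<le>d. (\<Sum>j\<le>d. s ^ (j - i) * D j i u w) * b ^ i)"
        unfolding sum_distrib_right by (subst sum.swap) (simp add: mult_ac)
      finally show ?thesis by (simp add: left_diff_distrib sum_subtractf)
    qed
    from sum_powers_zero [of UNIV "\<lambda>i. C i (?p + s *s u) w - (\<Sum>j\<le>d. s ^ (j - i) * D j i u w)" d 1, OF this]
    show ?thesis using d_less_card d_pos by simp
  qed
  define R where "R = (\<Sum>j\<in>{Suc k..d}. smult (D j 1 u w) ([:- t0, 1:] ^ (j - 1)))"
  have "P = R"
  proof (rule poly_eqI_degree [where A = UNIV])
    fix t
    have "poly P t = C 1 (?p + (t - t0) *s u) w"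
      using F(2) by (simp add: algebra_simps vec_eq_iff)
    also have "\<dots> = (\<Sum>j\<in>{Suc k..d}. (t - t0) ^ (j - 1) * D j 1 u w)"
      unfolding deriv using D1_zero by (intro sum.mono_neutral_right) (auto simp: not_less_eq_eq)
    also have "\<dots> = poly R t"
      by (simp add: R_def poly_sum poly_power mult.commute)
    finally show "poly P t = poly R t" .
  next
    show "degree P < CARD('a)" using F(1) d_less_card by simp
    have "degree R \<le> d - 1"
      unfolding R_def
      by (intro degree_sum_le) (auto intro!: order_trans [OF degree_smult_le] order_trans [OF degree_power_le])
    then show "degree R < CARD('a)" using d_less_card by simp
  qed
  moreover have "[:- t0, 1:] ^ k dvd R"
    unfolding R_def by (intro dvd_sum dvd_smult le_imp_power_dvd) auto
  ultimately show ?thesis by (simp add: k_def)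
qed

text \<open>The polynomial \<open>P = t\<^sup>q G - J\<close> is the derivative of \<open>f\<close> at the point \<open>e0 + t *s e1\<close> in the direction
  \<open>t ^ q *s e2 - e3\<close>, in which its tangent plane leaves the line.  To find its order at \<open>t0\<close>, write
  \<open>t\<^sup>q = (t - t0)\<^sup>q + t0\<^sup>q\<close>.  The first summand contributes a zero of order at least \<open>q\<close>; the second one
  leaves the derivative in the fixed direction \<open>t0 ^ q *s e2 - e3\<close>, which
  \<open>derivative_vanishing_order\<close> treats.\<close>

lemma sum_lines_through:
  assumes F: "frame e0 e1 e2 e3" and l: "line_in e0 e1" and nonsing: "C 1 e0 z \<noteq> 0"
  shows "(\<Sum>t\<in>UNIV. lines_through (e0 + t *s e1) e1 (t ^ q *s e2 - e3)) \<le> q + d - 1"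
proof -
  note H = frame_h [OF F]
  have C1: "is_form (d - 1) (\<lambda>x. C 1 x y)" for y by (rule coefficient_form(2) [OF expansion_facts])
  have less: "d - 1 < CARD('a)" using d_less_card by simp
  obtain G where G: "degree G \<le> d - 1" "\<And>t. poly G t = C 1 (e0 + t *s e1) e2"
    using form_polynomial_on_line [OF C1 less] by blast
  obtain J where J: "degree J \<le> d - 1" "\<And>t. poly J t = C 1 (e0 + t *s e1) e3"
    using form_polynomial_on_line [OF C1 less] by blast
  define P where "P = monom 1 q * G - J"
  \<comment> \<open>As \<open>G\<close> and \<open>J\<close> have degree less than \<open>q\<close>, the terms of \<open>t\<^sup>q G\<close> and \<open>J\<close> cannot cancel.  So \<open>P = 0\<close> forces
  the derivatives at \<open>e0\<close> in the directions \<open>e2\<close> and \<open>e3\<close> to vanish, hence those in all directions.\<close>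
  have "P \<noteq> 0"
  proof
    assume "P = 0"
    then have "coeff (monom 1 q * G) i = coeff J i" for i by (simp add: P_def)
    note * = this[unfolded coeff_monom_mult]
    have "coeff G i = 0" for i
      using *[of "q + i"] J(1) d_less_q by (simp add: coeff_eq_0)
    then have "G = 0" by (simp add: poly_eq_iff)
    with \<open>P = 0\<close> have "J = 0" by (simp add: P_def)
    have e23: "C 1 e0 e2 = 0" "C 1 e0 e3 = 0"
      using G(2) [of 0] J(2) [of 0] \<open>G = 0\<close> \<open>J = 0\<close> by simp_all
    have "C 1 e0 e0 = 0"
      using line_inD(1) [OF l, of "1 + b" 0 for b]
      by (intro coefficient_zero_on_line [OF expansion_facts]) (simp add: vector_sadd_rdistrib)
    moreover have "C 1 e0 e1 = 0"
      using line_inD(1) [OF l, of 1] by (intro coefficient_zero_on_line [OF expansion_facts]) simp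
    moreover obtain a b c e where "z = a *s e0 + b *s e1 + c *s e2 + e *s e3"
      using frame_coordinates [OF F] .
    then have "z = a *s e0 + 1 *s (b *s e1 + 1 *s (c *s e2 + e *s e3))" by (simp add: add.assoc)
    ultimately have "C 1 e0 z = 0" by (simp only: derivative_linear e23) simp
    then show False using nonsing by simp
  qed
  have "degree P \<le> q + d - 1"
    unfolding P_def
    using G(1) J(1) d_pos order_trans [OF degree_mult_le [of "monom 1 q" G]]
    by (intro degree_diff_le) (auto simp: degree_monom_eq)
  have order: "lines_through (e0 + t *s e1) e1 (t ^ q *s e2 - e3) \<le> order t P" for t
  proof -
    let ?p = "e0 + t *s e1" and ?w = "t ^ q *s e2 - e3"
    let ?k = "lines_through ?p e1 ?w"
    define R where "R = smult (t ^ q) G - J"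
    have "poly R s = C 1 (e0 + s *s e1) ?w" for s
    proof -
      have "?w = (t ^ q) *s e2 + (- 1) *s e3" by simp
      then have "C 1 (e0 + s *s e1) ?w = t ^ q * C 1 (e0 + s *s e1) e2 + (- 1) * C 1 (e0 + s *s e1) e3"
        by (simp only: derivative_linear)
      then show ?thesis by (simp add: R_def G(2) J(2))
    qed
    moreover have "degree R \<le> d - 1"
      unfolding R_def using G(1) J(1) by (intro degree_diff_le order_trans [OF degree_smult_le])
    moreover have "line_in ?p e1" using line_in_lincomb [OF l, of 1 t 0 1] by simp
    ultimately have R: "[:- t, 1:] ^ ?k dvd R"
      unfolding lines_through_def by (intro derivative_vanishing_order) auto
    have "monom 1 q = [:- t, 1:] ^ q + [:t ^ q:]"
    proof (rule poly_eqI_degree [where A = UNIV])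
      show "poly (monom 1 q) x = poly ([:- t, 1:] ^ q + [:t ^ q:]) x" for x
        by (simp add: poly_monom poly_power frob_diff)
      have "degree ([:- t, 1:] ^ q + [:t ^ q:]) \<le> q"
        by (intro degree_add_le order_trans [OF degree_power_le]) auto
      then show "degree ([:- t, 1:] ^ q + [:t ^ q:]) < CARD('a)" using q_less_card by simp
    qed (use q_less_card in \<open>simp add: degree_monom_eq\<close>)
    then have "P = [:- t, 1:] ^ q * G + R"
      by (simp add: P_def R_def algebra_simps)
    moreover have "[:- t, 1:] ^ ?k dvd [:- t, 1:] ^ q"
      using lines_through_finite_less [OF F l, of t] d_less_q by (intro le_imp_power_dvd) simp
    ultimately have "[:- t, 1:] ^ ?k dvd P"
      using R by (simp add: dvd_mult2)
    then show ?thesis using \<open>P \<noteq> 0\<close> by (simp add: order_divides)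
  qed
  have "(\<Sum>t\<in>UNIV. lines_through (e0 + t *s e1) e1 (t ^ q *s e2 - e3)) \<le> (\<Sum>t\<in>UNIV. order t P)"
    by (intro sum_mono order)
  also have "\<dots> = (\<Sum>t | poly P t = 0. order t P)"
    by (intro sum.mono_neutral_right) (auto simp: order_root)
  also have "\<dots> \<le> degree P" by (rule sum_order_le_degree [OF \<open>P \<noteq> 0\<close>])
  also note \<open>degree P \<le> q + d - 1\<close>
  finally show ?thesis .
qed

text \<open>The sum in \<open>sum_lines_through\<close> leaves out the point \<open>e1\<close>.  It is therefore chosen such that no other
  generator in the surface passes through it.  This is possible: otherwise each of the \<open>q\<^sup>2 - 1\<close>
  points \<open>e0 + t *s e1\<close> with \<open>t \<noteq> 0\<close> would contribute to the sum, which is at most \<open>q + d - 1\<close>.\<close>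

lemma frame_with_free_point:
  assumes F: "frame e0 e1 e2 e3" and l: "line_in e0 e1" and nonsing: "C 1 e0 z \<noteq> 0"
  obtains e1' e2' e3' where "frame e0 e1' e2' e3'" "line_in e0 e1'" "lines_through e1' e0 e2' = 0"
proof (rule ccontr)
  assume "\<not> thesis"
  with that have no: "\<And>e1' e2' e3'. frame e0 e1' e2' e3' \<Longrightarrow> line_in e0 e1' \<Longrightarrow> lines_through e1' e0 e2' \<noteq> 0"
    by blast
  note H = frame_h [OF F]
  have pos: "1 \<le> lines_through (e0 + t *s e1) e1 (t ^ q *s e2 - e3)" if "t \<noteq> 0" for t
  proof -
    let ?p = "e0 + t *s e1" and ?w = "t ^ q *s e2 - e3"
    have ind: "a = 0 \<and> b = 0" if "a *s e0 + b *s ?p = 0" for a b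
    proof -
      have "(a + b) *s e0 + (b * t) *s e1 + 0 *s e2 + 0 *s e3 = 0 *s e0 + 0 *s e1 + 0 *s e2 + 0 *s e3"
        using that by (simp add: vec_eq_iff algebra_simps)
      from frame_unique(1,2) [OF F this] \<open>t \<noteq> 0\<close> show ?thesis by simp
    qed
    have hp: "h ?p ?p = 0" "h e0 ?p = 0" by (simp_all add: h_linear H)
    obtain e2' e3' where F': "frame e0 ?p e2' e3'"
      using frame_exists [OF H(1) hp ind] by blast
    note H' = frame_h [OF F']
    have "line_in e0 ?p" using line_in_lincomb [OF l, of 1 0 1 t] by simp
    then have "lines_through ?p e0 e2' \<noteq> 0" using no F' by blast
    then obtain s where s: "h (e2' + s *s e0) (e2' + s *s e0) = 0" "line_in ?p (e2' + s *s e0)"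
      unfolding lines_through_def by (metis (mono_tags, lifting) card.empty empty_Collect_eq)
    let ?y = "e2' + s *s e0"
    have "h ?y ?p = 0" using H'(6) hp by (simp only: h_linear) (simp add: h_linear H)
    then obtain a b c where y: "?y = a *s ?p + (b *s e1 + c *s ?w)"
      using perp_frame_finite [OF F] by blast
    have "h ?y e0 = 1" by (simp add: h_linear H')
    moreover have "h (a *s ?p + (b *s e1 + c *s ?w)) e0 = c * t ^ q" by (simp add: h_linear H)
    ultimately have "c \<noteq> 0" unfolding y by auto
    have w: "?w + (b / c) *s e1 = (1 / c) *s ?y + (- a / c) *s ?p"
      unfolding y using \<open>c \<noteq> 0\<close> by (simp add: vec_eq_iff field_simps)
    have "h (?w + (b / c) *s e1) (?w + (b / c) *s e1) = h ((1 / c) *s ?y) ((1 / c) *s ?y)"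
      unfolding w using hp(1) \<open>h ?y ?p = 0\<close> by (intro h_translate) (simp_all only: h_scale_left mult_zero_right)
    also have "\<dots> = 0" by (simp only: h_scale_left h_scale_right s(1) mult_zero_right)
    finally have "h (?w + (b / c) *s e1) (?w + (b / c) *s e1) = 0" .
    moreover have "line_in ?p (?w + (b / c) *s e1)"
      unfolding w using line_in_lincomb [OF s(2), of 1 0 "- a / c" "1 / c"] by (simp add: add.commute)
    ultimately have "b / c \<in> {s. h (?w + s *s e1) (?w + s *s e1) = 0 \<and> line_in ?p (?w + s *s e1)}"
      by blast
    then have "lines_through ?p e1 ?w \<noteq> 0"
      unfolding lines_through_def by (metis (no_types, lifting) card_0_eq empty_iff finite)
    then show ?thesis by simp
  qed
  have "q ^ 2 - 1 = (\<Sum>t\<in>UNIV - {0 :: 'a}. 1)"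
    by (simp add: card_field)
  also have "\<dots> \<le> (\<Sum>t\<in>UNIV - {0}. lines_through (e0 + t *s e1) e1 (t ^ q *s e2 - e3))"
    using pos by (intro sum_mono) auto
  also have "\<dots> \<le> (\<Sum>t\<in>UNIV. lines_through (e0 + t *s e1) e1 (t ^ q *s e2 - e3))"
    by (intro sum_mono2) auto
  also have "\<dots> \<le> q + d - 1" by (rule sum_lines_through [OF F l nonsing])
  finally have "q ^ 2 - 1 \<le> q + 2" using d_le_3 by simp
  moreover obtain r where "q = r + 4" using q_ge_4 by (metis le_add_diff_inverse2)
  ultimately show False by (simp add: power2_eq_square algebra_simps)
qed

lemma is_form_f: "is_form d f"
proof -
  have "C d 0 = f" using coefficient_top [OF expansion_facts] by (simp add: fun_eq_iff)
  then show ?thesis using coefficient_form(1) [OF expansion_facts, of d 0] by simp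
qed

text \<open>Only nonzero vectors represent points; so a line that is not singular provides a point at which some
  derivative of \<open>f\<close> does not vanish, and this point can start a new frame.\<close>

definition singular_line :: "'a ^ 4 \<Rightarrow> 'a ^ 4 \<Rightarrow> bool" where
  "singular_line x y \<longleftrightarrow> (\<forall>a b z. a *s x + b *s y \<noteq> 0 \<longrightarrow> C 1 (a *s x + b *s y) z = 0)"

text \<open>On the join of a point of one line to a point of the other, the coefficients \<open>C 0\<close>, \<open>C 1\<close> vanish by
  the singularity at the first point and \<open>C (d - 1)\<close>, \<open>C d\<close> by that at the second.  As \<open>d \<le> 3\<close>, these are
  all.\<close>

lemma singular_lines_span:
  assumes "line_in p u" "line_in p y" "singular_line p u" "singular_line p y"
  shows "f ((a *s p + b *s u) + c *s y) = 0"
proof -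
  let ?x = "a *s p + b *s u" and ?v = "c *s y"
  have fx: "f ?x = 0" using line_inD(1) [OF assms(1)] .
  have fv: "f ?v = 0" using line_inD(1) [OF assms(2), of 0 c] by simp
  show ?thesis
  proof (cases "?x = 0 \<or> ?v = 0")
    case True
    then show ?thesis using fx fv by auto
  next
    case False
    have "C j ?x ?v = 0" if "j \<le> d" for j
    proof -
      have "C 0 ?x ?v = 0" using coefficient_swap [OF expansion_facts, of 0 ?v ?x] coefficient_top [OF expansion_facts, of ?v ?x] fx by simp
      moreover have "C d ?x ?v = 0" using coefficient_top [OF expansion_facts] fv by simp
      moreover have "C 1 ?x ?v = 0" using assms(3) False by (auto simp: singular_line_def)
      moreover have "C (d - 1) ?x ?v = 0"
      proof -
        have "C (d - 1) ?x ?v = C 1 ?v ?x" by (rule coefficient_swap [OF expansion_facts d_pos])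
        also have "\<dots> = 0"
          using assms(4) [unfolded singular_line_def, rule_format, of 0 c ?x] False by simp
        finally show ?thesis .
      qed
      moreover have "j = 0 \<or> j = 1 \<or> j = d - 1 \<or> j = d" using that d_le_3 by linarith
      ultimately show ?thesis by blast
    qed
    then have "f (1 *s ?x + 1 *s ?v) = 0" unfolding expansion_eval [OF expansion_facts] by simp
    then show ?thesis by simp
  qed
qed

lemma flag_frame:
  assumes "p \<noteq> 0" "h p p = 0" "h p u = 0" "h w p = 0" "h w u \<noteq> 0" "h u u = 0"
    "h (w + s *s u) (w + s *s u) = 0"
  shows "\<exists>e2 e3. frame p (w + s *s u) e2 e3"
proof (rule frame_exists)
  show "h p (w + s *s u) = 0" using assms(3) h_sym_zero [OF assms(4)] by (simp add: h_linear)
  fix a b assume z: "a *s p + b *s (w + s *s u) = 0"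
  have "h (a *s p + b *s (w + s *s u)) u = b * h w u" using assms by (simp add: h_linear)
  then have "b = 0" using z assms(5) by simp
  then show "a = 0 \<and> b = 0" using z assms(1) by simp
qed fact+

text \<open>A second generator through \<open>p\<close> would span the tangent plane at \<open>p\<close> together with the first one, and
  \<open>f\<close> would vanish on it.\<close>

lemma no_further_lines:
  assumes flag: "p \<noteq> 0" "h p p = 0" "h p u = 0" "h w p = 0" "h w u \<noteq> 0" "h u u = 0"
    and plane: "\<And>x. h x p = 0 \<Longrightarrow> \<exists>a b c. x = a *s p + (b *s u + c *s w)"
    and l: "line_in p u" and sing: "singular_line p u"
    and all_sing: "\<And>y e2 e3. frame p y e2 e3 \<Longrightarrow> line_in p y \<Longrightarrow> singular_line p y"
  shows "lines_through p u w = 0"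
proof -
  have False if s: "h (w + s *s u) (w + s *s u) = 0" "line_in p (w + s *s u)" for s
  proof -
    let ?y = "w + s *s u"
    have y: "singular_line p ?y" using flag_frame [OF flag s(1)] all_sing s(2) by blast
    obtain x where x: "h x p = 0" "f x \<noteq> 0" using no_tangent_plane [OF flag(1,2)] by (auto simp: perp_def)
    then obtain a b c where "x = a *s p + (b *s u + c *s w)" using plane by blast
    then have "x = (a *s p + (b - c * s) *s u) + c *s ?y"
      by (simp add: vec_eq_iff algebra_simps)
    then have "f x = 0" using singular_lines_span [OF l s(2) sing y] by (simp only:)
    with x(2) show False by simp
  qed
  then show ?thesis unfolding lines_through_def by (auto simp: card_eq_0_iff)
qed

lemma frame_point_nonzero:
  assumes "frame e0 e1 e2 e3"
  shows "e0 \<noteq> 0" "e1 \<noteq> 0" "e0 + t *s e1 \<noteq> 0"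
proof -
  note H = frame_h [OF assms]
  show "e0 \<noteq> 0" "e1 \<noteq> 0" using H by auto
  have "h e2 (e0 + t *s e1) = 1" by (simp add: h_linear H)
  then show "e0 + t *s e1 \<noteq> 0" using h_zero(2) [of e2] zero_neq_one by metis
qed

lemma card_points_le:
  assumes F: "frame e0 e1 e2 e3" and l: "line_in e0 e1"
  shows "card (iso_points {x. f x = 0}) \<le> (q ^ 2 + 1) * (1 + (d - 1) * q) +
    ((\<Sum>t\<in>UNIV. lines_through (e0 + t *s e1) e1 (t ^ q *s e2 - e3)) + lines_through e1 e0 e2) * (q ^ 2 - q)"
proof -
  have "card (iso_points {x. f x = 0}) \<le>
      (\<Sum>t\<in>UNIV. 1 + (d - 1) * q + lines_through (e0 + t *s e1) e1 (t ^ q *s e2 - e3) * (q ^ 2 - q)) +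
      (1 + (d - 1) * q + lines_through e1 e0 e2 * (q ^ 2 - q))"
    unfolding card_iso_points_frame [OF F is_form_f]
    by (intro add_mono sum_mono zeros_through_finite [OF F l] zeros_through_infinity [OF F l])
  also have "\<dots> = (q ^ 2 + 1) * (1 + (d - 1) * q) +
    ((\<Sum>t\<in>UNIV. lines_through (e0 + t *s e1) e1 (t ^ q *s e2 - e3)) + lines_through e1 e0 e2) * (q ^ 2 - q)"
    by (simp add: sum.distrib sum_distrib_right card_field add_mult_distrib del: One_nat_def)
  finally show ?thesis .
qed

text \<open>Either some generator in the surface is not a singular line, and the sum of the numbers
  \<open>lines_through\<close> along it is at most \<open>q + d - 1\<close>; or all of them are singular lines, and then these
  numbers are 0.\<close>

lemma card_points_line_in:
  assumes F: "frame e0 e1 e2 e3" and l: "line_in e0 e1"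
  shows "card (iso_points {x. f x = 0}) \<le> (q ^ 2 + 1) * (1 + (d - 1) * q) + (q + d - 1) * (q ^ 2 - q)"
proof (cases "\<exists>e0 e1 e2 e3. frame e0 e1 e2 e3 \<and> line_in e0 e1 \<and> \<not> singular_line e0 e1")
  case True
  then obtain e0 e1 e2 e3 where F: "frame e0 e1 e2 e3" and l: "line_in e0 e1"
      and "\<not> singular_line e0 e1"
    by blast
  then obtain a b z where nz: "a *s e0 + b *s e1 \<noteq> 0" and z: "C 1 (a *s e0 + b *s e1) z \<noteq> 0"
    by (auto simp: singular_line_def)
  note H = frame_h [OF F]
  \<comment> \<open>Pass to a frame whose first vector is a nonsingular point of the line.\<close>
  define p where "p = a *s e0 + b *s e1"
  define u where "u = (if a \<noteq> 0 then e1 else e0)"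
  have u: "u = (if a \<noteq> 0 then 0 else 1) *s e0 + (if a \<noteq> 0 then 1 else 0) *s e1"
    by (simp add: u_def)
  have ind: "k = 0 \<and> m = 0" if "k *s p + m *s u = 0" for k m
  proof -
    have "(k * a + m * (if a \<noteq> 0 then 0 else 1)) *s e0 + (k * b + m * (if a \<noteq> 0 then 1 else 0)) *s e1 +
        0 *s e2 + 0 *s e3 = 0 *s e0 + 0 *s e1 + 0 *s e2 + 0 *s e3"
      using that unfolding u p_def by (simp add: vec_eq_iff algebra_simps)
    from frame_unique(1,2) [OF F this] show ?thesis
      using nz by (auto split: if_splits)
  qed
  have "h p p = 0" "h u u = 0" "h p u = 0"
    by (simp_all add: p_def u_def h_linear H)
  from frame_exists [OF this ind] obtain e2' e3' where F': "frame p u e2' e3'"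
    by blast
  have l': "line_in p u"
    unfolding p_def u by (rule line_in_lincomb [OF l])
  have z': "C 1 p z \<noteq> 0" using z by (simp add: p_def)
  obtain e1'' e2'' e3'' where F'': "frame p e1'' e2'' e3''" and l'': "line_in p e1''"
      and "lines_through e1'' p e2'' = 0"
    using frame_with_free_point [OF F' l' z'] .
  then have "(\<Sum>t\<in>UNIV. lines_through (p + t *s e1'') e1'' (t ^ q *s e2'' - e3'')) +
      lines_through e1'' p e2'' \<le> q + d - 1"
    using sum_lines_through [OF F'' l'' z'] by simp
  then show ?thesis
    by (rule order_trans [OF card_points_le [OF F'' l''] add_left_mono [OF mult_right_mono]]) simp
next
  case False
  then have all: "\<And>e0 e1 e2 e3. frame e0 e1 e2 e3 \<Longrightarrow> line_in e0 e1 \<Longrightarrow> singular_line e0 e1"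
    by blast
  note H = frame_h [OF F]
  have comb: "singular_line x y" if "x = a *s e0 + b *s e1" "y = a' *s e0 + b' *s e1" for x y a b a' b'
  proof -
    have "k *s x + m *s y = (k * a + m * a') *s e0 + (k * b + m * b') *s e1" for k m
      unfolding that by (simp add: vec_eq_iff algebra_simps)
    then show ?thesis using all [OF F l] unfolding singular_line_def by (simp only:) blast
  qed
  have "lines_through (e0 + t *s e1) e1 (t ^ q *s e2 - e3) = 0" for t
  proof (rule no_further_lines)
    show "line_in (e0 + t *s e1) e1" using line_in_lincomb [OF l, of 1 t 0 1] by simp
    show "singular_line (e0 + t *s e1) e1" by (rule comb [of _ 1 t _ 0 1]) simp_all
  qed (use frame_point_nonzero [OF F] perp_frame_finite [OF F] all in \<open>simp_all add: h_linear H\<close>)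
  moreover have "lines_through e1 e0 e2 = 0"
  proof (rule no_further_lines)
    show "line_in e1 e0" using line_in_lincomb [OF l, of 0 1 1 0] by simp
    show "singular_line e1 e0" by (rule comb [of _ 0 1 _ 1 0]) simp_all
  qed (use frame_point_nonzero [OF F] perp_frame_infinity [OF F] all in \<open>simp_all add: H\<close>)
  ultimately show ?thesis using card_points_le [OF F l] by simp
qed

text \<open>Each of the \<open>q\<close> further generators through \<open>p\<close> carries at most \<open>d\<close> zeros of \<open>f\<close>, and at most \<open>d - 1\<close>
  besides \<open>p\<close> if \<open>p\<close> is a zero.  The latter saves \<open>q - 1\<close> in the count.\<close>

lemma zeros_through_no_line:
  assumes no: "\<And>e0 e1 e2 e3. frame e0 e1 e2 e3 \<Longrightarrow> \<not> line_in e0 e1"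
    and flag: "p \<noteq> 0" "h p p = 0" "h p u = 0" "h w p = 0" "h w u \<noteq> 0" "h u u = 0"
  shows "zeros_through f p u w + (if f p = 0 then q - 1 else 0) \<le> q * d"
proof -
  let ?S = "{t. h (w + t *s u) (w + t *s u) = 0}"
  let ?n = "\<lambda>t. card {a. f (w + t *s u + a *s p) = 0}"
  have S: "card ?S = q"
    using card_isotropic_translates [OF flag(6)] flag(5) h_sym_zero by blast
  have nz: "\<exists>a b. f (a *s p + b *s (w + t *s u)) \<noteq> 0" if "t \<in> ?S" for t
  proof -
    have "h (w + t *s u) (w + t *s u) = 0" using that by simp
    from flag_frame [OF flag this] no have "\<not> line_in p (w + t *s u)" by blast
    then show ?thesis unfolding line_in_def by blast
  qed
  show ?thesis
  proof (cases "f p = 0")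
    case True
    have "?n t \<le> d - 1" if "t \<in> ?S" for t
    proof -
      obtain a b where "f (a *s p + b *s (w + t *s u)) \<noteq> 0" using nz [OF \<open>t \<in> ?S\<close>] by blast
      from card_zeros_on_line(2) [OF expansion_facts this True] show ?thesis by simp
    qed
    then have "(\<Sum>t\<in>?S. ?n t) \<le> (\<Sum>t\<in>?S. d - 1)" by (rule sum_mono)
    also have "\<dots> = q * (d - 1)" by (simp only: sum_constant S) simp
    finally have "zeros_through f p u w + (q - 1) \<le> 1 + q * (d - 1) + (q - 1)"
      using True by (simp add: zeros_through_def)
    also have "\<dots> = q * d" using d_pos q_ge_4 by (cases d) auto
    finally show ?thesis using True by simp
  next
    case False
    have "?n t \<le> d" if "t \<in> ?S" for t
    proof -
      obtain a b where "f (a *s p + b *s (w + t *s u)) \<noteq> 0" using nz [OF \<open>t \<in> ?S\<close>] by blast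
      from card_zeros_on_line(1) [OF expansion_facts this] show ?thesis .
    qed
    then have "(\<Sum>t\<in>?S. ?n t) \<le> (\<Sum>t\<in>?S. d)" by (rule sum_mono)
    also have "\<dots> = q * d" by (simp only: sum_constant S) simp
    finally show ?thesis using False by (simp add: zeros_through_def)
  qed
qed

text \<open>For \<open>d = 1\<close> the crude bound is too weak by \<open>q - 1\<close>; but a plane meets every line, so the saving of
  \<open>zeros_through_no_line\<close> applies at one point.\<close>

lemma card_points_no_line:
  assumes no: "\<And>e0 e1 e2 e3. frame e0 e1 e2 e3 \<Longrightarrow> \<not> line_in e0 e1"
  shows "card (iso_points {x. f x = 0}) \<le> (q ^ 2 + 1) * q * d"
    "d = 1 \<Longrightarrow> card (iso_points {x. f x = 0}) \<le> q ^ 3 + 1"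
proof -
  obtain p where "p \<noteq> 0" "h p p = 0" using isotropic_exists by blast
  then obtain e0 e1 e2 e3 where F: "frame e0 e1 e2 e3" using frame_at_point by blast
  note H = frame_h [OF F]
  define Z where "Z t = zeros_through f (e0 + t *s e1) e1 (t ^ q *s e2 - e3)" for t
  define c where "c t = (if f (e0 + t *s e1) = 0 then q - 1 else 0)" for t
  define Z' where "Z' = zeros_through f e1 e0 e2"
  define c' where "c' = (if f e1 = 0 then q - 1 else 0)"
  have Z: "Z t + c t \<le> q * d" for t
    unfolding Z_def c_def
    by (rule zeros_through_no_line [OF no]) (use frame_point_nonzero [OF F] in \<open>simp_all add: h_linear H\<close>)
  have Z': "Z' + c' \<le> q * d"
    unfolding Z'_def c'_def
    by (rule zeros_through_no_line [OF no]) (use frame_point_nonzero [OF F] in \<open>simp_all add: H\<close>)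
  have N: "card (iso_points {x. f x = 0}) = (\<Sum>t\<in>UNIV. Z t) + Z'"
    by (simp add: card_iso_points_frame [OF F is_form_f] Z_def Z'_def)
  have "(\<Sum>t\<in>UNIV. Z t + c t) + (Z' + c') \<le> (\<Sum>t\<in>(UNIV :: 'a set). q * d) + q * d"
    by (intro add_mono sum_mono Z Z')
  also have "\<dots> = (q ^ 2 + 1) * q * d" by (simp add: card_field algebra_simps)
  finally have total: "card (iso_points {x. f x = 0}) + ((\<Sum>t\<in>UNIV. c t) + c') \<le> (q ^ 2 + 1) * q * d"
    by (simp add: N sum.distrib)
  then show "card (iso_points {x. f x = 0}) \<le> (q ^ 2 + 1) * q * d" by simp
  assume d: "d = 1"
  have lin: "f (a *s x + b *s y) = a * f x + b * f y" for a b x y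
    using is_form_f unfolding d by (rule is_form_1_linear)
  have "q - 1 \<le> (\<Sum>t\<in>UNIV. c t) + c'"
  proof (cases "f e1 = 0")
    case False
    define t where "t = - f e0 / f e1"
    have "f (e0 + t *s e1) = 0" using lin [of 1 e0 t e1] False by (simp add: t_def)
    then have "c t = q - 1" by (simp add: c_def)
    moreover have "c t \<le> (\<Sum>t\<in>UNIV. c t)" by (rule member_le_sum) auto
    ultimately show ?thesis by simp
  qed (simp add: c'_def)
  with total have "card (iso_points {x. f x = 0}) + (q - 1) \<le> (q ^ 2 + 1) * q" by (simp add: d)
  moreover have "(q ^ 2 + 1) * q = q ^ 3 + 1 + (q - 1)"
    using q_ge_4 by (simp add: power2_eq_square power3_eq_cube algebra_simps)
  ultimately show "card (iso_points {x. f x = 0}) \<le> q ^ 3 + 1" by simp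
qed

text \<open>Both estimates are polynomials in \<open>q\<close>; they are compared after the substitution \<open>q = r + 4\<close>, which makes
  all coefficients nonnegative.\<close>

lemma card_points_bounds:
  "d = 1 \<Longrightarrow> card (iso_points {x. f x = 0}) \<le> q ^ 3 + 1"
  "d = 2 \<Longrightarrow> card (iso_points {x. f x = 0}) + 3 * q \<le> 2 * q ^ 3 + 2 * q ^ 2"
  "d = 3 \<Longrightarrow> card (iso_points {x. f x = 0}) + 3 * q \<le> 3 * q ^ 3 + 3 * q ^ 2 + 1"
proof -
  obtain r where r: "q = r + 4" using q_ge_4 by (metis le_add_diff_inverse2)
  have qq: "q ^ 2 - q = (r + 4) * (r + 3)"
    by (simp add: r power2_eq_square algebra_simps)
  note arith = r power2_eq_square power3_eq_cube algebra_simps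
  show "d = 1 \<Longrightarrow> card (iso_points {x. f x = 0}) \<le> q ^ 3 + 1"
  proof (cases "\<exists>e0 e1 e2 e3. frame e0 e1 e2 e3 \<and> line_in e0 e1")
    case True
    assume d: "d = 1"
    show ?thesis using True card_points_line_in unfolding d qq by (fastforce simp: arith)
  qed (use card_points_no_line(2) in blast)
  show "d = 2 \<Longrightarrow> card (iso_points {x. f x = 0}) + 3 * q \<le> 2 * q ^ 3 + 2 * q ^ 2"
  proof (cases "\<exists>e0 e1 e2 e3. frame e0 e1 e2 e3 \<and> line_in e0 e1")
    case True
    assume d: "d = 2"
    show ?thesis using True card_points_line_in unfolding d qq by (fastforce simp: arith)
  next
    case False
    assume d: "d = 2"
    show ?thesis using False card_points_no_line(1) unfolding d by (fastforce simp: arith)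
  qed
  show "d = 3 \<Longrightarrow> card (iso_points {x. f x = 0}) + 3 * q \<le> 3 * q ^ 3 + 3 * q ^ 2 + 1"
  proof (cases "\<exists>e0 e1 e2 e3. frame e0 e1 e2 e3 \<and> line_in e0 e1")
    case True
    assume d: "d = 3"
    show ?thesis using True card_points_line_in unfolding d qq by (fastforce simp: arith)
  next
    case False
    assume d: "d = 3"
    show ?thesis using False card_points_no_line(1) unfolding d by (fastforce simp: arith)
  qed
qed

end

context hermitian
begin

section \<open>Unions of three tangent planes\<close>

lemma h_as_linear_form: "h x p = (\<Sum>i\<in>UNIV. (\<Sum>j\<in>UNIV. A $ i $ j * (p $ j) ^ q) * x $ i)"
  by (simp add: h_def sum_distrib_left mult_ac)

lemma is_form_h_left: "is_form 1 (\<lambda>x. h x p)"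
proof -
  have "is_form (Suc 0) (\<lambda>x. h x p * 1)"
    unfolding h_as_linear_form by (rule is_form_linear_mult) auto
  then show ?thesis by (simp del: is_form.simps)
qed

text \<open>Count the zeros of \<open>h _ p\<close> with a frame that starts at \<open>p\<close>: the tangent plane at \<open>p\<close> lies in the zero
  set, and those at the other points of the line meet it in the line only.\<close>

lemma card_tangent_plane:
  assumes p: "p \<noteq> 0" "h p p = 0"
  shows "card (iso_points (perp p)) = q ^ 3 + q ^ 2 + 1"
proof -
  obtain e1 e2 e3 where F: "frame p e1 e2 e3" using frame_at_point [OF p] by blast
  note H = frame_h [OF F]
  have "zeros_through (\<lambda>x. h x p) (p + t *s e1) e1 (t ^ q *s e2 - e3) = 1 + (if t = 0 then q * q ^ 2 else 0)"
    for t
  proof -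
    let ?w = "t ^ q *s e2 - e3"
    have "card {s. h (?w + s *s e1) (?w + s *s e1) = 0} = q"
      by (rule card_isotropic_translates) (simp_all add: h_linear H)
    moreover have "h (?w + s *s e1 + a *s (p + t *s e1)) p = t ^ q" for s a
      by (simp add: h_linear H)
    moreover have "h (p + t *s e1) p = 0" by (simp add: h_linear H)
    ultimately show ?thesis by (simp add: zeros_through_def card_field)
  qed
  moreover have "zeros_through (\<lambda>x. h x p) e1 p e2 = 1"
    by (simp add: zeros_through_def h_linear H)
  ultimately have "card (iso_points {x. h x p = 0}) = q ^ 2 + q * q ^ 2 + 1"
    unfolding card_iso_points_frame [OF F is_form_h_left]
    by (simp only: sum.distrib) (simp add: card_field)
  then show ?thesis by (simp add: perp_def power2_eq_square power3_eq_cube)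
qed

lemma iso_points_perp_Int: "iso_points (perp p \<inter> perp r) = iso_points (perp p) \<inter> iso_points (perp r)"
  by (rule iso_points_Int [OF subspace_perp])

lemma iso_points_dim_1:
  assumes "vec.subspace S" "vec.dim S = 1"
  shows "iso_points S \<subseteq> {S}"
proof
  fix P assume "P \<in> iso_points S"
  then obtain x where x: "x \<in> S" "x \<noteq> 0" "P = vec.span {x}" by (auto simp: iso_points_def)
  then have "vec.span {x} = S"
    using assms by (intro vec.subspace_dim_equal) (simp_all add: vec.span_minimal)
  then show "P \<in> {S}" using x(3) by simp
qed

lemma card_three_tangent_planes:
  assumes p: "p1 \<noteq> 0" "h p1 p1 = 0" "p2 \<noteq> 0" "h p2 p2 = 0" "p3 \<noteq> 0" "h p3 p3 = 0"
    and nonorth: "h p1 p2 \<noteq> 0" "h p1 p3 \<noteq> 0" "h p2 p3 \<noteq> 0"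
  shows "card (iso_points (perp p1 \<union> perp p2 \<union> perp p3)) =
    3 * (q ^ 3 + q ^ 2 - q) + card (iso_points (perp p1 \<inter> perp p2 \<inter> perp p3))"
proof -
  let ?A = "iso_points (perp p1)" and ?B = "iso_points (perp p2)" and ?C = "iso_points (perp p3)"
  have AB: "card (?A \<inter> ?B) = q + 1" and AC: "card (?A \<inter> ?C) = q + 1" and BC: "card (?B \<inter> ?C) = q + 1"
    using polar_line_secant(2) p nonorth by (simp_all flip: iso_points_perp_Int)
  have ABC: "iso_points (perp p1 \<inter> perp p2 \<inter> perp p3) = ?A \<inter> ?B \<inter> ?C"
    by (simp add: iso_points_Int [OF subspace_perp])
  have 1: "card (?A \<union> ?B) + card (?A \<inter> ?B) = card ?A + card ?B"
    by (rule card_Un_Int [symmetric]) simp_all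
  have 2: "card (?A \<union> ?B \<union> ?C) + card ((?A \<union> ?B) \<inter> ?C) = card (?A \<union> ?B) + card ?C"
    by (rule card_Un_Int [symmetric]) simp_all
  have "(?A \<inter> ?C) \<union> (?B \<inter> ?C) = (?A \<union> ?B) \<inter> ?C" "(?A \<inter> ?C) \<inter> (?B \<inter> ?C) = ?A \<inter> ?B \<inter> ?C"
    by blast+
  then have 3: "card ((?A \<union> ?B) \<inter> ?C) + card (?A \<inter> ?B \<inter> ?C) = card (?A \<inter> ?C) + card (?B \<inter> ?C)"
    using card_Un_Int [of "?A \<inter> ?C" "?B \<inter> ?C"] by simp
  have "q \<le> q ^ 2" using q_ge_2 by (simp add: power2_eq_square)
  then show ?thesis
    using 1 2 3 AB AC BC card_tangent_plane p
    by (simp add: iso_points_Un ABC)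
qed

text \<open>If \<open>p\<close> and \<open>r\<close> are orthogonal, their tangent planes coincide or share the generator through both points.
  They have at least \<open>q\<^sup>2\<close> points of \<open>V\<^sub>2\<close> in common, which is much more than the \<open>q + 1\<close> points of a
  secant line.\<close>

lemma card_orthogonal_tangent_planes:
  assumes "4 \<le> q" and p: "p \<noteq> 0" "h p p = 0" "r \<noteq> 0" "h r r = 0" "s \<noteq> 0" "h s s = 0"
    and orth: "h p r = 0"
  shows "card (iso_points (perp p \<union> perp r \<union> perp s)) \<le> 3 * (q ^ 3 + q ^ 2 - q) + 1"
proof -
  let ?A = "iso_points (perp p)" and ?B = "iso_points (perp r)" and ?C = "iso_points (perp s)"
  have orth': "h r p = 0" using orth h_sym_zero by blast
  have "q ^ 2 \<le> card (?A \<inter> ?B)"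
  proof (cases "\<exists>k. p = k *s r")
    case True
    then obtain k where k: "p = k *s r" by blast
    then have "k \<noteq> 0" using p(1) by auto
    with k have "perp p = perp r" by (auto simp: perp_def h_linear)
    then show ?thesis using card_tangent_plane [OF p(1,2)] by simp
  next
    case False
    have nz: "p + t *s r \<noteq> 0" for t
    proof
      assume "p + t *s r = 0"
      then have "p = (- t) *s r" by (simp add: eq_neg_iff_add_eq_0)
      then show False using False by blast
    qed
    have "inj (\<lambda>t. vec.span {p + t *s r})"
    proof (rule injI)
      fix t t' assume "vec.span {p + t *s r} = vec.span {p + t' *s r}"
      from span_singleton_eqD [OF this nz] obtain k where k: "p + t' *s r = k *s (p + t *s r)" by blast
      have eq: "(1 - k) *s p = (k * t - t') *s r"
        using k by (simp add: vec_eq_iff algebra_simps)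
      have "k = 1"
      proof (rule ccontr)
        assume "k \<noteq> 1"
        then have "p = (1 / (1 - k)) *s ((1 - k) *s p)" by (simp only: vector_smult_assoc) simp
        also have "\<dots> = ((1 / (1 - k)) * (k * t - t')) *s r" by (simp only: eq vector_smult_assoc)
        finally show False using False by blast
      qed
      with eq p(3) show "t = t'" by simp
    qed
    then have "card (range (\<lambda>t. vec.span {p + t *s r})) = q ^ 2"
      by (simp add: card_image card_field)
    moreover have "range (\<lambda>t. vec.span {p + t *s r}) \<subseteq> ?A \<inter> ?B"
      unfolding iso_points_perp_Int [symmetric] using nz p orth orth'
      by (auto simp: iso_points_def perp_def h_linear intro!: imageI)
    ultimately show ?thesis by (metis card_mono finite_Int finite_iso_points)
  qed
  moreover have "card (?A \<union> ?B) + card (?A \<inter> ?B) = card ?A + card ?B"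
    by (rule card_Un_Int [symmetric]) simp_all
  moreover have "card (?A \<union> ?B \<union> ?C) \<le> card (?A \<union> ?B) + card ?C"
    by (rule card_Un_le)
  ultimately have "card (?A \<union> ?B \<union> ?C) + q ^ 2 \<le> 3 * (q ^ 3 + q ^ 2 + 1)"
    using card_tangent_plane p by simp
  moreover have "3 * q + 2 \<le> q ^ 2"
  proof -
    obtain k where "q = k + 4" using assms(1) by (metis le_add_diff_inverse2)
    then show ?thesis by (simp add: power2_eq_square algebra_simps)
  qed
  ultimately show ?thesis by (simp add: iso_points_Un)
qed

text \<open>For pairwise nonorthogonal points, inclusion-exclusion leaves only the common points of the three planes
  to be counted: these form a secant line, or at most one point of \<open>V\<^sub>2\<close>.\<close>

lemma tangent_planes_dichotomy:
  assumes "4 \<le> q" and p: "p1 \<noteq> 0" "h p1 p1 = 0" "p2 \<noteq> 0" "h p2 p2 = 0" "p3 \<noteq> 0" "h p3 p3 = 0"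
  shows "card (iso_points (perp p1 \<union> perp p2 \<union> perp p3)) \<le> 3 * (q ^ 3 + q ^ 2 - q) + 1 \<or>
    card (iso_points (perp p1 \<union> perp p2 \<union> perp p3)) = 3 * (q ^ 3 + q ^ 2 - q) + (q + 1)"
proof (cases "h p1 p2 = 0 \<or> h p1 p3 = 0 \<or> h p2 p3 = 0")
  case True
  have "card (iso_points (perp p1 \<union> perp p2 \<union> perp p3)) \<le> 3 * (q ^ 3 + q ^ 2 - q) + 1"
    using True card_orthogonal_tangent_planes [OF assms(1), of p1 p2 p3]
      card_orthogonal_tangent_planes [OF assms(1), of p1 p3 p2]
      card_orthogonal_tangent_planes [OF assms(1), of p2 p3 p1] p
    by (auto simp: Un_ac)
  then show ?thesis ..
next
  case False
  then have N: "card (iso_points (perp p1 \<union> perp p2 \<union> perp p3)) =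
      3 * (q ^ 3 + q ^ 2 - q) + card (iso_points (perp p1 \<inter> perp p2 \<inter> perp p3))"
    using p by (intro card_three_tangent_planes) auto
  let ?W = "perp p1 \<inter> perp p2"
  have W: "vec.subspace ?W" "vec.dim ?W = 2" "card (iso_points ?W) = q + 1"
    using polar_line_secant [of p1 p2] p False by (auto intro: vec.subspace_inter subspace_perp)
  show ?thesis
  proof (cases "?W \<subseteq> perp p3")
    case True
    then have "?W \<inter> perp p3 = ?W" by blast
    then show ?thesis using N W(3) by simp
  next
    case no: False
    then obtain y where y: "y \<in> ?W" "h y p3 \<noteq> 0" by (auto simp: perp_def)
    have eq: "{x \<in> ?W. h x p3 = 0} = ?W \<inter> perp p3" by (auto simp: perp_def)
    have "vec.subspace (?W \<inter> perp p3)" "vec.dim ?W = Suc (vec.dim (?W \<inter> perp p3))"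
      using dim_kernel [OF W(1) y(1), of "\<lambda>x. h x p3"] y(2) unfolding eq by (simp_all add: h_linear)
    then have "card (iso_points (?W \<inter> perp p3)) \<le> card {?W \<inter> perp p3}"
      using W(2) by (intro card_mono iso_points_dim_1) auto
    then show ?thesis using N by simp
  qed
qed

section \<open>Cubic surfaces\<close>

definition contains_no_tangent_plane :: "('a ^ 4 \<Rightarrow> 'a) \<Rightarrow> bool" where
  "contains_no_tangent_plane f \<longleftrightarrow> (\<forall>p. p \<noteq> 0 \<longrightarrow> h p p = 0 \<longrightarrow> (\<exists>x\<in>perp p. f x \<noteq> 0))"

lemma card_points_no_tangent_plane:
  assumes "is_form d f" "contains_no_tangent_plane f" "4 \<le> q"
  shows "d = 1 \<Longrightarrow> card (iso_points {x. f x = 0}) \<le> q ^ 3 + 1"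
    "d = 2 \<Longrightarrow> card (iso_points {x. f x = 0}) + 3 * q \<le> 2 * q ^ 3 + 2 * q ^ 2"
    "d = 3 \<Longrightarrow> card (iso_points {x. f x = 0}) + 3 * q \<le> 3 * q ^ 3 + 3 * q ^ 2 + 1"
proof -
  obtain C where C: "bihomogeneous_expansion d f C"
    using form_bihomogeneous_expansion [OF assms(1)] by blast
  have sec: "hermitian_section q A d f C" if "1 \<le> d" "d \<le> 3"
    using that C assms(2,3) by unfold_locales (auto simp: contains_no_tangent_plane_def)
  show "d = 1 \<Longrightarrow> card (iso_points {x. f x = 0}) \<le> q ^ 3 + 1"
    using hermitian_section.card_points_bounds(1) [OF sec] by simp
  show "d = 2 \<Longrightarrow> card (iso_points {x. f x = 0}) + 3 * q \<le> 2 * q ^ 3 + 2 * q ^ 2"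
    using hermitian_section.card_points_bounds(2) [OF sec] by simp
  show "d = 3 \<Longrightarrow> card (iso_points {x. f x = 0}) + 3 * q \<le> 3 * q ^ 3 + 3 * q ^ 2 + 1"
    using hermitian_section.card_points_bounds(3) [OF sec] by simp
qed

lemma tangent_plane_factor:
  assumes f: "is_form (Suc d) f" and p: "p \<noteq> 0" "\<And>x. x \<in> perp p \<Longrightarrow> f x = 0"
  shows "\<exists>g. is_form d g \<and> (\<forall>x. f x = h x p * g x)"
proof -
  obtain y where y: "h y p \<noteq> 0" using nondegenerate [OF p(1)] .
  let ?c = "\<lambda>i. \<Sum>j\<in>UNIV. A $ i $ j * (p $ j) ^ q"
  have "(\<Sum>i\<in>UNIV. ?c i * ((1 / h y p) *s y) $ i) = 1"
    using y unfolding h_as_linear_form [symmetric] by (simp add: h_scale_left)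
  moreover have "f x = 0" if "(\<Sum>i\<in>UNIV. ?c i * x $ i) = 0" for x
    using that p(2) unfolding h_as_linear_form [symmetric] by (simp add: perp_def)
  ultimately show ?thesis
    by (rule form_vanishing_on_hyperplane [OF f]) (auto simp: h_as_linear_form)
qed

lemma tangent_plane_component:
  assumes "is_form (Suc d) f" "\<not> contains_no_tangent_plane f"
  shows "\<exists>p g. p \<noteq> 0 \<and> h p p = 0 \<and> is_form d g \<and> (\<forall>x. f x = h x p * g x) \<and>
    {x. f x = 0} = perp p \<union> {x. g x = 0}"
proof -
  obtain p where p: "p \<noteq> 0" "h p p = 0" "\<And>x. x \<in> perp p \<Longrightarrow> f x = 0"
    using assms(2) by (auto simp: contains_no_tangent_plane_def)
  obtain g where g: "is_form d g" "\<forall>x. f x = h x p * g x"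
    using tangent_plane_factor [OF assms(1) p(1,3)] by blast
  then have "{x. f x = 0} = perp p \<union> {x. g x = 0}" by (auto simp: perp_def)
  with p g show ?thesis by blast
qed

text \<open>Split off tangent planes as long as possible.  The remaining factor of degree 3, 2 or 1 contains no
  tangent plane and is small enough for the total to stay below the second value; if nothing but a
  constant remains, the surface consists of three tangent planes.\<close>

lemma cubic_section_dichotomy:
  assumes q: "4 \<le> q" and f: "is_form 3 f" "f x \<noteq> 0"
  shows "card (iso_points {x. f x = 0}) \<le> 3 * (q ^ 3 + q ^ 2 - q) + 1 \<or>
    card (iso_points {x. f x = 0}) = 3 * (q ^ 3 + q ^ 2 - q) + (q + 1)"
proof -
  have qq: "q \<le> q ^ 2" using q_ge_2 by (simp add: power2_eq_square)
  have q2: "3 * q + 2 \<le> q ^ 2"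
  proof -
    obtain k where "q = k + 4" using q by (metis le_add_diff_inverse2)
    then show ?thesis by (simp add: power2_eq_square algebra_simps)
  qed
  have v: "3 * (q ^ 3 + q ^ 2 - q) + 3 * q = 3 * q ^ 3 + 3 * q ^ 2"
    using qq by simp
  have Un: "card (iso_points (S \<union> T)) \<le> card (iso_points S) + card (iso_points T)" for S T
    unfolding iso_points_Un by (rule card_Un_le)
  show ?thesis
  proof (cases "contains_no_tangent_plane f")
    case True
    have "card (iso_points {x. f x = 0}) + 3 * q \<le> 3 * q ^ 3 + 3 * q ^ 2 + 1"
      by (rule card_points_no_tangent_plane(3) [OF f(1) True q]) simp
    then have "card (iso_points {x. f x = 0}) \<le> 3 * (q ^ 3 + q ^ 2 - q) + 1"
      using v by linarith
    then show ?thesis ..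
  next
    case False
    have "is_form (Suc 2) f" using f(1) by (simp only: numeral_3_eq_3 numeral_2_eq_2)
    from tangent_plane_component [OF this False] obtain p1 g where
      g: "p1 \<noteq> 0" "h p1 p1 = 0" "is_form 2 g" "\<forall>x. f x = h x p1 * g x"
        and S1: "{x. f x = 0} = perp p1 \<union> {x. g x = 0}"
      by blast
    note T1 = card_tangent_plane [OF g(1,2)]
    show ?thesis
    proof (cases "contains_no_tangent_plane g")
      case True
      have "card (iso_points {x. g x = 0}) + 3 * q \<le> 2 * q ^ 3 + 2 * q ^ 2"
        by (rule card_points_no_tangent_plane(2) [OF g(3) True q]) simp
      then have "card (iso_points (perp p1 \<union> {x. g x = 0})) \<le> 3 * (q ^ 3 + q ^ 2 - q) + 1"
        using Un [of "perp p1" "{x. g x = 0}"] T1 v by linarith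
      then show ?thesis unfolding S1 ..
    next
      case False
      have "is_form (Suc 1) g" using g(3) by (simp only: Suc_1)
      from tangent_plane_component [OF this False] obtain p2 k where
        k: "p2 \<noteq> 0" "h p2 p2 = 0" "is_form 1 k" "\<forall>x. g x = h x p2 * k x"
          and S2: "{x. g x = 0} = perp p2 \<union> {x. k x = 0}"
        by blast
      note T2 = card_tangent_plane [OF k(1,2)]
      have S: "{x. f x = 0} = perp p1 \<union> perp p2 \<union> {x. k x = 0}"
        unfolding S1 S2 by (rule Un_assoc [symmetric])
      show ?thesis
      proof (cases "contains_no_tangent_plane k")
        case True
        have "card (iso_points {x. k x = 0}) \<le> q ^ 3 + 1"
          by (rule card_points_no_tangent_plane(1) [OF k(3) True q]) simp
        then have "card (iso_points (perp p1 \<union> perp p2 \<union> {x. k x = 0})) \<le>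
            3 * (q ^ 3 + q ^ 2 - q) + 1"
          using Un [of "perp p1 \<union> perp p2" "{x. k x = 0}"] Un [of "perp p1" "perp p2"] T1 T2 q2 v
          by linarith
        then show ?thesis unfolding S ..
      next
        case False
        have "is_form (Suc 0) k" using k(3) by (simp only: One_nat_def)
        from tangent_plane_component [OF this False] obtain p3 c where
          c: "p3 \<noteq> 0" "h p3 p3 = 0" "is_form 0 c" "\<forall>x. k x = h x p3 * c x"
            and S3: "{x. k x = 0} = perp p3 \<union> {x. c x = 0}"
          by blast
        have "c x \<noteq> 0" using f(2) by (simp add: g(4) k(4) c(4))
        then have "{x. c x = 0} = {}" using c(3) by auto
        then show ?thesis
          using tangent_planes_dichotomy [OF q g(1,2) k(1,2) c(1,2)] unfolding S S3 by simp
      qed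
    qed
  qed
qed

section \<open>Three tangent planes attaining the two highest values\<close>

text \<open>Three points \<open>p1\<close>, \<open>p2\<close> and \<open>p2 + k *s p1\<close> of a secant line, and a point \<open>r\<close> of the polar line.\<close>

lemma isotropic_triple:
  obtains p1 p2 k r where "h p1 p1 = 0" "h p2 p2 = 0" "h p1 p2 = 1" "h p2 p1 = 1" "k \<noteq> 0"
    "h (p2 + k *s p1) (p2 + k *s p1) = 0" "r \<noteq> 0" "h r r = 0" "r \<in> perp p1 \<inter> perp p2"
proof -
  obtain e0 where "e0 \<noteq> 0" "h e0 e0 = 0" using isotropic_exists by blast
  then obtain e1 e2 e3 where F: "frame e0 e1 e2 e3" using frame_at_point by blast
  note H = frame_h [OF F]
  have "card {c. h (e2 + c *s e0) (e2 + c *s e0) = 0} = q"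
    by (rule card_isotropic_translates) (simp_all add: H)
  then have "\<not> card {c. h (e2 + c *s e0) (e2 + c *s e0) = 0} \<le> 1"
    using q_ge_2 by simp
  then obtain c c' where c: "h (e2 + c *s e0) (e2 + c *s e0) = 0" "h (e2 + c' *s e0) (e2 + c' *s e0) = 0"
      "c \<noteq> c'"
    by (auto simp: card_le_Suc0_iff_eq)
  let ?p = "e2 + c *s e0"
  have p: "h e0 ?p = 1" "h ?p e0 = 1" by (simp_all add: h_linear H)
  have "vec.dim (perp e0 \<inter> perp ?p) = 2"
    using polar_line_secant(1) [of e0 ?p] c(1) p H by simp
  then obtain r where r: "r \<in> perp e0 \<inter> perp ?p" "r \<noteq> 0" "h r r = 0"
    using isotropic_in_subspace [OF vec.subspace_inter [OF subspace_perp subspace_perp], of e0 ?p] by auto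
  have "?p + (c' - c) *s e0 = e2 + c' *s e0" by (simp add: vec_eq_iff algebra_simps)
  then show ?thesis
    using that [of e0 ?p "c' - c" r] c p r H by simp
qed

text \<open>With \<open>p3 = p2 + k *s p1\<close>, the plane \<open>perp p3\<close> contains the line \<open>perp p1 \<inter> perp p2\<close>.  With
  \<open>p3' = p3 + r\<close>, it cuts out the vectors of that line which are orthogonal to \<open>r\<close>, and these are the
  multiples of \<open>r\<close>.\<close>

lemma three_isotropic_points:
  obtains p1 p2 p3 p3' where
    "h p1 p1 = 0" "h p2 p2 = 0" "h p3 p3 = 0" "h p3' p3' = 0"
    "h p1 p2 \<noteq> 0" "h p1 p3 \<noteq> 0" "h p2 p3 \<noteq> 0" "h p1 p3' \<noteq> 0" "h p2 p3' \<noteq> 0"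
    "card (iso_points (perp p1 \<inter> perp p2 \<inter> perp p3)) = q + 1"
    "card (iso_points (perp p1 \<inter> perp p2 \<inter> perp p3')) = 1"
proof -
  obtain p1 p2 k r where H: "h p1 p1 = 0" "h p2 p2 = 0" "h p1 p2 = 1" "h p2 p1 = 1" and k: "k \<noteq> 0"
    and p3: "h (p2 + k *s p1) (p2 + k *s p1) = 0"
    and r: "r \<noteq> 0" "h r r = 0" "r \<in> perp p1 \<inter> perp p2"
    by (rule isotropic_triple)
  let ?W = "perp p1 \<inter> perp p2"
  let ?p3 = "p2 + k *s p1"
  let ?p3' = "?p3 + r"
  have hr: "h r p1 = 0" "h r p2 = 0" "h p1 r = 0" "h p2 r = 0"
    using r(3) h_sym_zero by (auto simp: perp_def)
  have p3': "h ?p3' ?p3' = 0"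
  proof -
    have "h ?p3' ?p3' = h ?p3 ?p3 + h ?p3 r + h r ?p3 + h r r" by (simp only: h_add_left h_add_right add_ac)
    then show ?thesis using p3 hr r(2) by (simp add: h_linear)
  qed
  have W: "vec.subspace ?W" "vec.dim ?W = 2" "card (iso_points ?W) = q + 1"
    using polar_line_secant [of p1 p2] H by (auto intro: vec.subspace_inter subspace_perp)
  have hW: "h x p1 = 0" "h x p2 = 0" if "x \<in> ?W" for x using that by (simp_all add: perp_def)
  have "?W \<inter> perp ?p3 = ?W" by (auto simp: perp_def h_linear)
  then have 1: "card (iso_points (?W \<inter> perp ?p3)) = q + 1" using W(3) by simp
  have eq: "{x \<in> ?W. h x r = 0} = ?W \<inter> perp ?p3'"
    by (auto simp: perp_def h_linear)
  obtain y where y: "y \<in> ?W" "h y r \<noteq> 0"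
    using perp_perp_nondegenerate [of p1 p2 r] H r by auto
  have dim: "vec.subspace (?W \<inter> perp ?p3')" "vec.dim ?W = Suc (vec.dim (?W \<inter> perp ?p3'))"
    using dim_kernel [OF W(1) y(1), of "\<lambda>x. h x r"] y(2) unfolding eq by (simp_all add: h_linear)
  then have "iso_points (?W \<inter> perp ?p3') \<subseteq> {?W \<inter> perp ?p3'}"
    using W(2) by (intro iso_points_dim_1) simp_all
  moreover have "vec.span {r} \<in> iso_points (?W \<inter> perp ?p3')"
    unfolding eq [symmetric] using r by (auto simp: iso_points_def)
  ultimately have "iso_points (?W \<inter> perp ?p3') = {?W \<inter> perp ?p3'}"
    by (auto dest!: subset_singletonD)
  then have 2: "card (iso_points (?W \<inter> perp ?p3')) = 1" by simp
  show ?thesis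
    by (rule that [of p1 p2 ?p3 ?p3', OF H(1,2) p3 p3' _ _ _ _ _ 1 2])
      (use k hr H in \<open>simp_all add: h_linear\<close>)
qed

text \<open>The product of the equations of the planes.  It is not the zero polynomial, because on the line
  \<open>p1, p2\<close> its factors vanish at no more than three points.\<close>

lemma three_tangent_planes_cubic:
  assumes H: "h p1 p1 = 0" "h p2 p2 = 0" "h p1 p2 \<noteq> 0" "h p2 p3 \<noteq> 0"
  obtains F where "F \<noteq> 0" "homogeneous 3 F" "{x. peval F x = 0} = perp p1 \<union> perp p2 \<union> perp p3"
proof -
  let ?l = "\<lambda>p i. \<Sum>j\<in>UNIV. A $ i $ j * (p $ j) ^ q"
  define F where "F = triple_product (?l p1) (?l p2) (?l p3)"
  have F: "peval F x = h x p1 * h x p2 * h x p3" for x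
    unfolding F_def peval_triple_product h_as_linear_form ..
  have "card {0, - h p1 p3 / h p2 p3} \<le> 2" by (simp add: card_insert_if)
  also have "\<dots> < CARD('a)"
    using power_mono [OF q_ge_2, of 2] by (simp add: card_field)
  finally have "{0, - h p1 p3 / h p2 p3} \<noteq> UNIV" by (metis less_irrefl)
  then obtain t where t: "t \<noteq> 0" "t \<noteq> - h p1 p3 / h p2 p3" by blast
  have "h p1 p3 + t * h p2 p3 \<noteq> 0"
    using t(2) H(4) by (simp add: field_simps eq_neg_iff_add_eq_0)
  moreover have "h p2 p1 \<noteq> 0" using H(3) h_sym_zero by blast
  ultimately have "peval F (p1 + t *s p2) \<noteq> 0"
    using H t(1) by (simp add: F h_linear)
  then have "F \<noteq> 0" by auto
  moreover have "homogeneous 3 F" unfolding F_def by (rule homogeneous_triple_product)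
  moreover have "{x. peval F x = 0} = perp p1 \<union> perp p2 \<union> perp p3"
    by (auto simp: F perp_def)
  ultimately show ?thesis using that by blast
qed

end

theorem theorem5p6:
  fixes q :: nat and A :: "'a::{field,finite} ^ 4 ^ 4" and V2 :: "('a ^ 4) set set"
  assumes "primepow q"
    and "CARD('a) = q ^ 2"
    and "nondeg_hermitian q A"
    and "V2 = VV (herm_poly q A)"
  shows "(\<exists>T :: nat \<Rightarrow> ('a ^ 4) set.
            (\<forall>i\<in>{1..3}. tangent_plane (herm_poly q A) (T i)) \<and>
            (\<forall>i\<in>{1..3}. \<forall>j\<in>{1..3}. i \<noteq> j \<longrightarrow> secant_line q A (T i \<inter> T j)) \<and>
            card (points_of (T 1 \<inter> T 2 \<inter> T 3) \<inter> V2) = 1) \<and>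
         (\<exists>F :: 'a poly4. F \<noteq> 0 \<and> homogeneous 3 F \<and>
            card (VV F \<inter> V2) = 3 * (q ^ 3 + q ^ 2 - q) + 1) \<and>
         (4 \<le> q \<longrightarrow>
            second_highest {card (VV F \<inter> V2) | F :: 'a poly4. F \<noteq> 0 \<and> homogeneous 3 F}
              (3 * (q ^ 3 + q ^ 2 - q) + 1))"
proof -
  interpret hermitian q A using assms(1-3) by unfold_locales
  let ?v = "3 * (q ^ 3 + q ^ 2 - q) + 1" and ?w = "3 * (q ^ 3 + q ^ 2 - q) + (q + 1)"
  let ?S = "{card (VV F \<inter> V2) | F :: 'a poly4. F \<noteq> 0 \<and> homogeneous 3 F}"
  obtain p1 p2 p3 p3' where
    iso: "h p1 p1 = 0" "h p2 p2 = 0" "h p3 p3 = 0" "h p3' p3' = 0" and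
    nonorth: "h p1 p2 \<noteq> 0" "h p1 p3 \<noteq> 0" "h p2 p3 \<noteq> 0" "h p1 p3' \<noteq> 0" "h p2 p3' \<noteq> 0" and
    card3: "card (iso_points (perp p1 \<inter> perp p2 \<inter> perp p3)) = q + 1"
      "card (iso_points (perp p1 \<inter> perp p2 \<inter> perp p3')) = 1"
    by (rule three_isotropic_points)
  have nz: "p1 \<noteq> 0" "p2 \<noteq> 0" "p3 \<noteq> 0" "p3' \<noteq> 0" using nonorth by auto
  have V2_Int: "card (VV F \<inter> V2) = card (iso_points {x. peval F x = 0})" if "homogeneous 3 F" for F
    using VV_Int_VV_herm [OF is_form_peval [OF that]] assms(4) by simp
  have planes: "\<exists>T :: nat \<Rightarrow> ('a ^ 4) set.
            (\<forall>i\<in>{1..3}. tangent_plane (herm_poly q A) (T i)) \<and>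
            (\<forall>i\<in>{1..3}. \<forall>j\<in>{1..3}. i \<noteq> j \<longrightarrow> secant_line q A (T i \<inter> T j)) \<and>
            card (points_of (T 1 \<inter> T 2 \<inter> T 3) \<inter> V2) = 1"
  proof -
    define p where "p i = (if i = 1 then p1 else if i = 2 then p2 else p3')" for i :: nat
    have p: "p i \<noteq> 0" "h (p i) (p i) = 0" for i using nz iso by (simp_all add: p_def)
    have "secant_line q A (perp (p i) \<inter> perp (p j))" if "i \<in> {1..3}" "j \<in> {1..3}" "i \<noteq> j" for i j
    proof -
      have sub: "vec.subspace (perp (p i) \<inter> perp (p j))"
        by (intro vec.subspace_inter subspace_perp)
      have "h p2 p1 \<noteq> 0" "h p3' p1 \<noteq> 0" "h p3' p2 \<noteq> 0"
        using nonorth h_sym_zero by blast+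
      moreover have "i = 1 \<or> i = 2 \<or> i = 3" "j = 1 \<or> j = 2 \<or> j = 3"
        using that(1,2) by auto
      ultimately have "h (p i) (p j) \<noteq> 0"
        using that(3) nonorth by (elim disjE) (simp_all add: p_def)
      then show ?thesis
        using polar_line_secant [OF p(2) p(2)] sub
        unfolding secant_line_def proj_line_def points_of_Int_VV_herm [OF sub] by blast
    qed
    moreover have "tangent_plane (herm_poly q A) (perp (p i))" for i
      using p by (auto simp: tangent_plane_iff)
    moreover have "card (points_of (perp (p 1) \<inter> perp (p 2) \<inter> perp (p 3)) \<inter> V2) = 1"
    proof -
      have "vec.subspace (perp (p 1) \<inter> perp (p 2) \<inter> perp (p 3))"
        by (intro vec.subspace_inter subspace_perp)
      then show ?thesis
        using card3(2) assms(4) by (simp add: points_of_Int_VV_herm p_def)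
    qed
    ultimately show ?thesis by (intro exI [of _ "\<lambda>i. perp (p i)"]) blast
  qed
  have v: "?v \<in> ?S"
  proof -
    obtain F where F: "F \<noteq> 0" "homogeneous 3 F" "{x. peval F x = 0} = perp p1 \<union> perp p2 \<union> perp p3'"
      using three_tangent_planes_cubic [OF iso(1,2) nonorth(1,5)] .
    have "card (VV F \<inter> V2) = ?v"
      using card_three_tangent_planes [of p1 p2 p3'] nz iso nonorth card3(2) F by (simp add: V2_Int)
    then show ?thesis using F(1,2) by force
  qed
  have w: "?w \<in> ?S"
  proof -
    obtain F where F: "F \<noteq> 0" "homogeneous 3 F" "{x. peval F x = 0} = perp p1 \<union> perp p2 \<union> perp p3"
      using three_tangent_planes_cubic [OF iso(1,2) nonorth(1,3)] .
    have "card (VV F \<inter> V2) = ?w"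
      using card_three_tangent_planes [of p1 p2 p3] nz iso nonorth card3(1) F by (simp add: V2_Int)
    then show ?thesis using F(1,2) by force
  qed
  have "second_highest ?S ?v" if q: "4 \<le> q"
  proof -
    have upper: "n \<le> ?v \<or> n = ?w" if n: "n \<in> ?S" for n
    proof -
      from n obtain F where F: "F \<noteq> 0" "homogeneous 3 F" "n = card (VV F \<inter> V2)"
        by (elim CollectE exE conjE)
      have "3 < CARD('a)" using q power_mono [OF q, of 2] by (simp add: card_field)
      then obtain x where "peval F x \<noteq> 0" using peval_not_zero [OF F(1,2)] by blast
      from cubic_section_dichotomy [OF q is_form_peval [OF F(2)] this] show ?thesis
        using F(2,3) by (simp add: V2_Int)
    qed
    have less: "?v < ?w" using q_ge_2 by simp
    show ?thesis
      unfolding second_highest_def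
    proof (intro conjI v ex1I [of _ ?w])
      show "?w \<in> ?S" by (rule w)
      show "?v < ?w" by (rule less)
      fix n assume n: "n \<in> ?S \<and> ?v < n"
      then have "n \<le> ?v \<or> n = ?w" by (intro upper) (rule conjunct1)
      then show "n = ?w" using n by linarith
    qed
  qed
  moreover from v have "\<exists>F :: 'a poly4. F \<noteq> 0 \<and> homogeneous 3 F \<and> card (VV F \<inter> V2) = ?v"
    by (elim CollectE exE conjE) (metis (no_types))
  ultimately show ?thesis using planes by (intro conjI impI)
qed

end
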